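(* Let $p$ be a prime with $p \equiv 1 \pmod{24}$, and let $n\ge0$, $\alpha \geq 0$ be integers. (i) If $p \nmid (24n+7)$ and $B_{7,2} \left(\frac{7(p-1)}{24}\right)\equiv 0 \pmod 7$, then $B_{7,2}\left(p^{2 \alpha +1}n+ \frac{7(p^{2 \alpha+1}-1)}{24}\right) \equiv 0 \pmod 7$. (ii) If $p \nmid (24n+11)$ and $B_{11,2} \left(\frac{11(p-1)}{24}\right)\equiv 0 \pmod{11}$, then $B_{11,2}\left(p^{2 \alpha +1}n+ \frac{11(p^{2 \alpha+1}-1)}{24}\right) \equiv 0 \pmod{11}$. (iii) If $p \nmid (24n+13)$ and $B_{13,2} \left(\frac{13(p-1)}{24}\right)\equiv 0 \pmod{13}$, then $B_{13,2}\left(p^{2 \alpha +1}n+ \frac{13(p^{2 \alpha+1}-1)}{24}\right) \equiv 0 \pmod{13}$.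
   Context: For integers $u,v\ge 2$, $B_{u,v}(n)$ is the number of bipartitions $(\alpha,\beta)$ of $n$ with $\alpha$ having no part divisible by $u$ and $\beta$ having no part divisible by $v$; $B_{u,v}(0)=1$ and $\sum_{n\ge0}B_{u,v}(n)q^n=\frac{f_uf_v}{f_1^2}$, $f_t=\prod_{k\ge1}(1-q^{tk})$. *)

theory Defs
  imports "HOL-Library.Multiset" "HOL-Computational_Algebra.Primes" "HOL-Number_Theory.Cong"
begin

definition regular_partition :: "nat \<Rightarrow> nat multiset \<Rightarrow> bool" where
  "regular_partition u A \<longleftrightarrow> (\<forall>k\<in>#A. k > 0 \<and> \<not> u dvd k)"

definition bipartitions :: "nat \<Rightarrow> nat \<Rightarrow> nat \<Rightarrow> (nat multiset \<times> nat multiset) set" where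
  "bipartitions u v n =
     {(A, C). regular_partition u A \<and> regular_partition v C \<and> \<Sum>\<^sub># A + \<Sum>\<^sub># C = n}"

definition B :: "nat \<Rightarrow> nat \<Rightarrow> nat \<Rightarrow> nat" where
  "B u v n = card (bipartitions u v n)"

(* The cardinality in B is that of a finite set, hence not the default value 0. *)
lemma size_le_sum_mset:
  fixes A :: "nat multiset"
  assumes "\<forall>k\<in>#A. k > 0"
  shows "size A \<le> \<Sum>\<^sub># A"
  using assms by (induction A) auto

lemma finite_bipartitions: "finite (bipartitions u v n)"
proof -
  let ?M = "\<Union>m\<le>n. multisets_of_size {..n} m"
  have in_M: "A \<in> ?M" if "regular_partition w A" "\<Sum>\<^sub># A \<le> n" for w A
  proof -
    have "size A \<le> n"
      using size_le_sum_mset[of A] that by (auto simp: regular_partition_def)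
    moreover have "k \<le> n" if "k \<in># A" for k
      using sum_mset.remove[OF that] \<open>\<Sum>\<^sub># A \<le> n\<close> by linarith
    ultimately show ?thesis
      unfolding multisets_of_size_def by blast
  qed
  have "bipartitions u v n \<subseteq> ?M \<times> ?M"
  proof
    fix x assume "x \<in> bipartitions u v n"
    then obtain A C where x: "x = (A, C)" "regular_partition u A" "regular_partition v C"
      "\<Sum>\<^sub># A + \<Sum>\<^sub># C = n"
      unfolding bipartitions_def by blast
    have "A \<in> ?M" "C \<in> ?M"
      using in_M[OF x(2)] in_M[OF x(3)] x(4) by (metis le_add1, metis le_add2)
    then show "x \<in> ?M \<times> ?M"
      using x(1) by blast
  qed
  moreover have "finite (?M \<times> ?M)"
    by (intro finite_cartesian_product finite_UN_I) auto
  ultimately show ?thesis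
    by (rule finite_subset)
qed

lemma B_0: "B u v 0 = 1"
proof -
  have "A = {#}" if "regular_partition w A" "\<Sum>\<^sub># A = 0" for w A
    using size_le_sum_mset[of A] that by (simp add: regular_partition_def)
  moreover have "regular_partition w {#}" for w
    by (simp add: regular_partition_def)
  ultimately have "bipartitions u v 0 = {({#}, {#})}"
    unfolding bipartitions_def by fastforce
  then show ?thesis
    by (simp add: B_def)
qed

end

theory Submission
  imports Defs "HOL-Complex_Analysis.Complex_Analysis" "HOL-Probability.Probability" "HOL-Number_Theory.Number_Theory"
begin

text \<open>Modulo a prime \<open>l\<close> the generating function of \<open>B l 2\<close> is the eta quotient \<open>f_1^r f_2\<close> with \<open>r = l - 2\<close>,
  because \<open>f_l\<close> is congruent to \<open>f_1^l\<close>. For odd \<open>r \<le> 11\<close> the function \<open>F(z) = \<eta>(z)^r \<eta>(2z)\<close> is an eigenform of the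
  Hecke operator at every prime \<open>p\<close> congruent to 1 modulo 24 (Newman). Indeed the quotient \<open>u\<close> of the
  transformed function by \<open>F\<close> has no poles: \<open>F\<close> has no zeros in the upper half-plane, and at both cusps the leading
  exponent of \<open>F\<close> is less than 24 in the natural unit, so that the Hecke operator cannot lower it.
  Both \<open>u(z)\<close> and \<open>u(-1/z)\<close> are then holomorphic functions on the unit disc in \<open>e(z)\<close> and \<open>e(z/2)\<close>.
  Reducing \<open>z\<close> to \<open>Im z \<ge> 1/2\<close> by translations and inversions, the maximum of \<open>|u|\<close> is attained, and \<open>u\<close> is constant.
  Comparing coefficients yields a two-term recursion for the coefficients of \<open>f_1^r f_2\<close>, whose
  multiplier vanishes modulo \<open>l\<close> by hypothesis; the claim follows by induction on \<open>\<alpha>\<close>.\<close>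

section \<open>Fourier series and theta inversion\<close>

text \<open>The inversion of eta is proved at the points \<open>(\<i> * y + 24 * a) / p\<close>
  only: there all square roots are those of positive reals and Poisson summation for a real Gaussian
  applies. The resulting identity for the Hecke quotients is known on the imaginary axis and spreads
  by analytic continuation. The price is a quadratic Gauss sum for each translate. Since p \<equiv>
  1 (mod 24) makes -1 and 2 squares modulo p, the r + 1 = 2k sums at one translate multiply to p^k,
  exactly the factor that lets the inversion permute the translates. The bound 11 comes from the
  cusp 0. At infinity the leading exponent of F is r + 2 in units of 1/24, but the companion
  function \<open>eta z ^ r * eta (z / 2)\<close> has 2r + 1 in units of 1/48, and 2r + 1 < 24 is
  required. The moduli 7, 11, 13 give r = 5, 9, 11; odd r makes the weight k = (r + 1)/2 an integer.
  Constancy of u is a complex statement, the conclusion an integral one; hence the power series have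
  integer coefficients and are mapped to complex ones for evaluation.\<close>

definition e2pi :: "complex \<Rightarrow> complex" where
  "e2pi z = exp (2 * of_real pi * \<i> * z)"

lemma e2pi_0 [simp]: "e2pi 0 = 1"
  by (simp add: e2pi_def)

lemma e2pi_nonzero [simp]: "e2pi z \<noteq> 0"
  by (simp add: e2pi_def)

lemma e2pi_add: "e2pi (x + y) = e2pi x * e2pi y"
  by (simp add: e2pi_def exp_add ring_distribs)

lemma e2pi_minus: "e2pi (- x) = inverse (e2pi x)"
  by (simp add: e2pi_def exp_minus)

lemma e2pi_of_int [simp]: "e2pi (of_int n) = 1"
  using exp_integer_2pi[of "of_int n"] by (simp add: e2pi_def mult_ac)

lemma e2pi_power: "e2pi z ^ n = e2pi (of_nat n * z)"
  unfolding e2pi_def exp_of_nat_mult[symmetric] by (simp add: mult_ac)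

lemma norm_e2pi: "norm (e2pi z) = exp (- 2 * pi * Im z)"
  by (simp add: e2pi_def norm_exp_eq_Re)

lemma cnj_e2pi_of_real: "cnj (e2pi (of_real x)) = e2pi (- of_real x)"
  by (simp add: e2pi_def exp_cnj)

lemma continuous_on_e2pi [continuous_intros]:
  "continuous_on A f \<Longrightarrow> continuous_on A (\<lambda>x. e2pi (f x))"
  unfolding e2pi_def by (intro continuous_intros)

lemma holomorphic_on_e2pi [holomorphic_intros]:
  "f holomorphic_on A \<Longrightarrow> (\<lambda>x. e2pi (f x)) holomorphic_on A"
  unfolding e2pi_def by (intro holomorphic_intros)

lemma e2pi_eq_1_iff: "e2pi z = 1 \<longleftrightarrow> z \<in> \<int>"
proof
  assume "e2pi z = 1"
  then obtain n :: int where n: "Im (2 * of_real pi * \<i> * z) = of_int (2 * n) * pi" "Re (2 * of_real pi * \<i> * z) = 0"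
    unfolding e2pi_def exp_eq_1 by auto
  then have "z = of_int n" by (auto simp: complex_eq_iff)
  then show "z \<in> \<int>" by simp
qed (auto elim!: Ints_cases)

definition fourier_coeff :: "(real \<Rightarrow> complex) \<Rightarrow> int \<Rightarrow> complex" where
  "fourier_coeff f m = integral {-1/2..1/2} (\<lambda>x. f x * e2pi (- of_int m * of_real x))"

lemma fourier_coeff_e2pi:
  "fourier_coeff (\<lambda>x. e2pi (of_int k * of_real x)) m = (if k = m then 1 else 0)"
proof (cases "k = m")
  case True
  have "(\<lambda>x::real. e2pi (of_int k * of_real x) * e2pi (- of_int m * of_real x)) = (\<lambda>x. 1)"
    using True by (auto simp: e2pi_add[symmetric])
  then show ?thesis using True by (simp add: fourier_coeff_def)
next
  case False
  define c where "c = 2 * of_real pi * \<i> * (of_int (k - m) :: complex)"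
  have c: "c \<noteq> 0" using False by (simp add: c_def)
  have "((\<lambda>x::real. exp (c * of_real x)) has_integral
     (exp (c * of_real (1/2)) / c - exp (c * of_real (-1/2)) / c)) {-1/2..1/2}"
  proof (rule fundamental_theorem_of_calculus)
    fix x :: real assume "x \<in> {-1/2..1/2}"
    have "((\<lambda>z. exp (c * z) / c) has_field_derivative exp (c * of_real x)) (at (of_real x))"
      using c by (auto intro!: derivative_eq_intros)
    then show "((\<lambda>x. exp (c * complex_of_real x) / c) has_vector_derivative exp (c * complex_of_real x)) (at x within {- 1 / 2..1 / 2})"
      using has_vector_derivative_real_field has_vector_derivative_at_within by blast
  qed auto
  moreover have "exp (c * of_real (1/2)) = exp (c * of_real (-1/2))"
  proof -
    have "exp (c * of_real (1/2)) / exp (c * of_real (-1/2)) = exp c"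
      by (simp add: exp_diff[symmetric] algebra_simps)
    also have "exp c = e2pi (of_int (k-m))" by (simp add: c_def e2pi_def)
    also have "\<dots> = 1" by (rule e2pi_of_int)
    finally show ?thesis by (simp add: field_simps)
  qed
  moreover have "(\<lambda>x::real. e2pi (of_int k * of_real x) * e2pi (- of_int m * of_real x)) = (\<lambda>x. exp (c * of_real x))"
    by (auto simp: e2pi_def exp_add[symmetric] c_def algebra_simps)
  ultimately show ?thesis using False by (auto simp: fourier_coeff_def integral_unique)
qed

text \<open>\<open>S\<close> is the orthogonal projection of \<open>g\<close> onto the span of the
  exponentials indexed by \<open>M\<close>, so its squared norm is the sum of the squared
  coefficients, and \<open>g - S\<close> is orthogonal to it.\<close>

lemma bessel_inequality:
  assumes g: "continuous_on {-1/2..1/2} g" and M: "finite M"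
  shows "(\<Sum>m\<in>M. norm (fourier_coeff g m) ^ 2) \<le> integral {-1/2..1/2} (\<lambda>x. norm (g x) ^ 2)"
proof -
  let ?I = "{-1/2..1/2::real}"
  define e where "e m x = e2pi (of_int m * of_real x)" for m :: int and x :: real
  have cnje: "cnj (e m x) = e2pi (- of_int m * of_real x)" for m x
    using cnj_e2pi_of_real[of "of_int m * x"] by (simp add: e_def)
  have ce: "continuous_on ?I (e m)" for m unfolding e_def by (intro continuous_intros)
  define c where "c = fourier_coeff g"
  have c: "c m = integral ?I (\<lambda>x. g x * cnj (e m x))" for m
    unfolding c_def fourier_coeff_def cnje ..
  have orth: "integral ?I (\<lambda>x. e k x * cnj (e m x)) = (if k = m then 1 else 0)" for k m
    using fourier_coeff_e2pi[of k m] unfolding fourier_coeff_def cnje unfolding e_def .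
  define S where "S x = (\<Sum>m\<in>M. c m * e m x)" for x
  have cS: "continuous_on ?I S" unfolding S_def by (intro continuous_intros ce)
  note cc = continuous_intros g cS ce
  have integ: "f integrable_on ?I" if "continuous_on ?I f" for f :: "real \<Rightarrow> complex"
    using that by (rule integrable_continuous_real)
  have Sw: "S x * w = (\<Sum>k\<in>M. c k * (e k x * w))" for w x
    unfolding S_def by (simp add: sum_distrib_right mult.assoc)
  have S_e: "integral ?I (\<lambda>x. S x * cnj (e m x)) = c m" if "m \<in> M" for m
  proof -
    have "integral ?I (\<lambda>x. S x * cnj (e m x)) = integral ?I (\<lambda>x. \<Sum>k\<in>M. c k * (e k x * cnj (e m x)))"
      unfolding Sw ..
    also have "\<dots> = (\<Sum>k\<in>M. integral ?I (\<lambda>x. c k * (e k x * cnj (e m x))))"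
      by (intro integral_sum M integ cc)
    also have "\<dots> = (\<Sum>k\<in>M. c k * (if k = m then 1 else 0))"
      by (simp only: integral_mult_right orth)
    also have "\<dots> = c m" using that M by (simp add: sum.delta' if_distrib cong: if_cong)
    finally show ?thesis .
  qed
  have gS_e: "integral ?I (\<lambda>x. (g x - S x) * cnj (e m x)) = 0" if "m \<in> M" for m
  proof -
    have "integral ?I (\<lambda>x. (g x - S x) * cnj (e m x)) = integral ?I (\<lambda>x. g x * cnj (e m x)) - integral ?I (\<lambda>x. S x * cnj (e m x))"
      unfolding left_diff_distrib by (intro integral_diff integ cc)
    then show ?thesis using S_e[OF that] c by simp
  qed
  have cnjS: "w * cnj (S x) = (\<Sum>m\<in>M. cnj (c m) * (w * cnj (e m x)))" for w x
    unfolding S_def by (simp add: sum_distrib_left mult_ac)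
  have gS_S: "integral ?I (\<lambda>x. (g x - S x) * cnj (S x)) = 0"
  proof -
    have "integral ?I (\<lambda>x. (g x - S x) * cnj (S x)) = integral ?I (\<lambda>x. \<Sum>m\<in>M. cnj (c m) * ((g x - S x) * cnj (e m x)))"
      unfolding cnjS ..
    also have "\<dots> = (\<Sum>m\<in>M. integral ?I (\<lambda>x. cnj (c m) * ((g x - S x) * cnj (e m x))))"
      by (intro integral_sum M integ cc)
    also have "\<dots> = 0" using gS_e by simp
    finally show ?thesis .
  qed
  have S_S: "integral ?I (\<lambda>x. S x * cnj (S x)) = (\<Sum>m\<in>M. cnj (c m) * c m)"
  proof -
    have "integral ?I (\<lambda>x. S x * cnj (S x)) = integral ?I (\<lambda>x. \<Sum>m\<in>M. cnj (c m) * (S x * cnj (e m x)))"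
      unfolding cnjS ..
    also have "\<dots> = (\<Sum>m\<in>M. integral ?I (\<lambda>x. cnj (c m) * (S x * cnj (e m x))))"
      by (intro integral_sum M integ cc)
    also have "\<dots> = (\<Sum>m\<in>M. cnj (c m) * c m)" using S_e by simp
    finally show ?thesis .
  qed
  have re: "norm (w :: complex) ^ 2 = Re (w * cnj w)" for w
    by (simp add: complex_mult_cnj cmod_power2)
  have Re_int: "integral ?I (\<lambda>x. Re (f x)) = Re (integral ?I f)" if "continuous_on ?I f" for f
    using integral_linear[OF integ[OF that] bounded_linear_Re] by (simp add: o_def)
  have "(\<Sum>m\<in>M. norm (c m) ^ 2) = Re (integral ?I (\<lambda>x. S x * cnj (S x)) + 2 * integral ?I (\<lambda>x. (g x - S x) * cnj (S x)))"
    unfolding gS_S S_S re by (simp add: mult.commute)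
  also have "\<dots> = integral ?I (\<lambda>x. Re (S x * cnj (S x) + 2 * ((g x - S x) * cnj (S x))))"
  proof -
    have "integral ?I (\<lambda>x. S x * cnj (S x) + 2 * ((g x - S x) * cnj (S x))) =
      integral ?I (\<lambda>x. S x * cnj (S x)) + integral ?I (\<lambda>x. 2 * ((g x - S x) * cnj (S x)))"
      by (intro integral_add integ cc)
    then show ?thesis by (subst Re_int, intro cc) (simp only: integral_mult_right)
  qed
  also have "\<dots> \<le> integral ?I (\<lambda>x. norm (g x) ^ 2)"
  proof (rule integral_le)
    show "(\<lambda>x. Re (S x * cnj (S x) + 2 * ((g x - S x) * cnj (S x)))) integrable_on ?I"
      by (intro integrable_continuous_real cc)
    show "(\<lambda>x. norm (g x) ^ 2) integrable_on ?I"
      by (intro integrable_continuous_real cc)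
    fix x
    \<comment> \<open>The gap between the two integrands is |g - S|^2.\<close>
    have "0 \<le> (Re (g x) - Re (S x))^2 + (Im (g x) - Im (S x))^2" by simp
    then show "Re (S x * cnj (S x) + 2 * ((g x - S x) * cnj (S x))) \<le> norm (g x) ^ 2"
      unfolding cmod_power2 by (simp add: power2_eq_square algebra_simps)
  qed
  finally show ?thesis by (simp add: c_def)
qed

text \<open>Riemann-Lebesgue: by Bessel the squared coefficients along distinct indices are
  summable. The general \<open>h\<close> serves both ends of a symmetric partial sum, the indices N
  and -N - 1.\<close>

lemma fourier_coeff_tendsto_0:
  assumes g: "continuous_on {-1/2..1/2} g" and inj: "inj (h :: nat \<Rightarrow> int)"
  shows "(\<lambda>N. fourier_coeff g (h N)) \<longlonglongrightarrow> 0"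
proof -
  have "summable (\<lambda>N. norm (fourier_coeff g (h N)) ^ 2)"
  proof (rule summableI_nonneg_bounded)
    fix n
    have "(\<Sum>i<n. norm (fourier_coeff g (h i)) ^ 2) = (\<Sum>m\<in>h ` {..<n}. norm (fourier_coeff g m) ^ 2)"
      using inj by (subst sum.reindex) (auto intro: inj_on_subset)
    also have "\<dots> \<le> integral {-1/2..1/2} (\<lambda>x. norm (g x) ^ 2)"
      by (intro bessel_inequality g) auto
    finally show "(\<Sum>i<n. norm (fourier_coeff g (h i)) ^ 2) \<le> integral {-1/2..1/2} (\<lambda>x. norm (g x) ^ 2)" .
  qed auto
  from summable_LIMSEQ_zero[OF this] have "(\<lambda>N. sqrt (norm (fourier_coeff g (h N)) ^ 2)) \<longlonglongrightarrow> sqrt 0"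
    by (rule tendsto_real_sqrt)
  then show ?thesis by (simp add: tendsto_norm_zero_iff)
qed

lemma has_vector_derivative_tendsto_quotient:
  fixes f :: "real \<Rightarrow> complex"
  assumes "(f has_vector_derivative D) (at 0)"
  shows "(\<lambda>x. (f x - f 0) / of_real x) \<midarrow>0\<rightarrow> D"
proof -
  have "((\<lambda>x. norm (f x - f 0 - x *\<^sub>R D) / norm x) \<longlongrightarrow> 0) (at 0)"
    using assms by (simp add: has_vector_derivative_def has_derivative_iff_norm)
  moreover have "norm (f x - f 0 - x *\<^sub>R D) / norm x = norm ((f x - f 0) / of_real x - D)" if "x \<noteq> 0" for x
  proof -
    have "(f x - f 0) / of_real x - D = (f x - f 0 - x *\<^sub>R D) / of_real x"
      using that by (simp add: scaleR_conv_of_real field_simps)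
    then show ?thesis by (simp add: norm_divide)
  qed
  then have "eventually (\<lambda>x. norm (f x - f 0 - x *\<^sub>R D) / norm x = norm ((f x - f 0) / of_real x - D)) (at (0::real))"
    by (auto simp: eventually_at_filter)
  ultimately have "((\<lambda>x. norm ((f x - f 0) / of_real x - D)) \<longlongrightarrow> 0) (at 0)"
    by (rule Lim_transform_eventually)
  then show ?thesis by (subst Lim_null) (rule tendsto_norm_zero_cancel)
qed

text \<open>Chernoff's argument: dividing \<open>\<Phi> - \<Phi> 0\<close> by \<open>e2pi x - 1\<close> makes the partial sums telescope.\<close>

lemma fourier_series_at_0:
  fixes \<Phi> :: "real \<Rightarrow> complex"
  assumes cont: "continuous_on {-1/2..1/2} \<Phi>" and D: "(\<Phi> has_vector_derivative D) (at 0)"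
  shows "(\<lambda>N. \<Sum>m\<in>{-int N..int N}. fourier_coeff \<Phi> m) \<longlonglongrightarrow> \<Phi> 0"
proof -
  let ?I = "{-1/2..1/2::real}"
  \<comment> \<open>The value at 0 is the quotient of the derivatives of \<Phi> and of
    \<open>e2pi\<close> at 0, which removes the singularity and makes \<open>g\<close>
    continuous.\<close>
  define g where "g x = (if x = 0 then D / (2 * pi * \<i>) else (\<Phi> x - \<Phi> 0) / (e2pi (of_real x) - 1))" for x :: real
  have ne: "e2pi (of_real x) \<noteq> 1" if "x \<in> ?I" "x \<noteq> 0" for x :: real
  proof
    assume "e2pi (of_real x) = 1"
    then obtain n where "complex_of_real x = of_int n" by (auto simp: e2pi_eq_1_iff elim: Ints_cases)
    then have "x = of_int n" by (metis of_real_eq_iff of_real_of_int_eq)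
    then show False using that by auto
  qed
  have g_eq: "g x * (e2pi (of_real x) - 1) = \<Phi> x - \<Phi> 0" if "x \<in> ?I" for x
    using ne[OF that] by (auto simp: g_def)
  have "((\<lambda>x. e2pi (of_real x)) has_vector_derivative 2 * pi * \<i>) (at 0)"
  proof -
    have "(e2pi has_field_derivative 2 * pi * \<i>) (at (of_real 0))"
      unfolding e2pi_def by (auto intro!: derivative_eq_intros)
    then show ?thesis by (rule has_vector_derivative_real_field)
  qed
  from tendsto_divide[OF has_vector_derivative_tendsto_quotient[OF D] has_vector_derivative_tendsto_quotient[OF this]]
  have "(\<lambda>x. ((\<Phi> x - \<Phi> 0) / of_real x) / ((e2pi (of_real x) - 1) / of_real x)) \<midarrow>0\<rightarrow> D / (2 * pi * \<i>)"
    by simp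
  moreover have "eventually (\<lambda>x. ((\<Phi> x - \<Phi> 0) / of_real x) / ((e2pi (of_real x) - 1) / of_real x) = g x) (at (0::real))"
    unfolding eventually_at_filter by (auto simp: g_def)
  ultimately have "g \<midarrow>0\<rightarrow> D / (2 * pi * \<i>)"
    by (rule Lim_transform_eventually)
  then have lim_g: "g \<midarrow>0\<rightarrow> g 0"
    by (simp add: g_def[of 0])
  have cont_g: "continuous_on ?I g"
  proof (unfold continuous_on_eq_continuous_within, intro ballI)
    fix x assume x: "x \<in> ?I"
    show "continuous (at x within ?I) g"
    proof (cases "x = 0")
      case True
      then show ?thesis using lim_g
        by (auto simp: continuous_within intro: tendsto_within_subset)
    next
      case False
      have "continuous_on (?I - {0}) (\<lambda>x. (\<Phi> x - \<Phi> 0) / (e2pi (of_real x) - 1))"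
        by (intro continuous_intros continuous_on_subset[OF cont]) (use ne in auto)
      then have "continuous_on (?I - {0}) g"
        by (rule continuous_on_eq) (auto simp: g_def)
      then have "continuous (at x within (?I - {0})) g"
        using x False by (auto simp: continuous_on_eq_continuous_within)
      moreover have "at x within (?I - {0}) = at x within ?I"
        using False by (intro at_within_nhd[of x "-{0}"]) auto
      ultimately show ?thesis by simp
    qed
  qed
  \<comment> \<open>Multiplication by \<open>e2pi x\<close> lowers the index of a Fourier
    coefficient by one, so multiplying \<open>g\<close> by \<open>e2pi x - 1\<close> produces
    differences of neighbouring coefficients; the constant \<Phi> 0 is seen at index 0 only.\<close>
  have coeff: "fourier_coeff \<Phi> m - (if m = 0 then \<Phi> 0 else 0) = fourier_coeff g (m - 1) - fourier_coeff g m" for m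
  proof -
    let ?e = "\<lambda>m x. e2pi (- of_int m * of_real x) :: complex"
    note cc = integrable_continuous_real continuous_intros cont cont_g
    have "fourier_coeff g (m - 1) - fourier_coeff g m = integral ?I (\<lambda>x. g x * ?e (m - 1) x - g x * ?e m x)"
      unfolding fourier_coeff_def by (rule integral_diff[symmetric]; intro cc)
    also have "\<dots> = integral ?I (\<lambda>x. (\<Phi> x * ?e m x) - \<Phi> 0 * ?e m x)"
    proof (rule integral_cong)
      fix x assume x: "x \<in> ?I"
      have "?e (m - 1) x = e2pi (of_real x) * ?e m x"
        by (simp add: e2pi_add[symmetric] algebra_simps)
      then have "g x * ?e (m - 1) x - g x * ?e m x = (g x * (e2pi (of_real x) - 1)) * ?e m x"
        by (simp add: algebra_simps)
      then show "g x * ?e (m - 1) x - g x * ?e m x = (\<Phi> x * ?e m x) - \<Phi> 0 * ?e m x"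
        unfolding g_eq[OF x] by (simp add: algebra_simps)
    qed
    also have "\<dots> = fourier_coeff \<Phi> m - integral ?I (\<lambda>x. \<Phi> 0 * ?e m x)"
      unfolding fourier_coeff_def by (rule integral_diff; intro cc)
    also have "integral ?I (\<lambda>x. \<Phi> 0 * ?e m x) = \<Phi> 0 * integral ?I (?e m)"
      by simp
    also have "integral ?I (?e m) = (if m = 0 then 1 else 0)"
      using fourier_coeff_e2pi[of 0 m] by (simp add: fourier_coeff_def)
    finally show ?thesis by simp
  qed
  have "(\<Sum>m\<in>{-int N..int N}. fourier_coeff \<Phi> m) = \<Phi> 0 + (fourier_coeff g (-int N - 1) - fourier_coeff g (int N))" for N
  proof -
    have "(\<Sum>m\<in>{-int N..int N}. fourier_coeff g (m - 1) - fourier_coeff g m) = fourier_coeff g (-int N - 1) - fourier_coeff g (int N)"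
    proof (induction N)
      case (Suc N)
      have "{-int (Suc N)..int (Suc N)} = insert (-int N - 1) (insert (int N + 1) {-int N..int N})" by auto
      then show ?case using Suc by (simp add: add.commute)
    qed simp
    moreover have "(\<Sum>m\<in>{-int N..int N}. fourier_coeff \<Phi> m - (if m = 0 then \<Phi> 0 else 0)) = (\<Sum>m\<in>{-int N..int N}. fourier_coeff \<Phi> m) - \<Phi> 0"
      by (simp add: sum_subtractf)
    ultimately show ?thesis unfolding coeff by (simp add: algebra_simps)
  qed
  moreover have "(\<lambda>N. \<Phi> 0 + (fourier_coeff g (-int N - 1) - fourier_coeff g (int N))) \<longlonglongrightarrow> \<Phi> 0 + (0 - 0)"
    by (intro tendsto_intros fourier_coeff_tendsto_0 cont_g) (auto simp: inj_def)
  ultimately show ?thesis by simp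
qed

section \<open>Poisson summation for the Gaussian\<close>

lemma summable_on_intI:
  fixes f :: "int \<Rightarrow> real"
  assumes "(\<lambda>n. f (int n)) summable_on UNIV" "(\<lambda>n. f (- int n)) summable_on UNIV"
  shows "f summable_on UNIV"
proof -
  have "f summable_on range int"
    using assms(1) by (subst summable_on_reindex) (auto simp: o_def)
  moreover have "f summable_on range (\<lambda>n. - int n)"
    using assms(2) by (subst summable_on_reindex) (auto simp: o_def inj_def)
  ultimately have "f summable_on (range int \<union> range (\<lambda>n. - int n))"
    by (rule summable_on_union)
  moreover have "range int \<union> range (\<lambda>n. - int n) = UNIV"
  proof (intro equalityI subsetI)
    fix x :: int assume "x \<in> UNIV"
    show "x \<in> range int \<union> range (\<lambda>n. - int n)" by (cases x rule: int_cases2) auto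
  qed auto
  ultimately show ?thesis by simp
qed

lemma summable_on_int_exp_square:
  assumes a: "(a::real) > 0"
  shows "(\<lambda>n::int. exp (- a * of_int n ^ 2)) summable_on UNIV"
proof -
  have "(\<lambda>n::nat. exp (- a * real n ^ 2)) summable_on UNIV"
  proof (rule summable_nonneg_imp_summable_on)
    show "summable (\<lambda>n::nat. exp (- a * real n ^ 2))"
    proof (rule summable_comparison_test[OF _ summable_geometric], intro exI allI impI)
      show "norm (exp (-a)) < 1" using a by simp
      fix n :: nat
      have "real n \<le> real n ^ 2" by (cases n) (auto simp: power2_eq_square)
      then have "- a * real n ^ 2 \<le> real n * (- a)" using a by simp
      then show "norm (exp (- a * real n ^ 2)) \<le> exp (-a) ^ n"
        by (simp add: exp_of_nat_mult[symmetric])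
    qed
  qed auto
  then show ?thesis by (intro summable_on_intI) auto
qed

text \<open>This is the characteristic function of the standard normal distribution after the affine
  substitution x \<mapsto> c (x + x0) with c^2 = 2 pi t, which turns exp (-x^2 / 2) into the shifted
  Gaussian; the shift x0 comes out as a phase.\<close>

lemma gauss_fourier_transform:
  fixes t s x0 :: real
  assumes t: "t > 0"
  defines "f \<equiv> \<lambda>x. of_real (exp (- pi * t * (x + x0)^2)) * e2pi (- of_real (s * x))"
  shows "integrable lborel f"
    and "(LINT x|lborel. f x) = e2pi (of_real (s * x0)) * of_real (exp (- pi * s^2 / t) / sqrt t)"
proof -
  define c where "c = sqrt (2 * pi * t)"
  have c: "c > 0" using t by (simp add: c_def)
  have c2: "c^2 = 2 * pi * t" using t by (simp add: c_def)
  define g where "g x = of_real (std_normal_density x) * iexp (- 2 * pi * s / c * x)" for x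
  have "integrable lborel (\<lambda>x. of_real (std_normal_density x) * (1::complex))"
    using integrable_of_real[OF integrable_normal_density[of 1 0]] by simp
  then have g_int: "integrable lborel g"
  proof (rule Bochner_Integration.integrable_bound)
    show "g \<in> borel_measurable lborel" unfolding g_def by measurable
  qed (auto simp: g_def norm_mult)
  have "(LINT x|lborel. g x) = char std_normal_distribution (- 2 * pi * s / c)"
    unfolding char_def g_def by (subst integral_density) (auto simp: scaleR_conv_of_real)
  also have "\<dots> = of_real (exp (- (4 * pi^2 * s^2 / c^2) / 2))"
    by (simp add: char_std_normal_distribution power_divide power_mult_distrib)
  also have "- (4 * pi^2 * s^2 / c^2) / 2 = - pi * s^2 / t"
    unfolding c2 using t by (simp add: field_simps power2_eq_square)
  finally have g_val: "(LINT x|lborel. g x) = of_real (exp (- pi * s^2 / t))" .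
  have gf: "g (c * x0 + c * x) = of_real (1 / sqrt (2 * pi)) * e2pi (- of_real (s * x0)) * f x" for x
  proof -
    have "(c * x0 + c * x)^2 = c^2 * (x + x0)^2" by (simp add: power2_eq_square algebra_simps)
    then have "std_normal_density (c * x0 + c * x) = 1 / sqrt (2 * pi) * exp (- pi * t * (x + x0)^2)"
      by (simp add: std_normal_density_def c2)
    moreover have "- 2 * pi * s / c * (c * x0 + c * x) = 2 * pi * (- (s * x0) - s * x)"
      using c by (simp add: field_simps)
    then have "iexp (- 2 * pi * s / c * (c * x0 + c * x)) = e2pi (of_real (- (s * x0) - s * x))"
      by (simp add: e2pi_def mult_ac)
    moreover have "e2pi (of_real (- (s * x0) - s * x)) = e2pi (- of_real (s * x0)) * e2pi (- of_real (s * x))"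
      by (simp add: e2pi_add[symmetric])
    ultimately show ?thesis unfolding g_def f_def by (simp add: mult_ac)
  qed
  have "integrable lborel (\<lambda>x. g (c * x0 + c * x))"
    using c by (intro lborel_integrable_real_affine g_int) auto
  then have "integrable lborel (\<lambda>x. (of_real (sqrt (2 * pi)) * e2pi (of_real (s * x0))) * g (c * x0 + c * x))"
    by (rule integrable_mult_right)
  also have "(\<lambda>x. (of_real (sqrt (2 * pi)) * e2pi (of_real (s * x0))) * g (c * x0 + c * x)) = f"
    unfolding gf by (simp add: e2pi_minus field_simps fun_eq_iff flip: of_real_mult)
  finally show "integrable lborel f" .
  have "of_real (exp (- pi * s^2 / t)) = of_real c * (LINT x|lborel. g (c * x0 + c * x))"
    using c lborel_integral_real_affine[of c g "c * x0"] g_val by (simp add: scaleR_conv_of_real)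
  also have "\<dots> = of_real c * (of_real (1 / sqrt (2 * pi)) * e2pi (- of_real (s * x0)) * (LINT x|lborel. f x))"
    unfolding gf by simp
  also have "\<dots> = of_real (c / sqrt (2 * pi)) * (e2pi (- of_real (s * x0)) * (LINT x|lborel. f x))"
    by simp
  also have "c / sqrt (2 * pi) = sqrt t"
    by (simp add: c_def real_sqrt_mult)
  finally show "(LINT x|lborel. f x) = e2pi (of_real (s * x0)) * of_real (exp (- pi * s^2 / t) / sqrt t)"
    using t by (simp add: e2pi_minus field_simps)
qed

text \<open>The shift is complex so that the sum over n is holomorphic in it. Differentiability at a
  real point, required for the convergence of the Fourier series, then comes for free.\<close>

definition gauss_term :: "real \<Rightarrow> complex \<Rightarrow> int \<Rightarrow> complex" where
  "gauss_term t z n = exp (- of_real (pi * t) * (of_int n + z)^2)"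

text \<open>The real part of (n + z)^2 is (n + Re z)^2 - (Im z)^2, which by completing the square is
  at least n^2 / 2 - |z|^2. The majorant is uniform for z in a disc, as the Weierstrass test
  demands.\<close>

lemma norm_gauss_term_le:
  assumes t: "t > 0" and z: "norm z \<le> R"
  shows "norm (gauss_term t z n) \<le> exp (pi * t * R^2) * exp (- (pi * t / 2) * of_int n ^ 2)"
proof -
  have "norm z ^ 2 \<le> R^2" using z by (intro power_mono) auto
  then have z2: "Re z ^ 2 + Im z ^ 2 \<le> R^2" by (simp add: cmod_power2)
  have "0 \<le> (of_int n / 2 + Re z)^2 * 2" by simp
  then have "of_int n ^ 2 / 2 - R^2 \<le> (of_int n + Re z)^2 - Im z ^2"
    using z2 by (simp add: power2_eq_square algebra_simps)
  then have "pi * t * (of_int n ^ 2 / 2 - R^2) \<le> pi * t * ((of_int n + Re z)^2 - Im z ^2)"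
    using t by (intro mult_left_mono) auto
  moreover have "norm (gauss_term t z n) = exp (- (pi * t * ((of_int n + Re z)^2 - Im z ^2)))"
    by (simp add: gauss_term_def power2_eq_square)
  ultimately show ?thesis by (simp add: exp_add[symmetric] algebra_simps)
qed

lemma gauss_bound_summable:
  "t > 0 \<Longrightarrow> (\<lambda>n::int. exp (pi * t * R^2) * exp (- (pi * t / 2) * of_int n ^ 2)) summable_on UNIV"
  by (intro summable_on_cmult_right summable_on_int_exp_square) auto

lemma uniform_limit_gauss:
  assumes "t > 0"
  shows "uniform_limit (cball 0 R) (\<lambda>X z. \<Sum>n\<in>X. gauss_term t z n) (\<lambda>z. \<Sum>\<^sub>\<infinity>n. gauss_term t z n) (finite_subsets_at_top UNIV)"
  using assms by (intro Weierstrass_m_test_general[OF _ gauss_bound_summable[of t R]] norm_gauss_term_le) auto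

lemma gauss_term_summable:
  assumes "t > 0" shows "gauss_term t z summable_on UNIV"
  by (rule abs_summable_summable, rule summable_on_comparison_test[OF gauss_bound_summable[of t "norm z"]])
     (use assms norm_gauss_term_le in auto)

lemma gauss_sum_holomorphic:
  assumes t: "t > 0"
  shows "(\<lambda>z. \<Sum>\<^sub>\<infinity>n. gauss_term t z n) holomorphic_on UNIV"
proof -
  have "(\<lambda>z. \<Sum>\<^sub>\<infinity>n. gauss_term t z n) holomorphic_on ball 0 R" for R
  proof (rule holomorphic_uniform_limit[OF _ uniform_limit_gauss[OF t]])
    show "\<forall>\<^sub>F X in finite_subsets_at_top UNIV. continuous_on (cball 0 R) (\<lambda>z. \<Sum>n\<in>X. gauss_term t z n) \<and>
       (\<lambda>z. \<Sum>n\<in>X. gauss_term t z n) holomorphic_on ball 0 R"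
      unfolding gauss_term_def
      by (intro always_eventually allI conjI holomorphic_intros holomorphic_on_imp_continuous_on)
  qed auto
  moreover have "z \<in> ball 0 (norm z + 1)" for z :: complex by simp
  ultimately have "(\<lambda>z. \<Sum>\<^sub>\<infinity>n. gauss_term t z n) field_differentiable at z" for z
    using holomorphic_on_imp_differentiable_at[OF _ open_ball] by blast
  then show ?thesis by (simp add: holomorphic_on_def field_differentiable_at_within)
qed

lemma filterlim_symmetric_int_intervals:
  "filterlim (\<lambda>N. {-int N..int N}) (finite_subsets_at_top UNIV) sequentially"
  unfolding filterlim_finite_subsets_at_top
proof (intro allI impI)
  fix X :: "int set" assume X: "finite X \<and> X \<subseteq> UNIV"
  define B where "B = Max (insert 0 ((\<lambda>x. nat \<bar>x\<bar>) ` X))"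
  have "nat \<bar>x\<bar> \<le> B" if "x \<in> X" for x
    unfolding B_def using X that by (intro Max_ge) auto
  then have "X \<subseteq> {-int N..int N}" if "N \<ge> B" for N
    using that by fastforce
  then show "\<forall>\<^sub>F N in sequentially. finite {-int N..int N} \<and> X \<subseteq> {-int N..int N} \<and> {-int N..int N} \<subseteq> UNIV"
    by (auto simp: eventually_sequentially intro!: exI[of _ B])
qed

text \<open>Unfolding: integer translation does not change the exponential, so the integrals of the
  translates over one period join to integrals over growing intervals of the line. The coefficient
  is thus the Fourier transform of a single Gaussian; uniform convergence on the period permits the
  interchange.\<close>

lemma fourier_coeff_gauss_sum:
  fixes x0 :: real
  assumes t: "t > 0"
  shows "fourier_coeff (\<lambda>x. \<Sum>\<^sub>\<infinity>n. gauss_term t (of_real (x0 + x)) n) m =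
    e2pi (of_int m * of_real x0) * of_real (exp (- pi * (of_int m)^2 / t) / sqrt t)"
proof -
  let ?I = "{-1/2..1/2::real}"
  let ?e = "\<lambda>x::real. e2pi (- of_int m * of_real x)"
  define f where "f x = of_real (exp (- pi * t * (x + x0)^2)) * e2pi (- of_real (of_int m * x))" for x :: real
  have cf: "continuous_on A f" for A unfolding f_def by (intro continuous_intros)
  have term_eq: "gauss_term t (of_real (x0 + x)) n * ?e x = f (x + of_int n)" for n x
  proof -
    have "gauss_term t (of_real (x0 + x)) n = of_real (exp (- pi * t * (x + of_int n + x0)^2))"
      by (simp add: gauss_term_def exp_of_real[symmetric] algebra_simps)
    moreover have "e2pi (- of_real (of_int m * (x + of_int n))) = ?e x * e2pi (of_int (- m * n))"
      unfolding e2pi_add[symmetric] by (simp add: algebra_simps)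
    ultimately show ?thesis unfolding f_def e2pi_of_int by simp
  qed
  have ul: "uniform_limit ?I (\<lambda>N x. \<Sum>n\<in>{-int N..int N}. f (x + of_int n))
     (\<lambda>x. (\<Sum>\<^sub>\<infinity>n. gauss_term t (of_real (x0 + x)) n) * ?e x) sequentially"
  proof -
    have b: "norm (complex_of_real (x0 + x)) \<le> \<bar>x0\<bar> + 1/2" if "x \<in> ?I" for x
      using that by (auto simp: norm_of_real simp del: of_real_add)
    have "uniform_limit ?I (\<lambda>X x. \<Sum>n\<in>X. gauss_term t (of_real (x0 + x)) n * ?e x)
       (\<lambda>x. \<Sum>\<^sub>\<infinity>n. gauss_term t (of_real (x0 + x)) n * ?e x) (finite_subsets_at_top UNIV)"
    proof (intro Weierstrass_m_test_general[OF _ gauss_bound_summable[of t "\<bar>x0\<bar> + 1/2"]])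
      fix n x assume "x \<in> ?I"
      have "norm (?e x) = 1" by (simp add: norm_e2pi)
      then show "norm (gauss_term t (of_real (x0 + x)) n * ?e x) \<le> exp (pi * t * (\<bar>x0\<bar> + 1/2)^2) * exp (- (pi * t / 2) * of_int n ^ 2)"
        using norm_gauss_term_le[OF t b[OF \<open>x \<in> ?I\<close>], of n] by (simp add: norm_mult)
    qed (use t in auto)
    from filterlim_compose[OF this filterlim_symmetric_int_intervals]
    have "uniform_limit ?I (\<lambda>N x. \<Sum>n\<in>{-int N..int N}. gauss_term t (of_real (x0 + x)) n * ?e x)
       (\<lambda>x. \<Sum>\<^sub>\<infinity>n. gauss_term t (of_real (x0 + x)) n * ?e x) sequentially" .
    moreover have "(\<Sum>\<^sub>\<infinity>n. gauss_term t (of_real (x0 + x)) n) * ?e x = (\<Sum>\<^sub>\<infinity>n. f (x + of_int n))" for x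
      unfolding term_eq[symmetric] by (rule infsum_cmult_left[symmetric]) (rule gauss_term_summable[OF t])
    ultimately show ?thesis unfolding term_eq by simp
  qed
  have shift: "integral ?I (\<lambda>x. f (x + c)) = integral {c-1/2..c+1/2} f" for c :: real
    using integral_shift_Icc_real[of "-1/2" "1/2" f c] by (simp add: o_def algebra_simps)
  have partial: "integral ?I (\<lambda>x. \<Sum>n\<in>{-int N..int N}. f (x + of_int n)) = integral {-real N - 1/2..real N + 1/2} f" for N
  proof -
    have "integral ?I (\<lambda>x. \<Sum>n\<in>{-int N..int N}. f (x + of_int n)) = (\<Sum>n\<in>{-int N..int N}. integral ?I (\<lambda>x. f (x + of_int n)))"
      by (intro integral_sum integrable_continuous_real continuous_on_compose2[OF cf[of UNIV]] continuous_intros) auto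
    also have "\<dots> = (\<Sum>n\<in>{-int N..int N}. integral {of_int n - 1/2..of_int n + 1/2} f)"
      unfolding shift ..
    also have "\<dots> = integral {-real N - 1/2..real N + 1/2} f"
    proof (induction N)
      case (Suc N)
      have *: "{-int (Suc N)..int (Suc N)} = insert (-int N - 1) (insert (int N + 1) {-int N..int N})" by auto
      have fi: "f integrable_on {a..b}" for a b by (intro integrable_continuous_real cf)
      have "integral {- real N - 3/2..real N + 3/2} f =
        integral {- real N - 3/2..- real N - 1/2} f + integral {- real N - 1/2..real N + 1/2} f + integral {real N + 1/2..real N + 3/2} f"
        by (subst Henstock_Kurzweil_Integration.integral_combine, simp_all add: fi)+
      then show ?case unfolding * using Suc.IH by (simp add: algebra_simps)
    qed simp
    finally show ?thesis .
  qed
  have lim1: "(\<lambda>N. integral {-real N - 1/2..real N + 1/2} f) \<longlonglongrightarrow>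
     fourier_coeff (\<lambda>x. \<Sum>\<^sub>\<infinity>n. gauss_term t (of_real (x0 + x)) n) m"
    unfolding partial[symmetric] fourier_coeff_def
  proof (rule uniform_limit_integral[OF ul, THEN exE])
    show "continuous_on ?I (\<lambda>x. \<Sum>n\<in>{-int N..int N}. f (x + of_int n))" for N
      by (intro continuous_on_compose2[OF cf[of UNIV]] continuous_intros) auto
  qed (auto simp: has_integral_iff)
  have fint: "integrable lborel f"
    unfolding f_def by (rule gauss_fourier_transform[OF t])
  have lim2: "(\<lambda>N. integral {-real N - 1/2..real N + 1/2} f) \<longlonglongrightarrow> (LINT x|lborel. f x)"
  proof -
    have si: "set_integrable lborel {a..b} f" for a b
      unfolding set_integrable_def using fint by (intro integrable_mult_indicator) auto
    have "(\<lambda>N. LINT x|lborel. indicator {-real N - 1/2..real N + 1/2} x *\<^sub>R f x) \<longlonglongrightarrow> (LINT x|lborel. f x)"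
    proof (rule integral_dominated_convergence[where w = "\<lambda>x. norm (f x)"])
      show "AE x in lborel. (\<lambda>N. indicator {-real N - 1/2..real N + 1/2} x *\<^sub>R f x) \<longlonglongrightarrow> f x"
      proof (intro AE_I2 tendsto_eventually)
        fix x :: real
        obtain N0 :: nat where N0: "real N0 \<ge> \<bar>x\<bar>" using real_arch_simple by blast
        show "\<forall>\<^sub>F N in sequentially. indicator {-real N - 1/2..real N + 1/2} x *\<^sub>R f x = f x"
          using eventually_ge_at_top[of N0]
        proof eventually_elim
          case (elim N)
          then have "real N0 \<le> real N" by simp
          then have "x \<in> {-real N - 1/2..real N + 1/2}" using N0 by auto
          then show ?case by simp
        qed
      qed
    qed (use fint in \<open>auto simp: indicator_def intro!: integrable_norm borel_measurable_integrable\<close>)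
    then show ?thesis
      using set_borel_integral_eq_integral(2)[OF si] by (simp add: set_lebesgue_integral_def)
  qed
  have "fourier_coeff (\<lambda>x. \<Sum>\<^sub>\<infinity>n. gauss_term t (of_real (x0 + x)) n) m = (LINT x|lborel. f x)"
    using lim1 lim2 by (rule LIMSEQ_unique)
  also have "\<dots> = e2pi (of_real (of_int m * x0)) * of_real (exp (- pi * (of_int m)^2 / t) / sqrt t)"
    unfolding f_def by (rule gauss_fourier_transform[OF t])
  finally show ?thesis by simp
qed

text \<open>The periodized Gaussian is evaluated at one point through its Fourier series. That
  series converges a priori along symmetric partial sums only; the decay of the right-hand terms
  gives unordered summability, and the limits agree.\<close>

theorem theta_inversion:
  fixes x0 :: real
  assumes t: "t > 0"
  shows "((\<lambda>n::int. complex_of_real (exp (- pi * t * (of_int n + x0)^2))) has_sum S) UNIV \<longleftrightarrow>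
     ((\<lambda>m::int. e2pi (of_int m * of_real x0) * of_real (exp (- pi * (of_int m)^2 / t) / sqrt t)) has_sum S) UNIV"
    (is "(?f has_sum S) UNIV \<longleftrightarrow> (?g has_sum S) UNIV")
proof -
  define \<Phi> where "\<Phi> x = (\<Sum>\<^sub>\<infinity>n. gauss_term t (of_real (x0 + x)) n)" for x
  have f_eq: "?f = gauss_term t (of_real (x0 + 0))"
    by (auto simp: gauss_term_def exp_of_real[symmetric] fun_eq_iff)
  have fs: "?f summable_on UNIV" unfolding f_eq using t by (rule gauss_term_summable)
  have gs: "?g summable_on UNIV"
  proof (rule abs_summable_summable, rule summable_on_comparison_test)
    show "(\<lambda>m::int. exp (- (pi / t) * of_int m ^ 2) * (1 / sqrt t)) summable_on UNIV"
      using t by (intro summable_on_cmult_left summable_on_int_exp_square) auto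
    fix m :: int
    have "norm (e2pi (of_int m * of_real x0)) = 1" by (simp add: norm_e2pi)
    then show "norm (?g m) \<le> exp (- (pi / t) * of_int m ^ 2) * (1 / sqrt t)"
      using t by (simp add: norm_mult norm_divide)
  qed auto
  have hol: "(\<lambda>z. \<Sum>\<^sub>\<infinity>n. gauss_term t (of_real x0 + z) n) holomorphic_on UNIV"
  proof -
    have "(\<lambda>z. of_real x0 + z) holomorphic_on UNIV" by (intro holomorphic_intros)
    from holomorphic_on_compose_gen[OF this gauss_sum_holomorphic[OF t]] show ?thesis
      by (simp add: o_def)
  qed
  have cont: "continuous_on {-1/2..1/2} \<Phi>"
    unfolding \<Phi>_def of_real_add
    by (rule continuous_on_compose2[OF holomorphic_on_imp_continuous_on[OF hol]]) (auto intro!: continuous_intros)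
  obtain D where "((\<lambda>z. \<Sum>\<^sub>\<infinity>n. gauss_term t (of_real x0 + z) n) has_field_derivative D) (at (of_real 0))"
    using hol by (metis UNIV_I holomorphic_derivI open_UNIV)
  from has_vector_derivative_real_field[OF this]
  have D: "(\<Phi> has_vector_derivative D) (at 0)" unfolding \<Phi>_def of_real_add .
  have "(\<lambda>N. \<Sum>m\<in>{-int N..int N}. fourier_coeff \<Phi> m) \<longlonglongrightarrow> \<Phi> 0"
    by (rule fourier_series_at_0[OF cont D])
  then have lim1: "(\<lambda>N. \<Sum>m\<in>{-int N..int N}. ?g m) \<longlonglongrightarrow> \<Phi> 0"
    unfolding \<Phi>_def fourier_coeff_gauss_sum[OF t] .
  have lim2: "(\<lambda>N. \<Sum>m\<in>{-int N..int N}. ?g m) \<longlonglongrightarrow> infsum ?g UNIV"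
    using filterlim_compose[OF has_sum_infsum[OF gs, unfolded has_sum_def] filterlim_symmetric_int_intervals] .
  have "infsum ?f UNIV = infsum ?g UNIV"
    using LIMSEQ_unique[OF lim1 lim2] by (simp only: \<Phi>_def f_eq)
  then show ?thesis using fs gs by (simp add: has_sum_iff)
qed

section \<open>Gauss sums and the inversion of eta\<close>

lemma has_sum_UN_finite:
  fixes f :: "'a \<Rightarrow> 'b::topological_comm_monoid_add"
  assumes "finite I" "\<And>i. i \<in> I \<Longrightarrow> (f has_sum a i) (A i)" "disjoint_family_on A I"
  shows "(f has_sum (\<Sum>i\<in>I. a i)) (\<Union>i\<in>I. A i)"
  using assms
proof (induction I rule: finite_induct)
  case (insert i I)
  have "disjoint_family_on A I"
    using insert.prems(2) by (rule disjoint_family_on_mono[rotated]) auto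
  then have "(f has_sum (\<Sum>i\<in>I. a i)) (\<Union>i\<in>I. A i)"
    using insert by auto
  moreover have "A i \<inter> (\<Union>i\<in>I. A i) = {}"
    using insert.prems(2) insert.hyps by (auto simp: disjoint_family_on_def)
  ultimately show ?case using insert by (auto intro!: has_sum_Un_disjoint)
qed auto

lemma has_sum_finite_sum:
  fixes f :: "'i \<Rightarrow> 'a \<Rightarrow> 'b::topological_comm_monoid_add"
  assumes "finite I" "\<And>i. i \<in> I \<Longrightarrow> (f i has_sum a i) A"
  shows "((\<lambda>x. \<Sum>i\<in>I. f i x) has_sum (\<Sum>i\<in>I. a i)) A"
  using assms by (induction I rule: finite_induct) (auto intro!: has_sum_add)

lemma sum_residues_reindex:
  fixes f :: "int \<Rightarrow> 'a::comm_monoid_add"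
  assumes p: "p > 0" and per: "\<And>w. f (w mod p) = f w"
    and inj: "\<And>v w. [h v = h w] (mod p) \<Longrightarrow> [v = w] (mod p)"
  shows "(\<Sum>w\<in>{0..<p}. f (h w)) = (\<Sum>w\<in>{0..<p}. f w)"
proof -
  let ?k = "\<lambda>w. h w mod p"
  have inj': "inj_on ?k {0..<p}"
  proof (rule inj_onI)
    fix v w assume *: "v \<in> {0..<p}" "w \<in> {0..<p}" "h v mod p = h w mod p"
    have "[v = w] (mod p)" by (rule inj) (use * in \<open>simp add: unique_euclidean_semiring_class.cong_def\<close>)
    then show "v = w" using * by (simp add: unique_euclidean_semiring_class.cong_def)
  qed
  have "?k ` {0..<p} = {0..<p}"
    by (rule endo_inj_surj[OF _ _ inj']) (use p in auto)
  then have "(\<Sum>w\<in>{0..<p}. f w) = (\<Sum>w\<in>?k ` {0..<p}. f w)" by simp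
  also have "\<dots> = (\<Sum>w\<in>{0..<p}. f (h w))"
    by (subst sum.reindex[OF inj']) (simp add: per)
  finally show ?thesis ..
qed

section \<open>Quadratic Gauss sums\<close>

definition efrac :: "int \<Rightarrow> int \<Rightarrow> complex" where
  "efrac p a = e2pi (of_int a / of_int p)"

lemma efrac_add: "efrac p (a + b) = efrac p a * efrac p b"
  by (simp add: efrac_def e2pi_add add_divide_distrib)

lemma efrac_mult_self: "p > 0 \<Longrightarrow> efrac p (p * a) = 1"
  by (simp add: efrac_def)

lemma efrac_cong:
  assumes "p > 0" "[a = b] (mod p)"
  shows "efrac p a = efrac p b"
proof -
  obtain k where "a = b + p * k" using assms(2) by (metis cong_iff_lin cong_sym)
  then show ?thesis using assms(1) by (simp add: efrac_add efrac_mult_self)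
qed

definition gauss_sum :: "int \<Rightarrow> int \<Rightarrow> complex" where
  "gauss_sum p a = (\<Sum>w\<in>{0..<p}. efrac p (a * w^2))"

text \<open>Multiplication by the unit s permutes the residues modulo p, so a square factor is
  absorbed into the summation variable.\<close>

lemma gauss_sum_mult_square:
  assumes "p > 0" "coprime s p" "[b = a * s^2] (mod p)"
  shows "gauss_sum p b = gauss_sum p a"
proof -
  have "gauss_sum p b = (\<Sum>w\<in>{0..<p}. efrac p (a * (s * w)^2))"
    unfolding gauss_sum_def
  proof (intro sum.cong refl efrac_cong assms)
    fix w
    have "[b * w^2 = (a * s^2) * w^2] (mod p)" using assms(3) by (rule cong_scalar_right)
    then show "[b * w^2 = a * (s * w)^2] (mod p)" by (simp add: power_mult_distrib mult_ac)
  qed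
  also have "\<dots> = gauss_sum p a"
    unfolding gauss_sum_def
  proof (rule sum_residues_reindex[of p "\<lambda>w. efrac p (a * w^2)" "\<lambda>w. s * w"])
    show "efrac p (a * (w mod p)^2) = efrac p (a * w^2)" for w
      by (intro efrac_cong assms cong_mult cong_pow) (auto simp: unique_euclidean_semiring_class.cong_def)
    show "[v = w] (mod p)" if "[s * v = s * w] (mod p)" for v w
      using that assms(2) by (simp add: cong_mult_lcancel)
  qed fact
  finally show ?thesis .
qed

lemma quadratic_gauss_sum:
  assumes p: "p > 0" and ab: "[4 * A * b = -1] (mod p)"
  shows "(\<Sum>w\<in>{0..<p}. efrac p (A * w^2 + m * w)) = efrac p (b * m^2) * gauss_sum p A"
proof -
  \<comment> \<open>Completing the square: since 4 A b \<equiv> -1, this c satisfies 2 A c \<equiv>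
    m and A c^2 \<equiv> - b m^2 modulo p.\<close>
  define c where "c = - 2 * b * m"
  have "(\<Sum>w\<in>{0..<p}. efrac p (A * w^2 + m * w)) = (\<Sum>w\<in>{0..<p}. efrac p (b * m^2) * efrac p (A * (w + c)^2))"
  proof (intro sum.cong refl)
    fix w
    have "p dvd 4 * A * b + 1" using ab by (simp add: cong_iff_dvd_diff)
    then have "p dvd (4 * A * b + 1) * (m * w - b * m^2)" by (rule dvd_mult2)
    also have "(4 * A * b + 1) * (m * w - b * m^2) = (A * w^2 + m * w) - (b * m^2 + A * (w + c)^2)"
      unfolding c_def by (simp add: power2_eq_square algebra_simps)
    finally have "[A * w^2 + m * w = b * m^2 + A * (w + c)^2] (mod p)" by (simp add: cong_iff_dvd_diff)
    then show "efrac p (A * w^2 + m * w) = efrac p (b * m^2) * efrac p (A * (w + c)^2)"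
      by (simp add: efrac_add[symmetric] efrac_cong[OF p])
  qed
  also have "\<dots> = efrac p (b * m^2) * (\<Sum>w\<in>{0..<p}. efrac p (A * (w + c)^2))"
    by (simp add: sum_distrib_left)
  also have "(\<Sum>w\<in>{0..<p}. efrac p (A * (w + c)^2)) = gauss_sum p A"
    unfolding gauss_sum_def
  proof (rule sum_residues_reindex[of p "\<lambda>w. efrac p (A * w^2)" "\<lambda>w. w + c"])
    show "efrac p (A * (w mod p)^2) = efrac p (A * w^2)" for w
      by (intro efrac_cong p cong_mult cong_pow) (auto simp: unique_euclidean_semiring_class.cong_def)
    show "[v = w] (mod p)" if "[v + c = w + c] (mod p)" for v w
      using that by (simp add: cong_add_rcancel)
  qed fact
  finally show ?thesis .
qed

section \<open>The theta series of eta and its inversion\<close>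

definition parity_sign :: "int \<Rightarrow> 'a::comm_ring_1" where
  "parity_sign n = (if even n then 1 else -1)"

text \<open>The Dedekind eta function as the theta series given by the pentagonal number theorem; as such it
  can be inverted at all cusps \<open>24 * a / p\<close> by Poisson summation.\<close>

definition eta_term :: "complex \<Rightarrow> int \<Rightarrow> complex" where
  "eta_term z n = parity_sign n * e2pi (of_int ((6 * n + 1)^2) * z / 24)"

definition eta :: "complex \<Rightarrow> complex" where
  "eta z = (\<Sum>\<^sub>\<infinity>n. eta_term z n)"

lemma e2pi_imaginary: "e2pi (of_real u * (\<i> * of_real v)) = of_real (exp (- (2 * pi * u * v)))"
  by (simp add: e2pi_def exp_of_real[symmetric] mult_ac)

text \<open>The sign of \<open>eta_term\<close> depends on 6n + 1 modulo 12: plus on the class 1 (n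
  even), minus on the class 7 (n odd). The kernel is the finite Fourier transform of this signed
  pair of classes and appears once Poisson summation has been applied on each class.\<close>

definition eta_kernel :: "int \<Rightarrow> complex" where
  "eta_kernel m = efrac 12 m - efrac 12 (7 * m)"

lemma efrac_12_7: "efrac 12 (7 * m) = parity_sign m * efrac 12 m"
proof -
  have "efrac 12 (7 * m) = efrac 12 (6 * m) * efrac 12 m"
    by (simp add: efrac_add[symmetric])
  moreover have "efrac 12 (6 * m) = parity_sign m"
  proof (cases "even m")
    case True
    then obtain k where "m = 2 * k" by blast
    then have "efrac 12 (6 * m) = efrac 12 (12 * k)" by simp
    then show ?thesis using True by (simp only: efrac_mult_self parity_sign_def) simp
  next
    case False
    then obtain k where "m = 2 * k + 1" by (metis oddE)
    then have "efrac 12 (6 * m) = efrac 12 (12 * k + 6)" by simp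
    also have "\<dots> = efrac 12 6" by (simp only: efrac_add efrac_mult_self) simp
    also have "\<dots> = exp (pi * \<i>)" by (simp add: efrac_def e2pi_def)
    finally show ?thesis using False by (simp add: parity_sign_def)
  qed
  ultimately show ?thesis by simp
qed

lemma eta_kernel_even: "even m \<Longrightarrow> eta_kernel m = 0"
  by (simp add: eta_kernel_def efrac_12_7 parity_sign_def)

lemma eta_kernel_odd: "odd m \<Longrightarrow> eta_kernel m = 2 * efrac 12 m"
  by (simp add: eta_kernel_def efrac_12_7 parity_sign_def)

lemma efrac_12_shift: "efrac 12 (6 * n + k) = parity_sign n * efrac 12 k"
proof -
  have "efrac 12 (6 * n) * efrac 12 n = efrac 12 (7 * n)" by (simp add: efrac_add[symmetric])
  moreover have "efrac 12 n \<noteq> 0" by (simp add: efrac_def)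
  ultimately show ?thesis by (simp add: efrac_12_7 efrac_add)
qed

lemma efrac_12_values:
  "efrac 12 1 + efrac 12 (-1) = of_real (sqrt 3)" "efrac 12 3 + efrac 12 (-3) = 0"
proof -
  have *: "efrac 12 k = cis (pi * of_int k / 6)" for k
    by (simp add: efrac_def e2pi_def cis_conv_exp mult_ac)
  show "efrac 12 1 + efrac 12 (-1) = of_real (sqrt 3)"
    unfolding * by (simp add: complex_eq_iff cos_30)
  show "efrac 12 3 + efrac 12 (-3) = 0"
    unfolding * by (simp add: complex_eq_iff)
qed

text \<open>Adding m and -m turns the classes 1 and 7 into the even real character modulo 12, which
  is +1 on 1, 11 and -1 on 5, 7. This character is its own Fourier transform up to the factor sqrt
  12 = 2 sqrt 3, and that self-duality is why inversion returns eta itself.\<close>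

lemma eta_kernel_symmetrized:
  shows "eta_kernel (6 * n + 1) + eta_kernel (- (6 * n + 1)) = 2 * of_real (sqrt 3) * parity_sign n"
    and "(\<And>n. m \<noteq> 6 * n + 1) \<Longrightarrow> (\<And>n. m \<noteq> - (6 * n + 1)) \<Longrightarrow> eta_kernel m + eta_kernel (- m) = 0"
proof -
  have sg: "parity_sign (-n) = (parity_sign n :: complex)" for n by (simp add: parity_sign_def)
  have "eta_kernel (6 * n + 1) + eta_kernel (- (6 * n + 1)) = 2 * (efrac 12 (6 * n + 1) + efrac 12 (6 * (-n) + (-1)))"
    by (subst (1 2) eta_kernel_odd) auto
  also have "\<dots> = 2 * parity_sign n * (efrac 12 1 + efrac 12 (-1))"
    unfolding efrac_12_shift sg by (simp add: algebra_simps)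
  finally show "eta_kernel (6 * n + 1) + eta_kernel (- (6 * n + 1)) = 2 * of_real (sqrt 3) * parity_sign n"
    unfolding efrac_12_values by simp
  assume m: "\<And>n. m \<noteq> 6 * n + 1" "\<And>n. m \<noteq> - (6 * n + 1)"
  show "eta_kernel m + eta_kernel (- m) = 0"
  proof (cases "even m")
    case True
    then show ?thesis by (simp add: eta_kernel_even)
  next
    case False
    have "m = 6 * ((m - 3) div 6) + 3"
      using m(1)[of "m div 6"] m(2)[of "- m div 6"] False by presburger
    then obtain n where n: "m = 6 * n + 3" by blast
    have "eta_kernel m + eta_kernel (- m) = 2 * (efrac 12 (6 * n + 3) + efrac 12 (6 * (-n) + (-3)))"
      using False by (simp add: eta_kernel_odd n)
    also have "\<dots> = 2 * parity_sign n * (efrac 12 3 + efrac 12 (-3))"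
      unfolding efrac_12_shift sg by (simp add: algebra_simps)
    finally show ?thesis unfolding efrac_12_values by simp
  qed
qed

lemma gauss_theta_inversion:
  assumes t: "t > 0"
  obtains S where "((\<lambda>n::int. complex_of_real (exp (- pi * t * (of_int n + x)^2))) has_sum S) UNIV"
     "((\<lambda>m::int. e2pi (of_int m * of_real x) * of_real (exp (- pi * (of_int m)^2 / t) / sqrt t)) has_sum S) UNIV"
proof -
  have "(\<lambda>n::int. complex_of_real (exp (- pi * t * (of_int n + x)^2))) = gauss_term t (of_real x)"
    by (auto simp: gauss_term_def exp_of_real[symmetric] fun_eq_iff)
  then have "(\<lambda>n::int. complex_of_real (exp (- pi * t * (of_int n + x)^2))) summable_on UNIV"
    using gauss_term_summable[OF t] by simp
  from has_sum_infsum[OF this] show ?thesis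
    using that theta_inversion[OF t] by blast
qed

lemma norm_parity_sign [simp]: "norm (parity_sign n :: complex) = 1"
  by (simp add: parity_sign_def)

lemma norm_eta_term_le:
  assumes "Im z > 0"
  shows "norm (eta_term z n) \<le> exp (- (pi * Im z / 12) * of_int n ^ 2)"
proof -
  \<comment> \<open>The difference (6n + 1)^2 - n^2 factors as (5n + 1)(7n + 1), and for integer n
    the two factors never have opposite signs.\<close>
  have "0 \<le> 5 * n + 1 \<and> 0 \<le> 7 * n + 1 \<or> 5 * n + 1 \<le> 0 \<and> 7 * n + 1 \<le> 0" by presburger
  then have "0 \<le> (5 * n + 1) * (7 * n + 1)" by (auto simp: zero_le_mult_iff)
  then have "n ^ 2 \<le> (6 * n + 1)^2" by (simp add: power2_eq_square algebra_simps)
  then have "of_int (n ^ 2) \<le> (of_int ((6 * n + 1)^2) :: real)" by (simp only: of_int_le_iff)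
  then have "(pi * Im z / 12) * of_int (n ^ 2) \<le> (pi * Im z / 12) * of_int ((6 * n + 1)^2)"
    using assms by (intro mult_left_mono) auto
  moreover have "Im (of_int ((6 * n + 1)^2) * z / 24) = of_int ((6 * n + 1)^2) * Im z / 24"
    by (simp add: Im_divide_numeral del: of_int_power)
  then have "norm (eta_term z n) = exp (- ((pi * Im z / 12) * of_int ((6 * n + 1)^2)))"
    unfolding eta_term_def norm_mult norm_e2pi by simp
  ultimately show ?thesis by simp
qed

lemma eta_has_sum:
  assumes "Im z > 0"
  shows "(eta_term z has_sum eta z) UNIV"
proof -
  have "(\<lambda>n. norm (eta_term z n)) summable_on UNIV"
    by (rule summable_on_comparison_test[OF summable_on_int_exp_square[of "pi * Im z / 12"]])
       (use assms norm_eta_term_le[OF assms] in auto)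
  from has_sum_infsum[OF abs_summable_summable[OF this]] show ?thesis unfolding eta_def .
qed

lemma Im_shifted_imaginary: "Im ((\<i> * of_real y + 24 * of_int a) / of_int p) = y / of_int p"
  using Im_divide_of_real[of "\<i> * of_real y + 24 * of_int a" "of_int p"] by simp

lemma eta_term_imaginary:
  assumes "p > 0"
  shows "eta_term ((\<i> * of_real y + 24 * of_int a) / of_int p) n =
    parity_sign n * efrac p (a * (6 * n + 1)^2) * of_real (exp (- (pi * y * of_int ((6 * n + 1)^2) / (12 * of_int p))))"
proof -
  define X where "X = (6 * n + 1)^2"
  have "of_int X * ((\<i> * of_real y + 24 * of_int a) / of_int p) / 24 =
    of_int (a * X) / of_int p + of_real (of_int X / (24 * of_int p)) * (\<i> * of_real y)"
    using assms by (simp add: field_simps)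
  then have "e2pi (of_int X * ((\<i> * of_real y + 24 * of_int a) / of_int p) / 24) =
    efrac p (a * X) * of_real (exp (- (2 * pi * (of_int X / (24 * of_int p)) * y)))"
    unfolding efrac_def by (simp only: e2pi_add e2pi_imaginary)
  also have "2 * pi * (of_int X / (24 * of_int p)) * y = pi * y * of_int X / (12 * of_int p)"
    by simp
  finally show ?thesis unfolding eta_term_def X_def by simp
qed

text \<open>The terms are grouped by 6n + 1 modulo 12 and modulo p, theta inversion is applied in
  each group, and the finite sums over the groups become \<open>eta_kernel\<close> times a quadratic
  Gauss sum. The shifts 24 a and 24 b have product -1 modulo p, as 576 = 24^2. The modulus p = 1 is
  included and yields the plain inversion on the imaginary axis.\<close>

theorem eta_inversion:
  fixes p a b :: int and y :: real
  assumes p: "p > 0" "[p = 1] (mod 12)" and ab: "[576 * a * b = -1] (mod p)" and y: "y > 0"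
  shows "eta ((\<i> * of_real y + 24 * of_int a) / of_int p) =
    of_real (1 / sqrt (of_int p * y)) * gauss_sum p a * eta ((\<i> * of_real (1 / y) + 24 * of_int b) / of_int p)"
    (is "eta ?z = _ * _ * eta ?z'")
proof -
  obtain q where q: "p = 12 * q + 1"
    using p(2) by (metis cong_iff_lin cong_sym add.commute)
  \<comment> \<open>In each group 6n + 1 = 12 p (m + x), so the exponent pi y (6n + 1)^2 / (12 p)
    becomes pi t (m + x)^2.\<close>
  define t where "t = 12 * of_int p * y"
  have t: "t > 0" using p y by (simp add: t_def)
  define E where "E m = complex_of_real (exp (- pi * (of_int m)^2 / t) / sqrt t)" for m :: int
  define x where "x i = real_of_int (p * fst i + 12 * snd i) / (12 * of_int p)" for i :: "int \<times> int"
  \<comment> \<open>For i = (\<epsilon>, w) this is the solution of 6 N + 1 = p \<epsilon> + 12 (w +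
    p m). As p \<equiv> 1 (mod 12), the division by 6 is exact and \<epsilon> = 1 or 7 decides
    whether N is even or odd.\<close>
  define N where "N i m = (p * fst i - 1) div 6 + 2 * (snd i + p * m)" for i :: "int \<times> int" and m
  define s :: "int \<Rightarrow> complex" where "s \<epsilon> = (if \<epsilon> = 1 then 1 else -1)" for \<epsilon>
  define I where "I = {1, 7 :: int} \<times> {0..<p}"
  have finI: "finite I" by (simp add: I_def)
  have N6: "6 * N i m + 1 = p * fst i + 12 * (snd i + p * m)" if "i \<in> I" for i m
    using that q by (auto simp: N_def I_def)
  have parN: "parity_sign (N i m) = s (fst i)" if "i \<in> I" for i m
    using that q by (auto simp: N_def I_def parity_sign_def s_def)
  have "\<exists>S. ((\<lambda>n::int. complex_of_real (exp (- pi * t * (of_int n + x i)^2))) has_sum S) UNIV \<and>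
     ((\<lambda>m::int. e2pi (of_int m * of_real (x i)) * E m) has_sum S) UNIV" (is "\<exists>S. ?P i S") for i
    using gauss_theta_inversion[OF t, of "x i"] unfolding E_def by blast
  then have "\<forall>i. \<exists>S. ?P i S" by (rule allI)
  then obtain S where "\<forall>i. ?P i (S i)" unfolding choice_iff by (rule exE)
  then have S: "((\<lambda>n::int. complex_of_real (exp (- pi * t * (of_int n + x i)^2))) has_sum S i) UNIV"
     "((\<lambda>m::int. e2pi (of_int m * of_real (x i)) * E m) has_sum S i) UNIV" for i by blast+
  define c where "c i = s (fst i) * efrac p (144 * a * snd i ^ 2)" for i :: "int \<times> int"
  have "(eta_term ?z has_sum (\<Sum>i\<in>I. c i * S i)) (\<Union>i\<in>I. range (N i))"
  proof (rule has_sum_UN_finite[OF finI])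
    fix i assume i: "i \<in> I"
    have inj: "inj (N i)" using p by (auto simp: inj_def N_def)
    have term_eq: "eta_term ?z (N i m) = c i * complex_of_real (exp (- pi * t * (of_int m + x i)^2))" for m
    proof -
      define X where "X = p * fst i + 12 * (snd i + p * m)"
      have "X = 12 * snd i + p * (fst i + 12 * m)" by (simp add: X_def algebra_simps)
      then have "[X = 12 * snd i] (mod p)" by (simp add: unique_euclidean_semiring_class.cong_def del: distrib_left_numeral)
      then have "[a * X^2 = a * (12 * snd i)^2] (mod p)" by (intro cong_mult cong_pow cong_refl)
      then have 1: "efrac p (a * X^2) = efrac p (144 * a * snd i ^ 2)"
        using efrac_cong[OF p(1)] by (simp add: power_mult_distrib mult_ac)
      have xX: "of_int m + x i = of_int X / (12 * of_int p)"
        using p by (simp add: x_def X_def field_simps)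
      have 2: "pi * t * (of_int m + x i)^2 = pi * y * of_int (X^2) / (12 * of_int p)"
        unfolding xX using p by (simp add: t_def power2_eq_square field_simps)
      show ?thesis
        unfolding eta_term_imaginary[OF p(1)] N6[OF i] X_def[symmetric] parN[OF i] c_def 1[symmetric]
        using 2 by simp
    qed
    show "(eta_term ?z has_sum c i * S i) (range (N i))"
      unfolding has_sum_reindex[OF inj] o_def term_eq by (intro has_sum_cmult_right S)
  next
    show "disjoint_family_on (\<lambda>i. range (N i)) I"
      unfolding disjoint_family_on_def
    proof (intro ballI impI equals0I)
      fix i j n assume ij: "i \<in> I" "j \<in> I" "i \<noteq> j" "n \<in> range (N i) \<inter> range (N j)"
      then obtain m m' where m: "n = N i m" "n = N j m'" by blast
      have e: "p * fst i + 12 * (snd i + p * m) = p * fst j + 12 * (snd j + p * m')"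
        using N6[OF ij(1), of m] N6[OF ij(2), of m'] m by simp
      have "s (fst i) = s (fst j)" using parN[OF ij(1)] parN[OF ij(2)] m by metis
      then have f: "fst i = fst j" using ij by (auto simp: s_def I_def split: if_splits)
      with e have "snd i + p * m = snd j + p * m'" by simp
      then have "(snd i + p * m) mod p = (snd j + p * m') mod p" by simp
      then have "snd i = snd j" using ij by (auto simp: I_def)
      with f ij show False by (auto simp: prod_eq_iff)
    qed
  qed
  also have "(\<Union>i\<in>I. range (N i)) = UNIV"
  proof (intro equalityI subsetI)
    fix n :: int
    define \<epsilon> where "\<epsilon> = (if even n then 1 else 7 :: int)"
    define v where "v = (6 * n + 1 - p * \<epsilon>) div 12"
    have v: "6 * n + 1 = p * \<epsilon> + 12 * v"
      unfolding v_def \<epsilon>_def q by (cases "even n") (auto elim!: evenE oddE)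
    have "(\<epsilon>, v mod p) \<in> I" using p by (simp add: I_def \<epsilon>_def)
    moreover from N6[OF this, of "v div p"] have "n = N (\<epsilon>, v mod p) (v div p)"
      using v by (simp add: algebra_simps)
    ultimately show "n \<in> (\<Union>i\<in>I. range (N i))" by blast
  qed auto
  finally have "(eta_term ?z has_sum (\<Sum>i\<in>I. c i * S i)) UNIV" .
  moreover have "(eta_term ?z has_sum eta ?z) UNIV"
    using p y by (intro eta_has_sum) (simp add: Im_shifted_imaginary)
  ultimately have eta_z: "eta ?z = (\<Sum>i\<in>I. c i * S i)"
    using has_sum_unique by blast
  define G where "G = gauss_sum p (144 * a)"
  define D where "D m = efrac p (b * m^2) * G * E m" for m
  have ab': "[4 * (144 * a) * b = -1] (mod p)" using ab by simp
  have kernel: "(\<Sum>i\<in>I. c i * (e2pi (of_int m * of_real (x i)) * E m)) = eta_kernel m * D m" for m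
  proof -
    have ex: "e2pi (of_int m * of_real (x i)) = efrac 12 (fst i * m) * efrac p (m * snd i)" for i
      unfolding efrac_def e2pi_add[symmetric] using p by (simp add: x_def field_simps)
    have "(\<Sum>i\<in>I. c i * (e2pi (of_int m * of_real (x i)) * E m)) =
      (\<Sum>\<epsilon>\<in>{1,7}. \<Sum>w\<in>{0..<p}. s \<epsilon> * efrac 12 (\<epsilon> * m) * E m * efrac p (144 * a * w^2 + m * w))"
      unfolding I_def sum.cartesian_product c_def ex by (intro sum.cong refl) (auto simp: efrac_add mult_ac)
    also have "\<dots> = (\<Sum>\<epsilon>\<in>{1,7}. s \<epsilon> * efrac 12 (\<epsilon> * m) * E m * (efrac p (b * m^2) * G))"
      unfolding sum_distrib_left[symmetric] quadratic_gauss_sum[OF p(1) ab'] G_def ..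
    also have "\<dots> = eta_kernel m * D m"
      by (simp add: s_def eta_kernel_def D_def algebra_simps)
    finally show ?thesis .
  qed
  have "((\<lambda>m. \<Sum>i\<in>I. c i * (e2pi (of_int m * of_real (x i)) * E m)) has_sum (\<Sum>i\<in>I. c i * S i)) UNIV"
    by (intro has_sum_finite_sum finI has_sum_cmult_right S)
  then have hs1: "((\<lambda>m. eta_kernel m * D m) has_sum eta ?z) UNIV"
    unfolding kernel eta_z .
  \<comment> \<open>Since \<open>D\<close> is even, the series can be added to its reflection. The
    symmetrized kernel is supported on m congruent to 1 or -1 modulo 6, and the two classes
    \<open>A\<close> and \<open>A'\<close> contribute equally, which cancels the doubling.\<close>
  have D_minus: "D (- m) = D m" for m by (simp add: D_def E_def)
  have "((\<lambda>m. eta_kernel m * D m) has_sum eta ?z) (range uminus)"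
    using hs1 by (simp add: surj_def) 
  then have hs2: "((\<lambda>m. eta_kernel (- m) * D m) has_sum eta ?z) UNIV"
    by (subst (asm) has_sum_reindex) (auto simp: o_def D_minus)
  let ?K = "\<lambda>m. (eta_kernel m + eta_kernel (- m)) * D m"
  define A where "A = range (\<lambda>n::int. 6 * n + 1)"
  define A' where "A' = range (\<lambda>n::int. - (6 * n + 1))"
  have hs: "(?K has_sum (eta ?z + eta ?z)) UNIV"
    unfolding distrib_right by (intro has_sum_add hs1 hs2)
  also have "(?K has_sum (eta ?z + eta ?z)) UNIV \<longleftrightarrow> (?K has_sum (eta ?z + eta ?z)) (A \<union> A')"
  proof (rule has_sum_cong_neutral)
    fix m assume "m \<in> UNIV - (A \<union> A')"
    then have "eta_kernel m + eta_kernel (- m) = 0"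
      by (intro eta_kernel_symmetrized) (auto simp: A_def A'_def)
    then show "?K m = 0" by simp
  qed auto
  finally have hs3: "(?K has_sum (eta ?z + eta ?z)) (A \<union> A')" .
  define r where "r = 1 / sqrt (of_int p * y)"
  have r: "2 * sqrt 3 / sqrt t = r"
  proof -
    have "sqrt t = sqrt (2^2 * (3 * (of_int p * y)))" by (simp add: t_def)
    also have "\<dots> = 2 * sqrt 3 * sqrt (of_int p * y)" by (simp only: real_sqrt_mult) simp
    finally show ?thesis by (simp add: r_def)
  qed
  have K_val: "?K (6 * n + 1) = of_real r * G * eta_term ?z' n" for n
  proof -
    have e: "- pi * (of_int (6 * n + 1))^2 / t = - (pi * (1 / y) * of_int ((6 * n + 1)^2) / (12 * of_int p))"
      by (simp add: t_def mult_ac)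
    have E_val: "E (6 * n + 1) = of_real (exp (- (pi * (1 / y) * of_int ((6 * n + 1)^2) / (12 * of_int p))) / sqrt t)"
      unfolding E_def e ..
    have "?K (6 * n + 1) = of_real (2 * sqrt 3 / sqrt t) * G * eta_term ?z' n"
      unfolding eta_kernel_symmetrized(1) eta_term_imaginary[OF p(1)] D_def E_val by simp
    then show ?thesis unfolding r .
  qed
  have "(eta_term ?z' has_sum eta ?z') UNIV"
    using p y by (intro eta_has_sum) (simp add: Im_shifted_imaginary)
  from has_sum_cmult_right[OF this, of "of_real r * G"]
  have "((\<lambda>n. ?K (6 * n + 1)) has_sum (of_real r * G * eta ?z')) UNIV"
    unfolding K_val .
  then have KA: "((\<lambda>n. ?K (6 * n + 1)) has_sum (of_real r * G * eta ?z')) UNIV" .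
  have K_minus: "?K (- m) = ?K m" for m by (simp only: D_minus minus_minus add.commute)
  have "(?K has_sum (of_real r * G * eta ?z')) A"
    unfolding A_def using KA by (subst has_sum_reindex) (simp_all add: inj_def o_def)
  moreover have "(?K has_sum (of_real r * G * eta ?z')) A'"
    unfolding A'_def
  proof (subst has_sum_reindex)
    show "((?K \<circ> (\<lambda>n. - (6 * n + 1))) has_sum (of_real r * G * eta ?z')) UNIV"
      unfolding o_def K_minus by (rule KA)
  qed (simp add: inj_def)
  moreover have "A \<inter> A' = {}" unfolding A_def A'_def by (auto; presburger)
  ultimately have "(?K has_sum (of_real r * G * eta ?z' + of_real r * G * eta ?z')) (A \<union> A')"
    by (intro has_sum_Un_disjoint)
  with hs3 have "eta ?z + eta ?z = of_real r * G * eta ?z' + of_real r * G * eta ?z'"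
    by (rule has_sum_unique)
  then have "eta ?z = of_real r * G * eta ?z'" by (simp flip: mult_2)
  moreover have "G = gauss_sum p a"
    unfolding G_def
  proof (rule gauss_sum_mult_square[OF p(1), of 12])
    show "coprime 12 p" using p(2) by (metis cong_imp_coprime cong_sym coprime_1_left coprime_commute)
  qed (simp add: mult_ac)
  ultimately show ?thesis by (simp add: r_def)
qed

section \<open>The pentagonal number theorem\<close>

definition tri :: "nat \<Rightarrow> nat" where "tri s = s * (s + 1) div 2"

lemma tri_0 [simp]: "tri 0 = 0" by (simp add: tri_def)
lemma tri_Suc [simp]: "tri (Suc s) = tri s + Suc s" by (simp add: tri_def)

text \<open>A finite form of the pentagonal number theorem, due to Shanks; the difference of
  consecutive left-hand sides telescopes.\<close>

lemma shanks:
  fixes q :: "'a::comm_ring_1"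
  shows "(\<Sum>s\<le>N. (-1)^s * (\<Prod>k\<in>{s<..N}. 1 - q^k) * q^(s * N + tri s)) =
    1 + (\<Sum>s<N. (-1)^Suc s * (q^(Suc s * Suc s + tri s) + q^(Suc s * Suc s + tri (Suc s))))"
proof (induction N)
  case 0
  show ?case by simp
next
  case (Suc N)
  define Q where "Q s N = (\<Prod>k\<in>{s<..N}. 1 - q^k)" for s N :: nat
  have Q_Suc: "Q s (Suc N) = Q s N * (1 - q^Suc N)" if "s \<le> N" for s
  proof -
    have "{s<..Suc N} = insert (Suc N) {s<..N}" using that by auto
    then show ?thesis by (simp add: Q_def mult.commute)
  qed
  have Q_left: "Q s N = (1 - q^Suc s) * Q (Suc s) N" if "Suc s \<le> N" for s
  proof -
    have "{s<..N} = insert (Suc s) {Suc s<..N}" using that by auto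
    then show ?thesis by (simp add: Q_def)
  qed
  define a where "a N s = (-1)^s * Q s N * q^(s * N + tri s)" for N s
  define b where "b s = (-1)^s * Q s N * q^(Suc s * Suc N + tri s)" for s
  have "(\<Sum>s\<le>m. a (Suc N) s - a N s) = - b m" if "m \<le> N" for m
    using that
  proof (induction m)
    case 0
    show ?case by (simp add: a_def b_def Q_Suc algebra_simps)
  next
    case (Suc m)
    define x where "x = q ^ (Suc m * N + tri (Suc m))"
    have "q ^ (Suc m * Suc N + tri (Suc m)) = x * q^Suc m"
      unfolding x_def by (simp add: power_add[symmetric] algebra_simps del: power_Suc)
    moreover have "q ^ (Suc m * Suc N + tri m) = x"
      unfolding x_def by (simp add: algebra_simps)
    moreover have "q ^ (Suc (Suc m) * Suc N + tri (Suc m)) = x * q^Suc m * q^Suc N"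
      unfolding x_def by (simp add: power_add[symmetric] algebra_simps del: power_Suc)
    moreover have "(-1::'a)^Suc m = - ((-1)^m)" by simp
    ultimately have "a (Suc N) (Suc m) - a N (Suc m) = b m - b (Suc m)"
      unfolding a_def b_def Q_Suc[OF Suc.prems] Q_left[OF Suc.prems] x_def[symmetric]
      by (simp add: algebra_simps del: power_Suc)
    then show ?case using Suc by simp
  qed
  from this[of N] have "(\<Sum>s\<le>N. a (Suc N) s) = (\<Sum>s\<le>N. a N s) - b N"
    by (simp add: sum_subtractf algebra_simps)
  moreover have "b N = (-1)^N * q^(Suc N * Suc N + tri N)" by (simp add: b_def Q_def)
  moreover have "a (Suc N) (Suc N) = (-1)^Suc N * q^(Suc N * Suc N + tri (Suc N))"
    by (simp add: a_def Q_def)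
  ultimately have "(\<Sum>s\<le>Suc N. a (Suc N) s) =
    (\<Sum>s\<le>N. a N s) + (-1)^Suc N * (q^(Suc N * Suc N + tri N) + q^(Suc N * Suc N + tri (Suc N)))"
    by (simp add: algebra_simps)
  then show ?case using Suc.IH unfolding a_def Q_def by (simp add: algebra_simps)
qed

text \<open>The convention s (3s + 1) / 2 over all integers s is the one with 24 * pent s + 1 = (6s
  + 1)^2, which matches the exponents in \<open>eta_term\<close>.\<close>

definition pent :: "int \<Rightarrow> nat" where
  "pent s = nat (s * (3 * s + 1) div 2)"

lemma pent_int: "int (pent s) = s * (3 * s + 1) div 2"
proof -
  have "0 \<le> s \<and> 0 \<le> 3 * s + 1 \<or> s \<le> 0 \<and> 3 * s + 1 \<le> 0" by presburger
  then have "0 \<le> s * (3 * s + 1)" by (auto simp: zero_le_mult_iff)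
  then show ?thesis by (simp add: pent_def)
qed

lemma pent_double: "2 * int (pent s) = s * (3 * s + 1)"
  unfolding pent_int by (rule dvd_mult_div_cancel) (cases "even s"; simp)

lemma pent_inj: "inj pent"
proof (rule injI)
  fix s t assume "pent s = pent t"
  then have "s * (3 * s + 1) = t * (3 * t + 1)" by (metis pent_double)
  then have "(s - t) * (3 * (s + t) + 1) = 0" by (simp add: algebra_simps)
  moreover have "3 * (s + t) + 1 \<noteq> 0" by presburger
  ultimately show "s = t" by simp
qed

lemma pent_ge: "nat \<bar>s\<bar> \<le> pent s"
proof -
  have "2 * \<bar>s\<bar> \<le> s * (3 * s + 1)"
  proof (cases "s \<ge> 0")
    case True
    then show ?thesis using mult_left_mono[of 2 "3 * s + 1" s] by (cases "s = 0") auto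
  next
    case False
    then show ?thesis using mult_left_mono_neg[of "3 * s + 1" "-2" s] by auto
  qed
  then show ?thesis using pent_double[of s] by linarith
qed

lemma pent_of_nat: "pent (int (Suc s)) = Suc s * Suc s + tri (Suc s)" "pent (- int (Suc s)) = Suc s * Suc s + tri s"
proof -
  have *: "2 * int (tri s) = int s * (int s + 1)" for s
    by (induction s) (auto simp: algebra_simps)
  have "2 * int (pent (int (Suc s))) = 2 * int (Suc s * Suc s + tri (Suc s))"
    unfolding pent_double of_nat_add distrib_left * by (simp add: algebra_simps)
  then show "pent (int (Suc s)) = Suc s * Suc s + tri (Suc s)"
    by (simp only: mult_cancel_left of_nat_eq_iff zero_neq_numeral[symmetric] simp_thms)
  have "2 * int (pent (- int (Suc s))) = 2 * int (Suc s * Suc s + tri s)"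
    unfolding pent_double of_nat_add distrib_left * by (simp add: algebra_simps)
  then show "pent (- int (Suc s)) = Suc s * Suc s + tri s"
    by (simp only: mult_cancel_left of_nat_eq_iff zero_neq_numeral[symmetric] simp_thms)
qed

lemma parity_sign_of_nat: "parity_sign (int s) = (-1)^s" "parity_sign (- int s) = (-1)^s"
  by (auto simp: parity_sign_def)

lemma shanks_pent:
  fixes q :: "'a::comm_ring_1"
  shows "(\<Sum>s\<le>N. (-1)^s * (\<Prod>k\<in>{s<..N}. 1 - q^k) * q^(s * N + tri s)) =
    (\<Sum>s\<in>{-int N..int N}. of_int (parity_sign s) * q^pent s)"
proof -
  have "(\<Sum>s\<in>{-int N..int N}. of_int (parity_sign s) * q^pent s) =
    1 + (\<Sum>s<N. (-1)^Suc s * (q^(Suc s * Suc s + tri s) + q^(Suc s * Suc s + tri (Suc s))))"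
  proof (induction N)
    case (Suc N)
    have "{-int (Suc N)..int (Suc N)} = insert (-int (Suc N)) (insert (int (Suc N)) {-int N..int N})" by auto
    then have "(\<Sum>s\<in>{-int (Suc N)..int (Suc N)}. of_int (parity_sign s) * q^pent s) =
      of_int (parity_sign (-int (Suc N))) * q^pent (-int (Suc N)) + (of_int (parity_sign (int (Suc N))) * q^pent (int (Suc N)) +
      (\<Sum>s\<in>{-int N..int N}. of_int (parity_sign s) * q^pent s))"
      by simp
    then show ?case unfolding Suc.IH parity_sign_of_nat pent_of_nat by (simp add: algebra_simps)
  qed (simp add: parity_sign_def pent_def)
  then show ?thesis using shanks by simp
qed

text \<open>The product f_1 of all 1 - q^k, encoded by its pentagonal expansion so that the link
  with the theta series is immediate; \<open>euler_fps_nth\<close> supplies the link with finite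
  products. The inverse of \<open>pent\<close> is used on the range of \<open>pent\<close>
  only.\<close>

definition euler_fps :: "int fps" where
  "euler_fps = Abs_fps (\<lambda>n. if n \<in> range pent then parity_sign (inv_into UNIV pent n) else 0)"

lemma euler_fps_pent: "fps_nth euler_fps (pent s) = parity_sign s"
  by (simp add: euler_fps_def inv_f_f[OF pent_inj])

lemma abs_euler_fps_le: "\<bar>fps_nth euler_fps n\<bar> \<le> 1"
  by (simp add: euler_fps_def parity_sign_def)

text \<open>In Shanks' identity the summand s = 0 is the truncated product, and for s \<ge> 1 the
  exponent s N + tri s exceeds N, so the other summands do not reach the coefficient n \<le>
  N.\<close>

lemma euler_fps_nth:
  assumes "n \<le> N"
  shows "fps_nth euler_fps n = fps_nth (\<Prod>k\<in>{1..N}. 1 - fps_X^k) n"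
proof -
  have "(\<Sum>s\<le>N. (-1)^s * (\<Prod>k\<in>{s<..N}. 1 - fps_X^k) * fps_X^(s * N + tri s)) =
      (\<Prod>k\<in>{0<..N}. 1 - fps_X^k) + (\<Sum>s\<in>{1..N}. (-1)^s * (\<Prod>k\<in>{s<..N}. 1 - fps_X^k) * (fps_X^(s * N + tri s) :: int fps))"
  proof -
    have "{..N} = insert 0 {1..N}" by auto
    then show ?thesis by simp
  qed
  moreover have "fps_nth (\<Sum>s\<in>{1..N}. (-1)^s * (\<Prod>k\<in>{s<..N}. 1 - fps_X^k) * (fps_X^(s * N + tri s) :: int fps)) n = 0"
    unfolding fps_sum_nth
  proof (intro sum.neutral ballI)
    fix s assume s: "s \<in> {1..N}"
    then have "1 * N \<le> s * N" by (intro mult_le_mono1) auto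
    moreover have "tri s \<ge> 1" using s by (cases s) auto
    ultimately have "n < s * N + tri s" using assms by linarith
    then show "fps_nth ((-1)^s * (\<Prod>k\<in>{s<..N}. 1 - fps_X^k) * (fps_X^(s * N + tri s) :: int fps)) n = 0"
      by (simp add: fps_X_power_mult_right_nth)
  qed
  ultimately have "fps_nth (\<Prod>k\<in>{0<..N}. 1 - fps_X^k :: int fps) n =
     fps_nth (\<Sum>s\<in>{-int N..int N}. of_int (parity_sign s) * fps_X^pent s) n"
    unfolding shanks_pent by simp
  also have "\<dots> = (\<Sum>s\<in>{-int N..int N}. if n = pent s then parity_sign s else 0)"
    by (simp add: fps_sum_nth fps_of_int[symmetric] if_distrib cong: if_cong)
  also have "\<dots> = fps_nth euler_fps n"
  proof (cases "n \<in> range pent")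
    case True
    then obtain t where t: "n = pent t" by blast
    then have "t \<in> {-int N..int N}" using pent_ge[of t] assms by auto
    moreover have "n = pent s \<longleftrightarrow> s = t" for s using t pent_inj by (auto simp: inj_def)
    ultimately show ?thesis using euler_fps_pent[of t] t by simp
  next
    case False
    then show ?thesis by (auto simp: euler_fps_def intro!: sum.neutral)
  qed
  also have "{0<..N} = {1..N}" by auto
  finally show ?thesis by simp
qed

section \<open>The Euler function on the unit disc\<close>

definition euler_function :: "complex \<Rightarrow> complex" where
  "euler_function q = (\<Sum>n. of_int (fps_nth euler_fps n) * q ^ n)"

lemma euler_function_summable:
  fixes q :: complex
  assumes "norm q < 1"
  shows "summable (\<lambda>n. norm (of_int (fps_nth euler_fps n) * q ^ n))"
proof (rule summable_comparison_test[OF _ summable_geometric], intro exI allI impI)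
  show "norm (norm q) < 1" using assms by simp
  fix n
  have "norm (of_int (fps_nth euler_fps n) :: complex) \<le> 1"
    using abs_euler_fps_le[of n] by (simp only: norm_of_int)
  from mult_right_mono[OF this, of "norm q ^ n"]
  show "norm (norm (of_int (fps_nth euler_fps n) * q ^ n)) \<le> norm q ^ n"
    by (simp add: norm_mult norm_power)
qed

lemma euler_function_has_sum:
  assumes "norm q < 1"
  shows "((\<lambda>s. of_int (parity_sign s) * q ^ pent s) has_sum euler_function q) UNIV"
proof -
  have "((\<lambda>n. of_int (fps_nth euler_fps n) * q ^ n) has_sum euler_function q) UNIV"
    unfolding euler_function_def
    using norm_summable_imp_has_sum[OF euler_function_summable[OF assms]
        summable_sums[OF summable_norm_cancel[OF euler_function_summable[OF assms]]]] .
  also have "((\<lambda>n. of_int (fps_nth euler_fps n) * q ^ n) has_sum euler_function q) UNIV \<longleftrightarrow>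
     ((\<lambda>n. of_int (fps_nth euler_fps n) * q ^ n) has_sum euler_function q) (range pent)"
    by (rule has_sum_cong_neutral) (auto simp: euler_fps_def)
  also have "\<dots> \<longleftrightarrow> ((\<lambda>s. of_int (parity_sign s) * q ^ pent s) has_sum euler_function q) UNIV"
    by (subst has_sum_reindex[OF pent_inj]) (simp add: o_def euler_fps_pent)
  finally show ?thesis .
qed

text \<open>The truncated products have the pentagonal series as limit, because the remainder in
  Shanks' identity tends to 0. They also tend to a convergent infinite product, which is nonzero
  since its factors are.\<close>

lemma euler_function_nonzero:
  assumes q: "norm q < 1"
  shows "euler_function q \<noteq> 0"
proof (cases "q = 0")
  case True
  have "euler_function 0 = of_int (fps_nth euler_fps 0)"
    unfolding euler_function_def by (subst suminf_finite[of "{0}"]) auto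
  then show ?thesis using True euler_fps_nth[of 0 0] by simp
next
  case False
  define r where "r = norm q"
  have r: "0 < r" "r < 1" using q False by (auto simp: r_def)
  define P where "P N = (\<Prod>k\<in>{1..N}. 1 - q^k)" for N
  define R where "R N = (\<Sum>s\<in>{1..N}. (-1)^s * (\<Prod>k\<in>{s<..N}. 1 - q^k) * (q^(s * N + tri s)))" for N
  have PR: "P N = (\<Sum>s\<in>{-int N..int N}. of_int (parity_sign s) * q^pent s) - R N" for N
  proof -
    have "{..N} = insert 0 {1..N}" "{0<..N} = {1..N}" by auto
    then show ?thesis
      using shanks_pent[where N = N and q = q] by (simp add: P_def R_def algebra_simps)
  qed
  \<comment> \<open>As 1 + r^k \<le> exp (r^k), every partial product is bounded by the exponential
    of the full geometric series.\<close>
  define C where "C = exp (1 / (1 - r))"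
  have Q_le: "norm (\<Prod>k\<in>{s<..N}. 1 - q^k) \<le> C" for s N
  proof -
    have "norm (\<Prod>k\<in>{s<..N}. 1 - q^k) \<le> (\<Prod>k\<in>{s<..N}. exp (r ^ k))"
      unfolding prod_norm[symmetric]
    proof (intro prod_mono conjI norm_ge_zero)
      fix k
      have "norm (1 - q^k) \<le> 1 + r^k" using norm_triangle_ineq4[of 1 "q^k"] by (simp add: r_def norm_power)
      also have "\<dots> \<le> exp (r^k)" by (rule exp_ge_add_one_self)
      finally show "norm (1 - q^k) \<le> exp (r^k)" .
    qed
    also have "\<dots> = exp (\<Sum>k\<in>{s<..N}. r ^ k)" by (simp add: exp_sum)
    also have "(\<Sum>k\<in>{s<..N}. r ^ k) \<le> (\<Sum>k. r ^ k)"
      using r by (intro sum_le_suminf summable_geometric) auto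
    also have "\<dots> = 1 / (1 - r)" using r by (intro suminf_geometric) auto
    finally show ?thesis by (simp add: C_def)
  qed
  have R_le: "norm (R N) \<le> real N * r ^ N * C" for N
  proof -
    have "norm (R N) \<le> (\<Sum>s\<in>{1..N}. C * r ^ N)"
      unfolding R_def
    proof (intro sum_norm_le)
      fix s assume "s \<in> {1..N}"
      then have "1 * N \<le> s * N" by (intro mult_le_mono1) auto
      then have "N \<le> s * N + tri s" by linarith
      then have "r ^ (s * N + tri s) \<le> r ^ N"
        using r by (intro power_decreasing) auto
      then have "norm (\<Prod>k\<in>{s<..N}. 1 - q^k) * r ^ (s * N + tri s) \<le> C * r ^ N"
        using Q_le[of s N] r by (intro mult_mono) (auto simp: C_def)
      then show "norm ((-1)^s * (\<Prod>k\<in>{s<..N}. 1 - q^k) * q^(s * N + tri s)) \<le> C * r ^ N"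
        by (simp add: norm_mult norm_power r_def)
    qed
    then show ?thesis by (simp add: mult_ac)
  qed
  have "(\<lambda>N. real N * r ^ N * C) \<longlonglongrightarrow> 0 * C"
    by (intro tendsto_intros powser_times_n_limit_0) (use r in auto)
  then have "R \<longlonglongrightarrow> 0"
    using R_le by (intro Lim_null_comparison[of R "\<lambda>N. real N * r ^ N * C"]) auto
  moreover have "(\<lambda>N. \<Sum>s\<in>{-int N..int N}. of_int (parity_sign s) * q^pent s) \<longlonglongrightarrow> euler_function q"
    using filterlim_compose[OF euler_function_has_sum[OF q, unfolded has_sum_def] filterlim_symmetric_int_intervals] .
  ultimately have "(\<lambda>N. (\<Sum>s\<in>{-int N..int N}. of_int (parity_sign s) * q^pent s) - R N) \<longlonglongrightarrow> euler_function q - 0"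
    by (intro tendsto_diff)
  then have lim: "P \<longlonglongrightarrow> euler_function q"
    unfolding PR[symmetric] by simp
  have "summable (\<lambda>k. norm ((1 - q ^ Suc k) - 1))"
    using summable_geometric[of r] r by (subst summable_Suc_iff[where f = "\<lambda>k. norm ((1 - q^k) - 1)"]) (simp add: norm_power r_def)
  then have conv: "convergent_prod (\<lambda>k. 1 - q ^ Suc k)"
    using abs_convergent_prod_conv_summable abs_convergent_prod_imp_convergent_prod by blast
  have "1 - q ^ Suc k \<noteq> 0" for k
  proof
    assume "1 - q ^ Suc k = 0"
    then have "norm (q ^ Suc k) = 1" by simp
    then have "r ^ Suc k = 1" by (simp only: norm_power r_def)
    moreover have "r ^ Suc k < 1" using r by (intro power_Suc_less_one) auto
    ultimately show False by simp
  qed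
  then have nz: "prodinf (\<lambda>k. 1 - q ^ Suc k) \<noteq> 0"
    by (rule prodinf_nonzero[OF conv])
  have "(\<lambda>n. \<Prod>i\<le>n. 1 - q ^ Suc i) \<longlonglongrightarrow> prodinf (\<lambda>k. 1 - q ^ Suc k)"
    by (rule convergent_prod_LIMSEQ[OF conv])
  moreover have "(\<Prod>i\<le>n. 1 - q ^ Suc i) = P (Suc n)" for n
    unfolding P_def by (rule prod.reindex_bij_witness[of _ "\<lambda>k. k - 1" Suc]) auto
  ultimately have "(\<lambda>n. P (Suc n)) \<longlonglongrightarrow> prodinf (\<lambda>k. 1 - q ^ Suc k)" by simp
  moreover have "(\<lambda>n. P (Suc n)) \<longlonglongrightarrow> euler_function q" using lim by (rule LIMSEQ_Suc)
  ultimately have "prodinf (\<lambda>k. 1 - q ^ Suc k) = euler_function q"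
    by (rule LIMSEQ_unique)
  with nz show ?thesis by simp
qed

lemma eta_eq_euler_function:
  assumes "Im z > 0"
  shows "eta z = e2pi (z / 24) * euler_function (e2pi z)"
proof -
  have "norm (e2pi z) < 1" using assms by (simp add: norm_e2pi)
  from has_sum_cmult_right[OF euler_function_has_sum[OF this], of "e2pi (z / 24)"]
  have "((\<lambda>s. e2pi (z / 24) * (of_int (parity_sign s) * e2pi z ^ pent s)) has_sum (e2pi (z / 24) * euler_function (e2pi z))) UNIV" .
  moreover have "e2pi (z / 24) * (of_int (parity_sign s) * e2pi z ^ pent s) = eta_term z s" for s
  proof -
    have "24 * int (pent s) + 1 = (6 * s + 1)^2"
      using pent_double[of s] by (simp add: power2_eq_square algebra_simps)
    then have "e2pi (of_int ((6 * s + 1)^2) * z / 24) = e2pi (of_int (24 * int (pent s) + 1) * z / 24)"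
      by (simp only:)
    also have "of_int (24 * int (pent s) + 1) * z / 24 = z / 24 + of_nat (pent s) * z"
      by (simp add: field_simps)
    finally have "e2pi (of_int ((6 * s + 1)^2) * z / 24) = e2pi (z / 24 + of_nat (pent s) * z)" .
    then show ?thesis unfolding eta_term_def e2pi_power
      by (simp add: e2pi_add parity_sign_def parity_sign_def mult_ac)
  qed
  ultimately show ?thesis
    using has_sum_unique[OF eta_has_sum[OF assms]] by simp
qed

lemma eta_nonzero: "Im z > 0 \<Longrightarrow> eta z \<noteq> 0"
  by (simp add: eta_eq_euler_function euler_function_nonzero norm_e2pi)

section \<open>Hecke operators on the upper half-plane\<close>

lemma norm_e2pi_less_1: "Im z > 0 \<Longrightarrow> norm (e2pi z) < 1"
  by (simp add: norm_e2pi)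

lemma e2pi_surj:
  assumes "norm q < 1" "q \<noteq> 0"
  obtains z where "Im z > 0" "e2pi z = q"
proof
  let ?z = "Ln q / (2 * of_real pi * \<i>)"
  show "e2pi ?z = q" using assms by (simp add: e2pi_def)
  then have "exp (- 2 * pi * Im ?z) < 1" using assms norm_e2pi[of ?z] by simp
  then have "0 < pi * Im ?z" by simp
  then show "Im ?z > 0" using pi_gt_zero by (rule zero_less_mult_pos)
qed

text \<open>The functions u(z), v(z) = u(-1/z) and v(z + 1) correspond to the three cosets of
  Gamma_0(2) in the modular group: z \<mapsto> z + 1 fixes u and exchanges the other two, z
  \<mapsto> -1/z exchanges u and v and fixes the third. A bound for all three on Im z \<ge> 1/2
  therefore spreads to the whole half-plane. It is a maximum over closed discs in the two local
  variables, hence attained inside, and the maximum principle applies.\<close>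

lemma modular_function_constant:
  assumes h1: "h1 holomorphic_on ball 0 1" and h2: "h2 holomorphic_on ball 0 1"
    and u1: "\<And>z. Im z > 0 \<Longrightarrow> u z = h1 (e2pi z)"
    and u2: "\<And>z. Im z > 0 \<Longrightarrow> u (-1 / z) = h2 (e2pi (z / 2))"
  obtains c where "\<And>q. norm q < 1 \<Longrightarrow> h1 q = c"
proof -
  define v where "v z = u (-1 / z)" for z
  have Im_inv: "Im (-1 / z) = Im z / (norm z)^2" for z
    by (simp add: Im_divide cmod_power2)
  have Im_inv_pos: "Im (-1 / z) > 0" if "Im z > 0" for z
    unfolding Im_inv using that by (intro divide_pos_pos) auto
  have u_shift: "u (z + of_int k) = u z" if "Im z > 0" for z k
    using u1[of z] u1[of "z + of_int k"] that by (simp add: e2pi_add)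
  have v_shift: "v (z + 2 * of_int k) = v z" if "Im z > 0" for z k
  proof -
    have "e2pi ((z + 2 * of_int k) / 2) = e2pi (z / 2 + of_int k)" by (simp add: add_divide_distrib)
    then show ?thesis using u2[of z] u2[of "z + 2 * of_int k"] that by (simp add: v_def e2pi_add)
  qed
  \<comment> \<open>This is the modulus of \<open>e2pi (z / 2)\<close> on the line Im z = 1/2; that
    of \<open>e2pi z\<close> is smaller there.\<close>
  define \<rho> where "\<rho> = exp (- pi / 2)"
  have \<rho>: "0 < \<rho>" "\<rho> < 1" by (simp_all add: \<rho>_def)
  have sub: "cball 0 \<rho> \<subseteq> ball (0 :: complex) 1" using \<rho> by auto
  have max_ex: "\<exists>x\<in>cball 0 \<rho>. \<forall>y\<in>cball 0 \<rho>. norm (h y) \<le> norm (h x)" if "h holomorphic_on ball 0 1" for h :: "complex \<Rightarrow> complex"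
    by (rule continuous_attains_sup)
       (use \<rho> in \<open>auto intro!: continuous_intros holomorphic_on_imp_continuous_on holomorphic_on_subset[OF that sub]\<close>)
  obtain x1 where x1: "x1 \<in> cball 0 \<rho>" "\<forall>y\<in>cball 0 \<rho>. norm (h1 y) \<le> norm (h1 x1)"
    using max_ex[OF h1] by blast
  obtain x2 where x2: "x2 \<in> cball 0 \<rho>" "\<forall>y\<in>cball 0 \<rho>. norm (h2 y) \<le> norm (h2 x2)"
    using max_ex[OF h2] by blast
  define M where "M = max (norm (h1 x1)) (norm (h2 x2))"
  have h1_le: "norm (h1 y) \<le> M" if "norm y \<le> \<rho>" for y using that x1 by (simp add: M_def le_max_iff_disj)
  have h2_le: "norm (h2 y) \<le> M" if "norm y \<le> \<rho>" for y using that x2 by (simp add: M_def le_max_iff_disj)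
  have base: "norm (u z) \<le> M \<and> norm (v z) \<le> M \<and> norm (v (z + 1)) \<le> M" if "Im z \<ge> 1 / 2" for z
  proof -
    have pos: "Im z > 0" "Im (z + 1) > 0" using that by auto
    have "norm (e2pi z) \<le> \<rho>" "norm (e2pi (z / 2)) \<le> \<rho>" "norm (e2pi ((z + 1) / 2)) \<le> \<rho>"
      using that by (simp_all add: norm_e2pi \<rho>_def)
    then show ?thesis
      unfolding v_def u1[OF pos(1)] u2[OF pos(1)] u2[OF pos(2)] using h1_le h2_le by blast
  qed
  have bound: "norm (u z) \<le> M \<and> norm (v z) \<le> M \<and> norm (v (z + 1)) \<le> M" if "Im z \<ge> 1 / 2 ^ Suc n" for n z
    using that
  proof (induction n arbitrary: z)
    case 0
    then show ?case by (intro base) simp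
  next
    case (Suc n)
    show ?case
    proof (cases "Im z \<ge> 1 / 2")
      case False
      have "0 < (1 / 2 ^ Suc (Suc n) :: real)" by simp
      then have pos: "Im z > 0" using Suc.prems by linarith
      define k where "k = round (Re z)"
      define w where "w = z - of_int k"
      have w_pos: "Im w > 0" using pos by (simp add: w_def)
      have w0: "w \<noteq> 0" using w_pos by auto
      have re: "\<bar>Re w\<bar> \<le> 1 / 2" using of_int_round_abs_le[of "Re z"] by (simp add: w_def k_def abs_minus_commute)
      have im: "\<bar>Im w\<bar> \<le> 1 / 2" using False w_pos by (simp add: w_def)
      \<comment> \<open>With both coordinates at most 1/2 in modulus, |w|^2 \<le> 1/2, so w
        \<mapsto> -1/w at least doubles the imaginary part; this drives the induction on n.\<close>
      have "(Re w)^2 \<le> (1/2)^2" by (subst power2_le_iff_abs_le) (use re in simp_all)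
      moreover have "(Im w)^2 \<le> (1/2)^2" by (subst power2_le_iff_abs_le) (use im in simp_all)
      ultimately have "(norm w)^2 \<le> 1 / 2" unfolding cmod_power2 by (simp add: power2_eq_square)
      then have "Im w / (norm w)^2 \<ge> Im w / (1 / 2)"
        using w_pos w0 by (intro divide_left_mono) auto
      then have "Im (-1 / w) \<ge> 2 * Im z" unfolding Im_inv by (simp add: w_def)
      then have "Im (-1 / w) \<ge> 1 / 2 ^ Suc n" using Suc.prems by simp
      from Suc.IH[OF this] have IH: "norm (u (-1 / w)) \<le> M" "norm (v (-1 / w)) \<le> M" "norm (v (-1 / w + 1)) \<le> M"
        by auto
      have vw: "norm (v w) \<le> M" using IH(1) by (simp add: v_def)
      have uw: "norm (u w) \<le> M" using IH(2) w0 by (simp add: v_def)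
      have w1: "w - 1 \<noteq> 0" "Im (w - 1) > 0" using w_pos by (auto simp: complex_eq_iff)
      \<comment> \<open>The point -1/w + 1 is inverted to an integer translate of -1/(w - 1), so the
        third function at -1/w reduces to v(w - 1), which equals v(w + 1).\<close>
      have "-1 / (-1 / w + 1) = -1 / (w - 1) + of_int (-1)"
        using w0 w1 by (simp add: field_simps)
      then have "v (-1 / w + 1) = v (w - 1)"
        using u_shift[OF Im_inv_pos[OF w1(2)], of "-1"] by (simp add: v_def)
      moreover have "v (w + 1) = v (w - 1)" using v_shift[OF w1(2), of 1] by (simp add: algebra_simps)
      ultimately have vw1: "norm (v (w + 1)) \<le> M" using IH(3) by simp
      have v_all: "norm (v (w + of_int m)) \<le> M" for m
      proof (cases "even m")
        case True
        then obtain l where "m = 2 * l" by blast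
        then show ?thesis using v_shift[OF w_pos, of l] vw by simp
      next
        case False
        then obtain l where "m = 2 * l + 1" by (metis oddE)
        moreover have "Im (w + 1) > 0" using w_pos by simp
        ultimately show ?thesis using v_shift[of "w + 1" l] vw1 by (simp add: algebra_simps)
      qed
      have z: "z = w + of_int k" "z + 1 = w + of_int (k + 1)" by (simp_all add: w_def)
      show ?thesis
        using v_all[of k] v_all[of "k + 1"] u_shift[OF w_pos, of k] uw
        unfolding z[symmetric] by simp
    qed (use base in blast)
  qed
  have bound': "norm (u z) \<le> M" "norm (v z) \<le> M" if z: "Im z > 0" for z
  proof -
    obtain n where "1 / Im z < 2 ^ n" using real_arch_pow[of 2] by auto
    moreover have "(2 :: real) ^ n \<le> 2 ^ Suc n" by simp
    ultimately have "1 / Im z \<le> 2 ^ Suc n" by linarith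
    then have "Im z \<ge> 1 / 2 ^ Suc n" using z by (simp add: field_simps)
    then show "norm (u z) \<le> M" "norm (v z) \<le> M" using bound by auto
  qed
  have h1_M: "norm (h1 q) \<le> M" if q: "norm q < 1" for q
  proof (cases "q = 0")
    case True
    then show ?thesis using h1_le[of 0] \<rho> by simp
  next
    case False
    obtain z where "Im z > 0" "e2pi z = q" using e2pi_surj[OF q False] .
    then show ?thesis using bound'(1)[of z] u1[of z] by simp
  qed
  have h2_M: "norm (h2 q) \<le> M" if q: "norm q < 1" for q
  proof (cases "q = 0")
    case True
    then show ?thesis using h2_le[of 0] \<rho> by simp
  next
    case False
    obtain z where "Im z > 0" "e2pi z = q" using e2pi_surj[OF q False] .
    then show ?thesis using bound'(2)[of "2 * z"] u2[of "2 * z"] by (simp add: v_def)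
  qed
  have x1b: "x1 \<in> ball 0 1" and x2b: "x2 \<in> ball 0 1" using x1 x2 sub by auto
  show ?thesis
  proof (cases "M = norm (h1 x1)")
    case True
    have "h1 constant_on ball 0 1"
      by (rule maximum_modulus_principle[OF h1 _ _ _ _ x1b]) (use h1_M True in auto)
    then show ?thesis using that by (auto simp: constant_on_def)
  next
    case False
    then have M: "M = norm (h2 x2)" by (auto simp: M_def max_def split: if_splits)
    have "h2 constant_on ball 0 1"
      by (rule maximum_modulus_principle[OF h2 _ _ _ _ x2b]) (use h2_M M in auto)
    then obtain c where c: "\<And>q. norm q < 1 \<Longrightarrow> h2 q = c" by (auto simp: constant_on_def)
    have h1c: "h1 q = c" if q: "norm q < 1" "q \<noteq> 0" for q
    proof -
      obtain z where z: "Im z > 0" "e2pi z = q" using e2pi_surj[OF q] .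
      then have "z \<noteq> 0" by auto
      define y where "y = -1 / z"
      have y: "Im y > 0" unfolding y_def by (rule Im_inv_pos[OF z(1)])
      then have "norm (e2pi (y / 2)) < 1" by (intro norm_e2pi_less_1) simp
      then have "u (-1 / y) = c" using u2[OF y] c by simp
      moreover have "-1 / y = z" by (simp add: y_def)
      ultimately show ?thesis using u1[OF z(1)] z by simp
    qed
    have "h1 constant_on ball 0 1"
    \<comment> \<open>So far \<open>h1\<close> is constant on the punctured disc. On a ball that
      avoids 0 it has constant modulus, so the maximum principle carries constancy to the whole
      disc, including the cusp q = 0.\<close>
    proof (rule maximum_modulus_principle[OF h1 _ _ _ _ , of "ball (1/2) (1/4)" "1/2"])
      have *: "norm z < 1 \<and> z \<noteq> 0" if "z \<in> ball (1/2) (1/4)" for z :: complex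
      proof -
        have "norm (1/2 - z) < 1/4" using that by (simp add: dist_norm)
        moreover have "norm (1/2 :: complex) = 1/2" by (simp add: norm_divide)
        moreover have "norm z \<le> norm (1/2 :: complex) + norm (1/2 - z)" using norm_triangle_ineq4[of "1/2" "1/2 - z"] by simp
        moreover have "norm (1/2 :: complex) \<le> norm z + norm (1/2 - z)" using norm_triangle_ineq[of z "1/2 - z"] by simp
        ultimately show ?thesis by auto
      qed
      show "ball (1/2) (1/4) \<subseteq> ball (0::complex) 1" using * by auto
      show "norm (h1 z) \<le> norm (h1 (1/2))" if "z \<in> ball (1/2) (1/4)" for z
        using h1c *[OF that] *[of "1/2"] by simp
    qed auto
    then show ?thesis using that by (auto simp: constant_on_def)
  qed
qed

section \<open>Hecke operators on power series\<close>

lemma root_of_unity_sum: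
  assumes p: "p > (0::nat)" and co: "coprime u (int p)"
  shows "(\<Sum>j<p. e2pi (of_int (a * u * int j) / of_nat p)) = (if int p dvd a then of_nat p else 0)"
proof (cases "int p dvd a")
  case True
  then obtain l where l: "a = int p * l" by blast
  have "e2pi (of_int (a * u * int j) / of_nat p) = 1" for j
  proof -
    have "of_int (a * u * int j) / of_nat p = (of_int (l * u * int j) :: complex)"
      using p by (simp add: l)
    then show ?thesis by (simp only: e2pi_of_int)
  qed
  then show ?thesis using True by simp
next
  case False
  define w where "w = e2pi (of_int (a * u) / of_nat p)"
  have "w \<noteq> 1"
  proof
    assume "w = 1"
    then obtain l where l: "of_int (a * u) / of_nat p = (of_int l :: complex)"
      unfolding w_def e2pi_eq_1_iff by (auto elim: Ints_cases)
    then have "of_int (a * u) = (of_int (l * int p) :: complex)" using p by (simp add: field_simps)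
    then have "a * u = l * int p" by (simp only: of_int_eq_iff)
    then have "int p dvd a * u" by simp
    then show False using co False by (simp add: coprime_commute coprime_dvd_mult_left_iff)
  qed
  moreover have "w ^ p = 1"
  proof -
    have "of_nat p * (of_int (a * u) / of_nat p) = (of_int (a * u) :: complex)" using p by simp
    then show ?thesis unfolding w_def e2pi_power by (simp only: e2pi_of_int)
  qed
  moreover have "e2pi (of_int (a * u * int j) / of_nat p) = w ^ j" for j
    unfolding w_def e2pi_power by (simp add: mult_ac)
  ultimately show ?thesis using False by (simp add: sum_gp_strict)
qed

text \<open>The index n stands for the exponent s + 24 n, and \<Delta> is taken with 24 \<Delta> = s
  (p - 1), so that p (s + 24 m) = s + 24 (p m + \<Delta>). The first summand divides by p the
  exponents divisible by p, the second multiplies exponents by p. The ring is general because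
  integer series and their complex images are both transformed.\<close>

definition hecke_fps :: "nat \<Rightarrow> nat \<Rightarrow> nat \<Rightarrow> 'a::comm_ring_1 fps \<Rightarrow> 'a fps" where
  "hecke_fps p w \<Delta> C = Abs_fps (\<lambda>m. fps_nth C (p * m + \<Delta>)) + of_nat (p ^ w) * fps_X ^ \<Delta> * (C oo fps_X ^ p)"

lemma eval_fps_has_sum:
  fixes C :: "complex fps"
  assumes "fps_conv_radius C \<ge> 1" "norm q < 1"
  shows "((\<lambda>n. fps_nth C n * q ^ n) has_sum eval_fps C q) UNIV"
proof -
  have "ereal (norm q) < fps_conv_radius C" using assms by (metis ereal_less(3) less_le_trans)
  then show ?thesis
    by (intro norm_summable_imp_has_sum norm_summable_fps sums_eval_fps)
qed

lemma fps_conv_radius_ge_1I: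
  fixes C :: "complex fps"
  assumes "\<And>r. 0 < r \<Longrightarrow> r < 1 \<Longrightarrow> summable (\<lambda>n. fps_nth C n * of_real r ^ n)"
  shows "fps_conv_radius C \<ge> 1"
  unfolding fps_conv_radius_def
proof (rule conv_radius_geI_ex)
  fix r :: real assume "0 < r" "ereal r < 1"
  then show "\<exists>z. norm z = r \<and> summable (\<lambda>n. fps_nth C n * z ^ n)"
    using assms[of r] by (intro exI[of _ "of_real r"]) auto
qed

lemma fps_compose_X_power_has_sum:
  fixes C :: "complex fps"
  assumes d: "d > 0" and "fps_conv_radius C \<ge> 1" "norm q < 1"
  shows "((\<lambda>n. fps_nth (C oo fps_X ^ d) n * q ^ n) has_sum eval_fps C (q ^ d)) UNIV"
proof -
  have "norm (q ^ d) < 1" using assms by (simp add: norm_power power_less_one_iff)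
  from eval_fps_has_sum[OF assms(2) this]
  have "((\<lambda>n. fps_nth (C oo fps_X ^ d) n * q ^ n) has_sum eval_fps C (q ^ d)) (range ((*) d))"
    using d by (subst has_sum_reindex) (auto simp: inj_def o_def fps_nth_compose_X_power power_mult)
  also have "?this \<longleftrightarrow> ?thesis"
    by (rule has_sum_cong_neutral) (use d in \<open>auto simp: fps_nth_compose_X_power elim!: dvdE\<close>)
  finally show ?thesis .
qed

lemma
  fixes C :: "complex fps"
  assumes "d > 0" "fps_conv_radius C \<ge> 1"
  shows fps_conv_radius_compose_X_power: "fps_conv_radius (C oo fps_X ^ d) \<ge> 1"
    and eval_fps_compose_X_power: "norm q < 1 \<Longrightarrow> eval_fps (C oo fps_X ^ d) q = eval_fps C (q ^ d)"
proof -
  show "fps_conv_radius (C oo fps_X ^ d) \<ge> 1"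
  proof (rule fps_conv_radius_ge_1I)
    fix r :: real assume "0 < r" "r < 1"
    then show "summable (\<lambda>n. fps_nth (C oo fps_X ^ d) n * of_real r ^ n)"
      using has_sum_imp_sums[OF fps_compose_X_power_has_sum[OF assms, of "of_real r"]] by (auto simp: sums_iff)
  qed
  assume "norm q < 1"
  then show "eval_fps (C oo fps_X ^ d) q = eval_fps C (q ^ d)"
    using has_sum_imp_sums[OF fps_compose_X_power_has_sum[OF assms, of q]] by (auto simp: sums_iff eval_fps_def)
qed

text \<open>The series \<open>\<Phi>\<close> in powers of \<open>e2pi (24 * z / D)\<close>, averaged over the translates of \<open>z / p\<close>,
  keeps the exponents divisible by \<open>p\<close>; as \<open>s < 24\<close>, no negative exponents arise.\<close>

lemma hecke_expansion:
  fixes C :: "complex fps" and p s D w :: nat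
  defines "\<Phi> \<equiv> \<lambda>z. e2pi (of_nat s * z / of_nat D) * eval_fps C (e2pi (24 * z / of_nat D))"
  assumes C: "fps_conv_radius C \<ge> 1" and p: "prime p" "[p = 1] (mod 24)" and s: "0 < s" "s < 24"
    and D: "D = 24 \<or> D = 48" and \<Delta>: "\<Delta> = s * (p - 1) div 24"
  shows "fps_conv_radius (hecke_fps p w \<Delta> C) \<ge> 1"
    and "Im z > 0 \<Longrightarrow> of_nat p ^ w * \<Phi> (of_nat p * z) + (\<Sum>j<p. \<Phi> ((z + 48 * of_nat j) / of_nat p)) / of_nat p =
      e2pi (of_nat s * z / of_nat D) * eval_fps (hecke_fps p w \<Delta> C) (e2pi (24 * z / of_nat D))"
proof -
  have p0: "p > 0" using p by (simp add: prime_gt_0_nat)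
  have Dpos: "D > 0" using D by auto
  have "24 dvd p - 1" using p(2) by (rule cong_to_1_nat)
  then have \<Delta>24: "24 * \<Delta> = s * (p - 1)" unfolding \<Delta> by simp
  have \<Delta>s: "s + 24 * \<Delta> = p * s" unfolding \<Delta>24 using p0 by (cases p) auto
  \<comment> \<open>The ratio 48 / D: the translate by 48 j multiplies the term of index n by
    \<open>e2pi\<close> of (s + 24 n) u j / p, and as u is a unit modulo p the average over j
    selects p dvd s + 24 n.\<close>
  define u where "u = (if D = 24 then 2 else 1 :: int)"
  have Du: "int D * u = 48" using D by (auto simp: u_def)
  have "odd p" using p by (auto simp: unique_euclidean_semiring_class.cong_def) presburger
  then have co: "coprime u (int p)" by (auto simp: u_def)
  define U where "U = Abs_fps (\<lambda>m. fps_nth C (p * m + \<Delta>))"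
  \<comment> \<open>If s + 24 n = p l, then l \<equiv> s modulo 24, and s < 24 forces l = s + 24 m
    with m \<ge> 0. For larger s the value l could drop below s, which would be a pole of the
    quotient.\<close>
  have idx: "p dvd s + 24 * n \<longleftrightarrow> n \<in> range (\<lambda>m. p * m + \<Delta>)" for n
  proof
    assume "p dvd s + 24 * n"
    then obtain l where l: "s + 24 * n = p * l" by blast
    have "[p * l = 1 * l] (mod 24)" using p(2) by (rule cong_scalar_right)
    then have "[s + 24 * n = l] (mod 24)" using l by simp
    then have sl: "s mod 24 = l mod 24" by (simp add: unique_euclidean_semiring_class.cong_def)
    then have "s = l mod 24" using s by simp
    then obtain m where m: "l = s + 24 * m" by (metis mod_mult_div_eq)
    have "24 * n = 24 * (p * m + \<Delta>)" using l \<Delta>s unfolding m by (simp add: algebra_simps)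
    then have "n = p * m + \<Delta>"
      by (simp only: mult_cancel_left zero_neq_numeral[symmetric] simp_thms)
    then show "n \<in> range (\<lambda>m. p * m + \<Delta>)" by auto
  next
    assume "n \<in> range (\<lambda>m. p * m + \<Delta>)"
    then obtain m where "n = p * m + \<Delta>" by blast
    then have "s + 24 * n = p * (s + 24 * m)" using \<Delta>s by (simp add: algebra_simps)
    then show "p dvd s + 24 * n" by simp
  qed
  have inj: "inj (\<lambda>m. p * m + \<Delta>)" using p0 by (auto simp: inj_def)
  have avg: "((\<lambda>m. e2pi (of_nat s * z / of_nat D) * (fps_nth U m * e2pi (24 * z / of_nat D) ^ m)) has_sum
       (\<Sum>j<p. \<Phi> ((z + 48 * of_nat j) / of_nat p)) / of_nat p) UNIV" if z: "Im z > 0" for z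
  proof -
    define t where "t n = fps_nth C n * e2pi (of_nat (s + 24 * n) * z / (of_nat D * of_nat p))" for n
    have hs: "((\<lambda>n. t n * e2pi (of_int (int (s + 24 * n) * u * int j) / of_nat p)) has_sum \<Phi> ((z + 48 * of_nat j) / of_nat p)) UNIV" for j
    proof -
      let ?z = "(z + 48 * of_nat j) / of_nat p"
      have "Im (24 * ?z / of_nat D) > 0"
        using z p0 Dpos by simp
      then have "norm (e2pi (24 * ?z / of_nat D)) < 1" by (rule norm_e2pi_less_1)
      from has_sum_cmult_right[OF eval_fps_has_sum[OF C this], of "e2pi (of_nat s * ?z / of_nat D)"]
      have "((\<lambda>n. e2pi (of_nat s * ?z / of_nat D) * (fps_nth C n * e2pi (24 * ?z / of_nat D) ^ n)) has_sum \<Phi> ?z) UNIV"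
        unfolding \<Phi>_def .
      moreover have "e2pi (of_nat s * ?z / of_nat D) * (fps_nth C n * e2pi (24 * ?z / of_nat D) ^ n) =
          t n * e2pi (of_int (int (s + 24 * n) * u * int j) / of_nat p)" for n
      proof -
        have "of_nat s * ?z / of_nat D + of_nat n * (24 * ?z / of_nat D) =
           of_nat (s + 24 * n) * z / (of_nat D * of_nat p) + of_nat (s + 24 * n) * (48 * of_nat j) / (of_nat D * of_nat p)"
          using p0 Dpos by (simp add: field_simps)
        also have "of_nat (s + 24 * n) * (48 * of_nat j) / (of_nat D * of_nat p) = (of_int (int (s + 24 * n) * u * int j) / of_nat p :: complex)"
        proof -
          have "(48 :: complex) = of_nat D * of_int u" using Du by (metis of_int_mult of_int_numeral of_int_of_nat_eq)
          then have "(48 :: complex) * of_nat j = of_nat D * (of_int u * of_nat j)" by simp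
          then show ?thesis using Dpos by (simp only:) (simp add: mult_ac)
        qed
        finally have e: "of_nat s * ?z / of_nat D + of_nat n * (24 * ?z / of_nat D) =
           of_nat (s + 24 * n) * z / (of_nat D * of_nat p) + of_int (int (s + 24 * n) * u * int j) / of_nat p" .
        have "e2pi (of_nat s * ?z / of_nat D) * (fps_nth C n * e2pi (24 * ?z / of_nat D) ^ n) =
          fps_nth C n * e2pi (of_nat s * ?z / of_nat D + of_nat n * (24 * ?z / of_nat D))"
          by (simp add: e2pi_power e2pi_add)
        then show ?thesis unfolding e t_def by (simp add: e2pi_add)
      qed
      ultimately show ?thesis by simp
    qed
    have "((\<lambda>n. \<Sum>j<p. t n * e2pi (of_int (int (s + 24 * n) * u * int j) / of_nat p)) has_sum (\<Sum>j<p. \<Phi> ((z + 48 * of_nat j) / of_nat p))) UNIV"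
      by (intro has_sum_finite_sum hs) auto
    then have "((\<lambda>n. if p dvd s + 24 * n then t n * of_nat p else 0) has_sum (\<Sum>j<p. \<Phi> ((z + 48 * of_nat j) / of_nat p))) UNIV"
      unfolding sum_distrib_left[symmetric] root_of_unity_sum[OF p0 co] int_dvd_int_iff
      by (simp add: if_distrib cong: if_cong)
    from has_sum_cmult_left[OF this, of "1 / of_nat p"]
    have "((\<lambda>n. if p dvd s + 24 * n then t n else 0) has_sum (\<Sum>j<p. \<Phi> ((z + 48 * of_nat j) / of_nat p)) / of_nat p) UNIV"
      using p0 by (simp add: if_distrib if_distribR cong: if_cong)
    also have "?this \<longleftrightarrow> (t has_sum (\<Sum>j<p. \<Phi> ((z + 48 * of_nat j) / of_nat p)) / of_nat p) (range (\<lambda>m. p * m + \<Delta>))"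
      by (rule has_sum_cong_neutral) (auto simp: idx)
    also have "\<dots> \<longleftrightarrow> ((\<lambda>m. t (p * m + \<Delta>)) has_sum (\<Sum>j<p. \<Phi> ((z + 48 * of_nat j) / of_nat p)) / of_nat p) UNIV"
      by (subst has_sum_reindex[OF inj]) (simp add: o_def)
    also have "(\<lambda>m. t (p * m + \<Delta>)) = (\<lambda>m. e2pi (of_nat s * z / of_nat D) * (fps_nth U m * e2pi (24 * z / of_nat D) ^ m))"
    proof
      fix m
      have "s + 24 * (p * m + \<Delta>) = p * (s + 24 * m)" using \<Delta>s by (simp add: algebra_simps)
      then have "of_nat (s + 24 * (p * m + \<Delta>)) * z / (of_nat D * of_nat p) = of_nat (p * (s + 24 * m)) * z / (of_nat D * of_nat p)"
        by (simp only:)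
      also have "\<dots> = of_nat s * z / of_nat D + of_nat m * (24 * z / of_nat D)"
        using p0 Dpos by (simp add: field_simps)
      finally show "t (p * m + \<Delta>) = e2pi (of_nat s * z / of_nat D) * (fps_nth U m * e2pi (24 * z / of_nat D) ^ m)"
        unfolding t_def U_def by (simp add: e2pi_power e2pi_add)
    qed
    finally show ?thesis .
  qed
  have U_sum: "((\<lambda>m. fps_nth U m * e2pi (24 * z / of_nat D) ^ m) has_sum
       (\<Sum>j<p. \<Phi> ((z + 48 * of_nat j) / of_nat p)) / of_nat p / e2pi (of_nat s * z / of_nat D)) UNIV" if z: "Im z > 0" for z
    using has_sum_cmult_right[OF avg[OF z], of "1 / e2pi (of_nat s * z / of_nat D)"] by (simp add: mult.commute)
  have U: "fps_conv_radius U \<ge> 1"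
  proof (rule fps_conv_radius_ge_1I)
    fix r :: real assume "0 < r" "r < 1"
    then obtain z where z: "Im z > 0" "e2pi z = of_real r" using e2pi_surj[of "of_real r"] by auto
    have "24 * (of_nat D * z / 24) / of_nat D = z" using Dpos by simp
    then show "summable (\<lambda>n. fps_nth U n * of_real r ^ n)"
      using has_sum_imp_sums[OF U_sum[of "of_nat D * z / 24"]] z Dpos by (auto simp: sums_iff)
  qed
  define V where "V = of_nat (p ^ w) * fps_X ^ \<Delta> * (C oo fps_X ^ p)"
  have Cp: "fps_conv_radius (C oo fps_X ^ p) \<ge> 1" by (rule fps_conv_radius_compose_X_power[OF p0 C])
  have pX: "fps_conv_radius (of_nat (p ^ w) * fps_X ^ \<Delta> :: complex fps) = \<infinity>"
    using fps_conv_radius_mult[of "of_nat (p ^ w) :: complex fps" "fps_X ^ \<Delta>"] by (simp flip: fps_of_nat)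
  have V: "fps_conv_radius V \<ge> 1"
    using fps_conv_radius_mult[of "of_nat (p ^ w) * fps_X ^ \<Delta>" "C oo fps_X ^ p"] Cp pX
    unfolding V_def by (auto simp: min_def split: if_splits)
  have T: "hecke_fps p w \<Delta> C = U + V" by (simp add: hecke_fps_def U_def V_def)
  show "fps_conv_radius (hecke_fps p w \<Delta> C) \<ge> 1"
    using fps_conv_radius_add[of U V] U V unfolding T by (auto simp: min_def split: if_splits)
  assume z: "Im z > 0"
  let ?q = "e2pi (24 * z / of_nat D)"
  have q: "norm ?q < 1" using z Dpos by (simp add: norm_e2pi)
  have qr: "ereal (norm ?q) < R" if "R \<ge> 1" for R using q that by (metis ereal_less(3) less_le_trans)
  have "eval_fps (hecke_fps p w \<Delta> C) ?q = eval_fps U ?q + eval_fps V ?q"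
    unfolding T by (rule eval_fps_add) (use qr U V in auto)
  also have "eval_fps U ?q = (\<Sum>j<p. \<Phi> ((z + 48 * of_nat j) / of_nat p)) / of_nat p / e2pi (of_nat s * z / of_nat D)"
    using has_sum_unique[OF eval_fps_has_sum[OF U q] U_sum[OF z]] .
  also have "eval_fps V ?q = eval_fps (of_nat (p ^ w) * fps_X ^ \<Delta>) ?q * eval_fps (C oo fps_X ^ p) ?q"
    unfolding V_def by (rule eval_fps_mult) (use qr Cp pX in auto)
  also have "eval_fps (of_nat (p ^ w) * fps_X ^ \<Delta>) ?q = of_nat p ^ w * ?q ^ \<Delta>"
    by (subst eval_fps_mult) (simp_all flip: fps_of_nat of_nat_power)
  also have "eval_fps (C oo fps_X ^ p) ?q = eval_fps C (?q ^ p)"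
    by (rule eval_fps_compose_X_power[OF p0 C q])
  finally show "of_nat p ^ w * \<Phi> (of_nat p * z) + (\<Sum>j<p. \<Phi> ((z + 48 * of_nat j) / of_nat p)) / of_nat p =
      e2pi (of_nat s * z / of_nat D) * eval_fps (hecke_fps p w \<Delta> C) ?q"
  proof -
    assume e: "eval_fps (hecke_fps p w \<Delta> C) ?q = (\<Sum>j<p. \<Phi> ((z + 48 * of_nat j) / of_nat p)) / of_nat p / e2pi (of_nat s * z / of_nat D) +
      of_nat p ^ w * ?q ^ \<Delta> * eval_fps C (?q ^ p)"
    have "of_nat s * (of_nat p * z) / of_nat D = of_nat (p * s) * z / of_nat D" by simp
    also have "\<dots> = of_nat s * z / of_nat D + of_nat \<Delta> * (24 * z / of_nat D)"
      unfolding \<Delta>s[symmetric] using Dpos by (simp add: field_simps)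
    finally have "e2pi (of_nat s * (of_nat p * z) / of_nat D) = e2pi (of_nat s * z / of_nat D) * ?q ^ \<Delta>"
      by (simp only: e2pi_power e2pi_add)
    moreover have "e2pi (24 * (of_nat p * z) / of_nat D) = ?q ^ p" by (simp add: e2pi_power mult_ac)
    ultimately have "\<Phi> (of_nat p * z) = e2pi (of_nat s * z / of_nat D) * ?q ^ \<Delta> * eval_fps C (?q ^ p)"
      unfolding \<Phi>_def by simp
    then show ?thesis unfolding e by (simp add: distrib_left)
  qed
qed

section \<open>Gauss sums modulo p and the inversion of the Hecke operator\<close>

lemma prime_1_mod_8_squares:
  assumes p: "prime p" and p8: "[p = 1] (mod (8::nat))"
  obtains i s :: int where "[i^2 = -1] (mod int p)" "[s^2 = 2] (mod int p)"
proof -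
  have p2: "p > 1" using p by (rule prime_gt_1_nat)
  have "8 dvd p - 1" using p8 by (rule cong_to_1_nat)
  then obtain l where l: "p - 1 = 8 * l" by blast
  have l0: "l > 0" using l p2 by (cases l) auto
  obtain g where g: "residue_primroot p g" using prime_primitive_root_exists[OF p2 p] by blast
  then have ord: "ord p g = p - 1" using p by (simp add: residue_primroot_def totient_prime)
  \<comment> \<open>A primitive eighth root of unity modulo p: z^4 \<equiv> -1, so z^2 is a square
    root of -1.\<close>
  define z where "z = int g ^ l"
  have "[g ^ (p - 1) = 1] (mod p)" using ord_works[of g p] ord by simp
  then have "[int (g ^ (8 * l)) = int 1] (mod int p)" unfolding l cong_int_iff .
  then have z8: "[z ^ 8 = 1] (mod int p)" by (simp add: z_def power_mult[symmetric] mult.commute)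
  have "4 * l < ord p g" using l l0 ord by simp
  then have "\<not> [g ^ (4 * l) = 1] (mod p)" using ord_minimal[of "4 * l" p g] l0 by simp
  then have "\<not> [int (g ^ (4 * l)) = int 1] (mod int p)" unfolding cong_int_iff .
  then have z4: "\<not> [z ^ 4 = 1] (mod int p)" by (simp add: z_def power_mult[symmetric] mult.commute)
  have "int p dvd (z ^ 4 - 1) * (z ^ 4 + 1)"
    using z8 by (simp add: cong_iff_dvd_diff algebra_simps power_add[symmetric])
  then have z4': "int p dvd z ^ 4 + 1"
    using z4 p by (simp add: prime_dvd_mult_iff cong_iff_dvd_diff)
  show ?thesis
  proof
    show "[(z^2)^2 = -1] (mod int p)" using z4' by (simp add: cong_iff_dvd_diff power_mult[symmetric])
    \<comment> \<open>Modulo p this is z + 1/z, because z^7 is the inverse of z; its square is z^2 +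
      2 + z^(-2), and the outer terms cancel.\<close>
    define s where "s = (1 + z^2) * z^7"
    have "s^2 - 2 = (z ^ 4 + 1) * (z^14 + 2 * z^12 - 2 * z^8 + 2 * z^4 - 2)"
      unfolding s_def power_mult_distrib power2_sum
      by (simp add: algebra_simps flip: power_mult power_add)
    then show "[s^2 = 2] (mod int p)" using z4' by (simp add: cong_iff_dvd_diff)
  qed
qed

lemma gauss_sum_1 [simp]: "gauss_sum 1 a = 1"
proof -
  have "{0..<1} = {0 :: int}" by auto
  then show ?thesis by (simp add: gauss_sum_def efrac_def)
qed

lemma eta_inversion_imaginary:
  assumes "y > 0"
  shows "eta (\<i> * of_real (1 / y)) = of_real (sqrt y) * eta (\<i> * of_real y)"
  using eta_inversion[of 1 0 0 "1 / y"] assms by (simp add: real_sqrt_divide)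

text \<open>Applying the inversion twice at y = 1 returns the same nonzero value of eta, so the
  Gauss sums of a and b multiply to p. Up to a square b is -1/a, hence -a, hence a, because -1 is a
  square modulo p; so both sums coincide.\<close>

lemma gauss_sum_power2:
  assumes p: "prime p" "[p = 1] (mod 24)" and a: "coprime a (int p)"
  shows "gauss_sum (int p) a ^ 2 = of_nat p"
proof -
  have p0: "int p > 0" using p(1) by (simp add: prime_gt_0_nat)
  have p8: "[p = 1] (mod 8)" using p(2) by (rule cong_dvd_modulus_nat) simp
  have "[p = 1] (mod 12)" using p(2) by (rule cong_dvd_modulus_nat) simp
  then have "[int p = int 1] (mod int 12)" unfolding cong_int_iff .
  then have p12: "[int p = 1] (mod 12)" by simp
  have "coprime p 24" using cong_imp_coprime[OF cong_sym[OF p(2)]] by simp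
  then have "coprime 24 p" by (simp only: coprime_commute)
  then have "coprime (int 24) (int p)" unfolding coprime_int_iff .
  then have co24: "coprime 24 (int p)" by simp
  have "coprime (576 * a) (int p)"
    using co24 a coprime_mult_left_iff[of "24 * 24" a "int p"] coprime_mult_left_iff[of 24 24 "int p"] by simp
  then obtain b' where b': "[576 * a * b' = 1] (mod int p)" using cong_solve_coprime_int by blast
  define b where "b = - b'"
  have ab: "[576 * a * b = -1] (mod int p)"
    using cong_minus_minus_iff[of "576 * a * b'" 1 "int p"] b' by (simp add: b_def)
  obtain i s :: int where i: "[i^2 = -1] (mod int p)" using prime_1_mod_8_squares[OF p(1) p8] .
  have "coprime (i^2) (int p)" by (rule cong_imp_coprime[OF cong_sym[OF i]]) simp
  then have coi: "coprime i (int p)" by simp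
  have "[a * i^2 = a * (-1)] (mod int p)" using i by (rule cong_scalar_left)
  also have "[a * (-1) = a * (576 * a * b)] (mod int p)" using ab by (intro cong_scalar_left cong_sym[OF ab])
  finally have "[a * i^2 = b * (24 * a)^2] (mod int p)" by (simp add: power2_eq_square mult_ac)
  from gauss_sum_mult_square[OF p0 coi cong_sym[OF this]]
  have "gauss_sum (int p) (b * (24 * a)^2) = gauss_sum (int p) a" .
  moreover have "gauss_sum (int p) (b * (24 * a)^2) = gauss_sum (int p) b"
    by (rule gauss_sum_mult_square[OF p0, of "24 * a"]) (use co24 a in auto)
  ultimately have gb: "gauss_sum (int p) b = gauss_sum (int p) a" by simp
  have ba: "[576 * b * a = -1] (mod int p)" using ab by (simp add: mult_ac)
  let ?\<eta> = "eta ((\<i> * of_real 1 + 24 * of_int a) / of_int (int p))"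
  have "?\<eta> = of_real (1 / sqrt (real p)) * gauss_sum (int p) a * (of_real (1 / sqrt (real p)) * gauss_sum (int p) b * ?\<eta>)"
    using eta_inversion[OF p0 p12 ab, of 1] eta_inversion[OF p0 p12 ba, of 1] by simp
  moreover have "?\<eta> \<noteq> 0" using p0 by (intro eta_nonzero) (simp only: Im_shifted_imaginary, simp)
  moreover have "complex_of_real (1 / sqrt (real p)) * of_real (1 / sqrt (real p)) = 1 / of_nat p"
    by (simp flip: of_real_mult)
  ultimately show ?thesis using p0 gb by (simp add: power2_eq_square field_simps)
qed

lemma gauss_sum_double:
  assumes p: "prime p" "[p = 1] (mod 24)"
  shows "gauss_sum (int p) (2 * a) = gauss_sum (int p) a"
proof -
  have p0: "int p > 0" using p(1) by (simp add: prime_gt_0_nat)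
  have p8: "[p = 1] (mod 8)" using p(2) by (rule cong_dvd_modulus_nat) simp
  have "[p = 1] (mod 2)" using p(2) by (rule cong_dvd_modulus_nat) simp
  then have co: "coprime 2 (int p)" by (auto simp: unique_euclidean_semiring_class.cong_def odd_iff_mod_2_eq_one)
  obtain i s :: int where s: "[s^2 = 2] (mod int p)" using prime_1_mod_8_squares[OF p(1) p8] .
  have "coprime (s^2) (int p)" by (rule cong_imp_coprime[OF cong_sym[OF s] co])
  then have cos: "coprime s (int p)" by simp
  have "[a * s^2 = a * 2] (mod int p)" using s by (rule cong_scalar_left)
  then have "[2 * a = a * s^2] (mod int p)" by (simp add: cong_sym mult.commute)
  then show ?thesis by (rule gauss_sum_mult_square[OF p0 cos])
qed

text \<open>With w = k - 1 this is the Hecke operator of weight k. The translates are by 48 j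
  because F and its companion have periods 24 and 48 instead of 1; as 48 is invertible modulo p, 48
  j still runs through all residues.\<close>

definition hecke_op :: "nat \<Rightarrow> nat \<Rightarrow> (complex \<Rightarrow> complex) \<Rightarrow> complex \<Rightarrow> complex" where
  "hecke_op p w \<Phi> z = of_nat p ^ w * \<Phi> (of_nat p * z) + (\<Sum>j<p. \<Phi> ((z + 48 * of_nat j) / of_nat p)) / of_nat p"

lemma prod_power_half:
  assumes "y > 0" "r = 2 * k - 1" "k > 0"
  shows "sqrt y ^ r * sqrt (y / 2) = y ^ k / sqrt 2"
proof -
  have "sqrt y ^ r * sqrt y = sqrt y ^ (2 * k)"
    using assms by (cases k) (auto simp: power_Suc2[symmetric] simp del: power_Suc)
  also have "\<dots> = y ^ k" using assms by (simp add: power_mult)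
  finally show ?thesis by (simp add: real_sqrt_divide)
qed

text \<open>The functions \<open>F\<close> and \<open>F'\<close> below are interchanged by \<open>z \<mapsto> -1 / z\<close>; the Hecke operator respects this
  because the inversion permutes the translates \<open>(z + 48 * j) / p\<close>, up to Gauss sums which multiply up to \<open>p ^ k\<close>.\<close>

lemma hecke_op_inversion:
  fixes p r k :: nat
  defines "F \<equiv> \<lambda>z. eta z ^ r * eta (2 * z)" and "F' \<equiv> \<lambda>z. eta z ^ r * eta (z / 2)"
  assumes p: "prime p" "[p = 1] (mod 24)" and rk: "r = 2 * k - 1" "k > 0" and y: "y > 0"
  shows "F (\<i> * of_real (1 / y)) = of_real (y ^ k / sqrt 2) * F' (\<i> * of_real y)"
    and "hecke_op p (k - 1) F (\<i> * of_real (1 / y)) = of_real (y ^ k / sqrt 2) * hecke_op p (k - 1) F' (\<i> * of_real y)"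
proof -
  have p0: "p > 0" using p(1) by (simp add: prime_gt_0_nat)
  have p1: "p > 1" using p(1) by (rule prime_gt_1_nat)
  have pc: "complex_of_nat p \<noteq> 0" using p0 by simp
  have "[p = 1] (mod 12)" using p(2) by (rule cong_dvd_modulus_nat) simp
  then have "[int p = int 1] (mod int 12)" unfolding cong_int_iff .
  then have p12: "int p > 0" "[int p = 1] (mod 12)" using p0 by simp_all
  have inv: "F (\<i> * of_real (1 / y)) = of_real (y ^ k / sqrt 2) * F' (\<i> * of_real y)" if y: "y > 0" for y
  proof -
    have "eta (2 * (\<i> * of_real (1 / y))) = eta (\<i> * of_real (1 / (y / 2)))" by (simp add: mult_ac)
    also have "\<dots> = of_real (sqrt (y / 2)) * eta (\<i> * of_real (y / 2))"
      by (rule eta_inversion_imaginary) (use y in simp)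
    finally have "F (\<i> * of_real (1 / y)) = of_real (sqrt y ^ r * sqrt (y / 2)) * F' (\<i> * of_real y)"
      unfolding F_def F'_def eta_inversion_imaginary[OF y] by (simp add: power_mult_distrib)
    then show ?thesis unfolding prod_power_half[OF y rk] .
  qed
  show "F (\<i> * of_real (1 / y)) = of_real (y ^ k / sqrt 2) * F' (\<i> * of_real y)" by (rule inv[OF y])
  \<comment> \<open>Inversion exchanges multiplication of the argument by p with division by p, so
    the first Hecke term and the translate j = 0 trade places; the powers of p match by p^k =
    p^(k-1) p.\<close>
  have t1: "of_nat p ^ (k - 1) * F (of_nat p * (\<i> * of_real (1 / y))) =
      of_real (y ^ k / sqrt 2) * (F' ((\<i> * of_real y) / of_nat p) / of_nat p)"
  proof -
    have e: "of_nat p * (\<i> * of_real (1 / y)) = \<i> * of_real (1 / (y / real p))" by (simp add: mult.commute)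
    have "F (of_nat p * (\<i> * of_real (1 / y))) = of_real ((y / real p) ^ k / sqrt 2) * F' (\<i> * of_real (y / real p))"
      unfolding e by (rule inv) (use y p0 in simp)
    moreover have "complex_of_nat p ^ k = of_nat p ^ (k - 1) * of_nat p" using rk by (cases k) auto
    ultimately show ?thesis using pc by (simp add: power_divide field_simps)
  qed
  have t2: "F ((\<i> * of_real (1 / y)) / of_nat p) / of_nat p =
      of_real (y ^ k / sqrt 2) * (of_nat p ^ (k - 1) * F' (of_nat p * (\<i> * of_real y)))"
  proof -
    have e: "(\<i> * of_real (1 / y)) / of_nat p = \<i> * of_real (1 / (y * real p))" by simp
    have "F ((\<i> * of_real (1 / y)) / of_nat p) = of_real ((y * real p) ^ k / sqrt 2) * F' (\<i> * of_real (y * real p))"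
      unfolding e by (rule inv) (use y p0 in simp)
    moreover have "complex_of_nat p ^ k = of_nat p ^ (k - 1) * of_nat p" using rk by (cases k) auto
    ultimately show ?thesis using pc by (simp add: power_mult_distrib field_simps)
  qed
  \<comment> \<open>The inversion of eta is used with shifts 48 j = 24 (2 j) and 48 l = 24 (2 l),
    and for the factor with doubled argument with 96 j = 24 (4 j) and 24 l. Both conditions reduce
    to the same congruence, as 2304 = 48^2.\<close>
  have t3: "F ((\<i> * of_real (1 / y) + 48 * of_nat j) / of_nat p) =
      of_real (y ^ k / sqrt 2) * F' ((\<i> * of_real y + 48 * of_nat l) / of_nat p)"
    if jl: "[2304 * int j * int l = -1] (mod int p)" for j l
  proof -
    have "[576 * (2 * int j) * (2 * int l) = -1] (mod int p)" using jl by (simp add: mult_ac)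
    from eta_inversion[OF p12 this, of "1 / y"] y
    have e1: "eta ((\<i> * of_real (1 / y) + 48 * of_nat j) / of_nat p) =
        of_real (1 / sqrt (real p / y)) * gauss_sum (int p) (2 * int j) * eta ((\<i> * of_real y + 48 * of_nat l) / of_nat p)"
      by (simp add: mult_ac)
    have "[576 * (4 * int j) * int l = -1] (mod int p)" using jl by (simp add: mult_ac)
    from eta_inversion[OF p12 this, of "2 / y"] y
    have e2': "eta ((\<i> * of_real (2 / y) + 24 * of_int (4 * int j)) / of_nat p) =
        of_real (1 / sqrt (real p * (2 / y))) * gauss_sum (int p) (4 * int j) * eta ((\<i> * of_real (1 / (2 / y)) + 24 * of_nat l) / of_nat p)"
      by simp
    have z1: "(\<i> * of_real (2 / y) + 24 * of_int (4 * int j)) / of_nat p = 2 * ((\<i> * of_real (1 / y) + 48 * of_nat j) / of_nat p)"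
      by (simp add: field_simps)
    have z2: "(\<i> * of_real (1 / (2 / y)) + 24 * of_nat l) / of_nat p = ((\<i> * of_real y + 48 * of_nat l) / of_nat p) / 2"
      by (simp add: field_simps)
    from e2' have e2: "eta (2 * ((\<i> * of_real (1 / y) + 48 * of_nat j) / of_nat p)) =
        of_real (1 / sqrt (real p * (2 / y))) * gauss_sum (int p) (4 * int j) * eta (((\<i> * of_real y + 48 * of_nat l) / of_nat p) / 2)"
      unfolding z1 z2 .
    have "coprime (-1) (int p)" by simp
    then have "coprime (2304 * int j * int l) (int p)" using cong_imp_coprime[OF cong_sym[OF jl]] by blast
    then have "coprime (int j) (int p)" by simp
    then have g2: "gauss_sum (int p) (int j) ^ 2 = of_nat p" by (rule gauss_sum_power2[OF p])
    have "gauss_sum (int p) (2 * int j) = gauss_sum (int p) (int j)" by (rule gauss_sum_double[OF p])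
    moreover have "gauss_sum (int p) (4 * int j) = gauss_sum (int p) (2 * int j)"
      using gauss_sum_double[OF p, of "2 * int j"] by simp
    \<comment> \<open>The r + 1 = 2k equal Gauss sums, each of square p, give the p^k that cancels
      the denominator of (y / p)^k.\<close>
    moreover have "gauss_sum (int p) (int j) ^ r * gauss_sum (int p) (int j) = of_nat p ^ k"
    proof -
      have "gauss_sum (int p) (int j) ^ r * gauss_sum (int p) (int j) = gauss_sum (int p) (int j) ^ (2 * k)"
        using rk by (cases k) (auto simp: power_Suc2[symmetric] simp del: power_Suc)
      then show ?thesis using g2 by (simp add: power_mult)
    qed
    ultimately have g: "gauss_sum (int p) (2 * int j) ^ r * gauss_sum (int p) (4 * int j) = of_nat p ^ k" by simp
    have "1 / sqrt (real p / y) = sqrt (y / real p)" "1 / sqrt (real p * (2 / y)) = sqrt ((y / real p) / 2)"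
      by (simp_all add: real_sqrt_divide real_sqrt_mult)
    moreover have "sqrt (y / real p) ^ r * sqrt ((y / real p) / 2) = (y / real p) ^ k / sqrt 2"
      by (rule prod_power_half) (use y p0 rk in auto)
    ultimately have s: "(1 / sqrt (real p / y)) ^ r * (1 / sqrt (real p * (2 / y))) = (y / real p) ^ k / sqrt 2" by simp
    have regroup: "(of_real c * g * h) ^ r * (of_real c' * g' * h') = of_real (c ^ r * c') * (g ^ r * g') * (h ^ r * h')"
      for c c' :: real and g g' h h' :: complex
      by (simp add: power_mult_distrib mult_ac)
    have "F ((\<i> * of_real (1 / y) + 48 * of_nat j) / of_nat p) =
       of_real ((1 / sqrt (real p / y)) ^ r * (1 / sqrt (real p * (2 / y)))) *
       (gauss_sum (int p) (2 * int j) ^ r * gauss_sum (int p) (4 * int j)) * F' ((\<i> * of_real y + 48 * of_nat l) / of_nat p)"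
      unfolding F_def F'_def e1 e2 by (rule regroup)
    also have "\<dots> = of_real (y ^ k / sqrt 2) * F' ((\<i> * of_real y + 48 * of_nat l) / of_nat p)"
      unfolding s g using pc by (simp add: power_divide)
    finally show ?thesis .
  qed
  \<comment> \<open>Translates j and l are partners when 48 j and 48 l have product -1 modulo p. The
    relation is symmetric and partners are unique, so it defines an involution of the nonzero
    residues by which the sum is reindexed.\<close>
  define R where "R j l \<longleftrightarrow> l \<in> {1..<p} \<and> [2304 * int j * int l = -1] (mod int p)" for j l :: nat
  have R_ex: "\<exists>l. R j l" if j: "j \<in> {1..<p}" for j
  proof -
    have "coprime p 24" using cong_imp_coprime[OF cong_sym[OF p(2)]] by simp
    then have "coprime (24 ^ 3) p" unfolding coprime_power_left_iff by (simp add: coprime_commute)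
    then have "coprime 2304 p" by (rule coprime_divisors[rotated 2]) auto
    moreover have "\<not> p dvd j" using j by (auto dest: dvd_imp_le)
    then have "coprime p j" using p(1) by (intro prime_imp_coprime)
    ultimately have "coprime (2304 * j) p" by (simp add: coprime_commute)
    then have "coprime (int (2304 * j)) (int p)" unfolding coprime_int_iff .
    then obtain x where x: "[int (2304 * j) * x = 1] (mod int p)" using cong_solve_coprime_int by blast
    define l where "l = nat ((- x) mod int p)"
    have il: "int l = (- x) mod int p" using p0 by (simp add: l_def)
    have "[int l = - x] (mod int p)" unfolding il by (simp add: unique_euclidean_semiring_class.cong_def)
    then have "[int (2304 * j) * int l = int (2304 * j) * (- x)] (mod int p)" by (rule cong_scalar_left)
    moreover have "[int (2304 * j) * (- x) = -1] (mod int p)"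
      using x cong_minus_minus_iff[of "int (2304 * j) * x" 1 "int p"] by simp
    ultimately have c: "[2304 * int j * int l = -1] (mod int p)" using cong_trans by fastforce
    have "l \<noteq> 0"
    proof
      assume "l = 0"
      then have "int p dvd 1" using c by (simp add: cong_iff_dvd_diff)
      then show False using p1 by simp
    qed
    moreover have "l < p" using il p0 by (metis of_nat_0_less_iff of_nat_less_iff pos_mod_bound)
    ultimately show ?thesis unfolding R_def using c by (intro exI[of _ l]) auto
  qed
  have R_sym: "R l j" if "R j l" "j \<in> {1..<p}" for j l
    using that by (simp add: R_def mult_ac)
  have R_unique: "l = l'" if "R j l" "R j l'" for j l l'
  proof -
    have "coprime (-1) (int p)" by simp
    then have "coprime (2304 * int j * int l) (int p)" using that(1) cong_imp_coprime[OF cong_sym] unfolding R_def by blast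
    then have co: "coprime (2304 * int j) (int p)" by simp
    have "[2304 * int j * int l = 2304 * int j * int l'] (mod int p)"
      using that unfolding R_def by (meson cong_sym cong_trans)
    then have "[int l = int l'] (mod int p)" using co by (simp only: cong_mult_lcancel)
    then have "[l = l'] (mod p)" by (simp only: cong_int_iff)
    then show ?thesis using that by (auto simp: R_def unique_euclidean_semiring_class.cong_def)
  qed
  define \<sigma> where "\<sigma> j = (SOME l. R j l)" for j
  have \<sigma>: "R j (\<sigma> j)" if "j \<in> {1..<p}" for j
    unfolding \<sigma>_def using R_ex[OF that] by (rule someI_ex)
  have \<sigma>_mem: "\<sigma> j \<in> {1..<p}" if "j \<in> {1..<p}" for j using \<sigma>[OF that] by (simp add: R_def)
  have \<sigma>\<sigma>: "\<sigma> (\<sigma> j) = j" if "j \<in> {1..<p}" for j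
    using R_unique[OF \<sigma>[OF \<sigma>_mem[OF that]] R_sym[OF \<sigma>[OF that] that]] .
  have split: "(\<Sum>j<p. f j) = f 0 + (\<Sum>j\<in>{1..<p}. f j)" for f :: "nat \<Rightarrow> complex"
  proof -
    have "{..<p} = insert 0 {1..<p}" using p0 by auto
    then show ?thesis by simp
  qed
  have "(\<Sum>j\<in>{1..<p}. F ((\<i> * of_real (1 / y) + 48 * of_nat j) / of_nat p)) =
      (\<Sum>j\<in>{1..<p}. of_real (y ^ k / sqrt 2) * F' ((\<i> * of_real y + 48 * of_nat (\<sigma> j)) / of_nat p))"
    using \<sigma> by (intro sum.cong refl t3) (simp add: R_def)
  also have "\<dots> = (\<Sum>j\<in>{1..<p}. of_real (y ^ k / sqrt 2) * F' ((\<i> * of_real y + 48 * of_nat j) / of_nat p))"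
    by (rule sum.reindex_bij_witness[of _ \<sigma> \<sigma>]) (use \<sigma>\<sigma> \<sigma>_mem in auto)
  also have "\<dots> = of_real (y ^ k / sqrt 2) * (\<Sum>j\<in>{1..<p}. F' ((\<i> * of_real y + 48 * of_nat j) / of_nat p))"
    by (simp add: sum_distrib_left)
  finally have t4: "(\<Sum>j\<in>{1..<p}. F ((\<i> * of_real (1 / y) + 48 * of_nat j) / of_nat p)) = \<dots>" .
  have "hecke_op p (k - 1) F (\<i> * of_real (1 / y)) =
      of_nat p ^ (k - 1) * F (of_nat p * (\<i> * of_real (1 / y))) + F ((\<i> * of_real (1 / y)) / of_nat p) / of_nat p +
      (\<Sum>j\<in>{1..<p}. F ((\<i> * of_real (1 / y) + 48 * of_nat j) / of_nat p)) / of_nat p"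
    unfolding hecke_op_def split by (simp add: add_divide_distrib)
  also have "\<dots> = of_real (y ^ k / sqrt 2) * (F' ((\<i> * of_real y) / of_nat p) / of_nat p + of_nat p ^ (k - 1) * F' (of_nat p * (\<i> * of_real y)) +
      (\<Sum>j\<in>{1..<p}. F' ((\<i> * of_real y + 48 * of_nat j) / of_nat p)) / of_nat p)"
    unfolding t1 t2 t4 by (simp add: distrib_left)
  also have "\<dots> = of_real (y ^ k / sqrt 2) * hecke_op p (k - 1) F' (\<i> * of_real y)"
    unfolding hecke_op_def split by (simp add: add_divide_distrib)
  finally show "hecke_op p (k - 1) F (\<i> * of_real (1 / y)) = of_real (y ^ k / sqrt 2) * hecke_op p (k - 1) F' (\<i> * of_real y)" .
qed

section \<open>Expansions of eta quotients and the eigenform property\<close>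

definition complex_fps :: "int fps \<Rightarrow> complex fps" where
  "complex_fps F = Abs_fps (\<lambda>n. of_int (fps_nth F n))"

lemma complex_fps_nth [simp]: "fps_nth (complex_fps F) n = of_int (fps_nth F n)"
  by (simp add: complex_fps_def)

lemma complex_fps_mult: "complex_fps (F * G) = complex_fps F * complex_fps G"
  by (simp add: fps_eq_iff fps_mult_nth)

lemma complex_fps_1: "complex_fps 1 = 1"
  by (simp add: fps_eq_iff)

lemma complex_fps_power: "complex_fps (F ^ n) = complex_fps F ^ n"
  by (induction n) (simp_all add: complex_fps_1 complex_fps_mult)

lemma complex_fps_compose_X_power: "d > 0 \<Longrightarrow> complex_fps (F oo fps_X ^ d) = complex_fps F oo fps_X ^ d"
  by (simp add: fps_eq_iff fps_nth_compose_X_power)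

lemma hecke_fps_nth:
  assumes "p > 0"
  shows "fps_nth (hecke_fps p w \<Delta> C) m = fps_nth C (p * m + \<Delta>) +
    of_nat (p ^ w) * (if \<Delta> \<le> m \<and> p dvd m - \<Delta> then fps_nth C ((m - \<Delta>) div p) else 0)"
  using assms unfolding hecke_fps_def
  by (simp add: fps_nth_compose_X_power fps_X_power_mult_nth mult.assoc flip: fps_of_nat of_nat_power)

lemma complex_fps_hecke: "p > 0 \<Longrightarrow> complex_fps (hecke_fps p w \<Delta> C) = hecke_fps p w \<Delta> (complex_fps C)"
  by (simp add: fps_eq_iff hecke_fps_nth)

lemma eball_ge_1: "R \<ge> 1 \<Longrightarrow> norm q < 1 \<Longrightarrow> ereal (norm q) < R"
  by (metis ereal_less(3) less_le_trans)

lemma fps_conv_radius_ge_1_mult: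
  fixes F G :: "complex fps"
  assumes "fps_conv_radius F \<ge> 1" "fps_conv_radius G \<ge> 1"
  shows "fps_conv_radius (F * G) \<ge> 1"
  using assms fps_conv_radius_mult[of F G] by (auto simp: min_def split: if_splits)

lemma fps_conv_radius_ge_1_power:
  fixes F :: "complex fps"
  shows "fps_conv_radius F \<ge> 1 \<Longrightarrow> fps_conv_radius (F ^ n) \<ge> 1"
  by (rule order_trans[OF _ fps_conv_radius_power])

lemma holomorphic_on_eval_fps_unit_disc:
  "fps_conv_radius (F :: complex fps) \<ge> 1 \<Longrightarrow> eval_fps F holomorphic_on ball 0 1"
  by (intro holomorphic_on_eval_fps) (auto simp: eball_ge_1)

lemma fps_conv_radius_euler: "fps_conv_radius (complex_fps euler_fps) \<ge> 1"
proof (rule fps_conv_radius_ge_1I)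
  fix r :: real assume "0 < r" "r < 1"
  then show "summable (\<lambda>n. fps_nth (complex_fps euler_fps) n * of_real r ^ n)"
    using summable_norm_cancel[OF euler_function_summable[of "of_real r"]] by simp
qed

lemma eval_fps_euler: "eval_fps (complex_fps euler_fps) q = euler_function q"
  by (simp add: eval_fps_def euler_function_def)

definition eta_quotient_fps :: "nat \<Rightarrow> int fps" where
  "eta_quotient_fps r = euler_fps ^ r * (euler_fps oo fps_X ^ 2)"

lemma euler_fps_0: "fps_nth euler_fps 0 = 1"
  using euler_fps_nth[of 0 0] by simp

lemma eta_quotient_fps_0: "fps_nth (eta_quotient_fps r) 0 = 1"
  by (simp add: eta_quotient_fps_def euler_fps_0 fps_nth_compose_X_power fps_power_zeroth_eq_one)

text \<open>Both cusps are covered at once: a = 1, b = 2 in the variable e(z) gives the series of F,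
  and a = 2, b = 1 in the variable e(z/2) that of its companion. Absence of zeros makes the
  quotients of the Hecke images by these series holomorphic.\<close>

lemma eval_eta_product:
  fixes a b i j :: nat
  defines "E \<equiv> complex_fps euler_fps"
  assumes "a > 0" "b > 0"
  defines "C \<equiv> (E oo fps_X ^ a) ^ i * (E oo fps_X ^ b) ^ j"
  shows "fps_conv_radius C \<ge> 1"
    and "norm q < 1 \<Longrightarrow> eval_fps C q = euler_function (q ^ a) ^ i * euler_function (q ^ b) ^ j"
    and "norm q < 1 \<Longrightarrow> eval_fps C q \<noteq> 0"
proof -
  have E: "fps_conv_radius E \<ge> 1" unfolding E_def by (rule fps_conv_radius_euler)
  note rad = fps_conv_radius_ge_1_power fps_conv_radius_compose_X_power[OF assms(2) E]
    fps_conv_radius_compose_X_power[OF assms(3) E]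
  show "fps_conv_radius C \<ge> 1"
    unfolding C_def by (intro fps_conv_radius_ge_1_mult rad)
  assume q: "norm q < 1"
  have "eval_fps C q = eval_fps ((E oo fps_X ^ a) ^ i) q * eval_fps ((E oo fps_X ^ b) ^ j) q"
    unfolding C_def by (intro eval_fps_mult eball_ge_1 rad q)
  also have "\<dots> = eval_fps (E oo fps_X ^ a) q ^ i * eval_fps (E oo fps_X ^ b) q ^ j"
    by (intro arg_cong2[where f = "(*)"] eval_fps_power eball_ge_1 rad q)
  also have "\<dots> = eval_fps E (q ^ a) ^ i * eval_fps E (q ^ b) ^ j"
    using eval_fps_compose_X_power[OF assms(2) E q] eval_fps_compose_X_power[OF assms(3) E q] by simp
  finally show eq: "eval_fps C q = euler_function (q ^ a) ^ i * euler_function (q ^ b) ^ j"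
    unfolding E_def eval_fps_euler .
  have "norm (q ^ n) < 1" if "n > 0" for n using q that by (simp add: norm_power power_less_one_iff)
  then show "eval_fps C q \<noteq> 0" unfolding eq using assms(2,3) by (simp add: euler_function_nonzero)
qed

lemma imaginary_axis_islimpt: "\<i> islimpt {\<i> * of_real y | y. y > 0}"
  unfolding islimpt_approachable
proof (intro allI impI)
  fix e :: real assume e: "e > 0"
  have "dist (\<i> * of_real (1 + e / 2)) \<i> = e / 2" using e by (simp add: dist_norm algebra_simps norm_mult)
  moreover have "\<i> * of_real (1 + e / 2) \<noteq> \<i>" using e by (simp add: complex_eq_iff)
  ultimately show "\<exists>x'\<in>{\<i> * of_real y | y. y > 0}. x' \<noteq> \<i> \<and> dist x' \<i> < e"
    using e by (intro bexI[of _ "\<i> * of_real (1 + e / 2)"]) (auto intro!: exI[of _ "1 + e / 2"])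
qed

theorem hecke_eigenform:
  fixes p r k :: nat
  assumes p: "prime p" "[p = 1] (mod 24)" and rk: "r = 2 * k - 1" "k > 0" "r \<le> 11"
    and \<Delta>: "\<Delta> = (r + 2) * (p - 1) div 24"
  shows "hecke_fps p (k - 1) \<Delta> (eta_quotient_fps r) =
    fps_const (fps_nth (eta_quotient_fps r) \<Delta>) * eta_quotient_fps r"
proof -
  have p0: "p > 0" and p1: "p > 1" using p(1) prime_gt_0_nat prime_gt_1_nat by blast+
  define E where "E = complex_fps euler_fps"
  have E1: "E oo fps_X ^ 1 = E" by simp
  define C where "C = (E oo fps_X ^ 1) ^ r * (E oo fps_X ^ 2) ^ 1"
  define C' where "C' = (E oo fps_X ^ 2) ^ r * (E oo fps_X ^ 1) ^ 1"
  note C = eval_eta_product[where a = 1 and b = 2 and i = r and j = 1, folded E_def, folded C_def, simplified]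
  note C' = eval_eta_product[where a = 2 and b = 1 and i = r and j = 1, folded E_def, folded C'_def, simplified]
  have CI: "complex_fps (eta_quotient_fps r) = C"
    by (simp add: C_def E_def eta_quotient_fps_def complex_fps_mult complex_fps_power complex_fps_compose_X_power)
  define F where "F z = eta z ^ r * eta (2 * z)" for z
  define F' where "F' z = eta z ^ r * eta (z / 2)" for z
  have F_eq: "F z = e2pi (of_nat (r + 2) * z / of_nat 24) * eval_fps C (e2pi (24 * z / of_nat 24))" if "Im z > 0" for z
  proof -
    have "of_nat (r + 2) * z / of_nat 24 = of_nat r * (z / 24) + (2 * z) / 24" by (simp add: field_simps)
    then have "e2pi (of_nat (r + 2) * z / of_nat 24) = e2pi (z / 24) ^ r * e2pi (2 * z / 24)"
      by (simp only: e2pi_add e2pi_power)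
    moreover have "e2pi z ^ 2 = e2pi (2 * z)" by (simp add: e2pi_power)
    ultimately show ?thesis
      using that C(2)[OF norm_e2pi_less_1[OF that]] eta_eq_euler_function[of z] eta_eq_euler_function[of "2 * z"]
      unfolding F_def by (simp add: power_mult_distrib)
  qed
  have F'_eq: "F' z = e2pi (of_nat (2 * r + 1) * z / of_nat 48) * eval_fps C' (e2pi (24 * z / of_nat 48))" if "Im z > 0" for z
  proof -
    have "of_nat (2 * r + 1) * z / of_nat 48 = of_nat r * (z / 24) + (z / 2) / 24" by (simp add: field_simps)
    then have "e2pi (of_nat (2 * r + 1) * z / of_nat 48) = e2pi (z / 24) ^ r * e2pi (z / 2 / 24)"
      by (simp only: e2pi_add e2pi_power)
    moreover have "e2pi (z / 2) ^ 2 = e2pi z" by (simp add: e2pi_power)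
    moreover have "24 * z / of_nat 48 = z / 2" by simp
    moreover have "Im (z / 2) > 0" using that by simp
    ultimately show ?thesis
      using that C'(2)[OF norm_e2pi_less_1[of "z / 2"]] eta_eq_euler_function[of z] eta_eq_euler_function[of "z / 2"]
      unfolding F'_def by (simp add: power_mult_distrib)
  qed
  define \<Delta>' where "\<Delta>' = (2 * r + 1) * (p - 1) div 24"
  define T where "T = hecke_fps p (k - 1) \<Delta> C"
  define T' where "T' = hecke_fps p (k - 1) \<Delta>' C'"
  have pos: "Im (of_nat p * z) > 0" "Im ((z + 48 * of_nat j) / of_nat p) > 0" if "Im z > 0" for z j
    using that p0 by simp_all
  have hF: "hecke_op p (k - 1) F z = e2pi (of_nat (r + 2) * z / of_nat 24) * eval_fps T (e2pi (24 * z / of_nat 24))" if "Im z > 0" for z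
    unfolding hecke_op_def F_eq[OF pos(1)[OF that]] F_eq[OF pos(2)[OF that]] T_def
    by (rule hecke_expansion(2)[OF C(1) p _ _ _ \<Delta> that]) (use rk in auto)
  have hF': "hecke_op p (k - 1) F' z = e2pi (of_nat (2 * r + 1) * z / of_nat 48) * eval_fps T' (e2pi (24 * z / of_nat 48))" if "Im z > 0" for z
    unfolding hecke_op_def F'_eq[OF pos(1)[OF that]] F'_eq[OF pos(2)[OF that]] T'_def
    by (rule hecke_expansion(2)[OF C'(1) p _ _ _ \<Delta>'_def that]) (use rk in auto)
  have T: "fps_conv_radius T \<ge> 1"
    unfolding T_def by (rule hecke_expansion(1)[OF C(1) p, of "r + 2" 24]) (use rk \<Delta> in auto)
  have T': "fps_conv_radius T' \<ge> 1"
    unfolding T'_def by (rule hecke_expansion(1)[OF C'(1) p, of "2 * r + 1" 48]) (use rk \<Delta>'_def in auto)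
  define h where "h q = eval_fps T q / eval_fps C q" for q
  define h' where "h' q = eval_fps T' q / eval_fps C' q" for q
  have h: "h holomorphic_on ball 0 1"
    unfolding h_def by (intro holomorphic_intros holomorphic_on_eval_fps_unit_disc T C) (use C(3) in auto)
  have h': "h' holomorphic_on ball 0 1"
    unfolding h'_def by (intro holomorphic_intros holomorphic_on_eval_fps_unit_disc T' C') (use C'(3) in auto)
  have hu: "hecke_op p (k - 1) F z / F z = h (e2pi z)" if "Im z > 0" for z
    unfolding hF[OF that] F_eq[OF that] h_def by simp
  have hu': "hecke_op p (k - 1) F' z / F' z = h' (e2pi (z / 2))" if "Im z > 0" for z
    unfolding hF'[OF that] F'_eq[OF that] h'_def by simp
  \<comment> \<open>On the imaginary axis the factor y^k / sqrt 2 from the inversion cancels in the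
    quotient. Both sides are holomorphic in the half-plane and the axis has accumulation points
    there, so the identity extends.\<close>
  have axis: "h (e2pi (-1 / z)) = h' (e2pi (z / 2))" if mem: "z \<in> {\<i> * of_real y | y. y > 0}" for z
  proof -
    obtain y where z: "z = \<i> * of_real y" and y: "y > 0" using mem by blast
    have "-1 / z = \<i> * of_real (1 / y)" using y by (simp add: z field_simps)
    then have "h (e2pi (-1 / z)) = hecke_op p (k - 1) F (\<i> * of_real (1 / y)) / F (\<i> * of_real (1 / y))"
      using hu[of "\<i> * of_real (1 / y)"] y by simp
    also have "\<dots> = hecke_op p (k - 1) F' (\<i> * of_real y) / F' (\<i> * of_real y)"
      using hecke_op_inversion[OF p rk(1,2) y] y unfolding F_def[abs_def] F'_def[abs_def] by simp
    also have "\<dots> = h' (e2pi (z / 2))" using hu'[of z] y by (simp add: z)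
    finally show ?thesis .
  qed
  have inv: "h (e2pi (-1 / z)) = h' (e2pi (z / 2))" if z: "Im z > 0" for z
  proof -
    let ?H = "{z. Im z > 0}"
    have "(\<lambda>z. h (e2pi (-1 / z)) - h' (e2pi (z / 2))) holomorphic_on ?H"
    proof (intro holomorphic_intros)
      have "(h \<circ> (\<lambda>z. e2pi (-1 / z))) holomorphic_on ?H"
      proof (rule holomorphic_on_compose_gen[OF _ h])
        show "(\<lambda>z. e2pi (-1 / z)) holomorphic_on ?H" by (intro holomorphic_intros) auto
        show "(\<lambda>z. e2pi (-1 / z)) ` ?H \<subseteq> ball 0 1"
        proof (clarsimp simp del: divide_minus_left)
          fix z assume z: "Im z > 0"
          then have "Im (-1 / z) > 0" unfolding Im_divide by (intro divide_pos_pos) (auto simp: sum_power2_gt_zero_iff)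
          then show "norm (e2pi (-1 / z)) < 1" by (rule norm_e2pi_less_1)
        qed
      qed
      then show "(\<lambda>z. h (e2pi (-1 / z))) holomorphic_on ?H" by (simp add: o_def)
      have "(h' \<circ> (\<lambda>z. e2pi (z / 2))) holomorphic_on ?H"
        by (rule holomorphic_on_compose_gen[OF _ h']) (auto intro!: holomorphic_intros norm_e2pi_less_1)
      then show "(\<lambda>z. h' (e2pi (z / 2))) holomorphic_on ?H" by (simp add: o_def)
    qed
    moreover have "connected ?H" by (intro convex_connected convex_halfspace_Im_gt)
    ultimately have "h (e2pi (-1 / z)) - h' (e2pi (z / 2)) = 0"
      by (rule analytic_continuation[OF _ open_halfspace_Im_gt, of _ 0 "{\<i> * of_real y | y. y > 0}" \<i>])
        (use axis z imaginary_axis_islimpt in auto)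
    then show ?thesis by simp
  qed
  obtain c where c: "\<And>q. norm q < 1 \<Longrightarrow> h q = c"
    using modular_function_constant[OF h h', of "\<lambda>z. h (e2pi z)"] inv by blast
  have "eval_fps T q = eval_fps (fps_const c * C) q" if "norm q < 1" for q
    using c[OF that] C(3)[OF that] eval_fps_mult[of q "fps_const c" C] eball_ge_1[OF C(1) that] by (simp add: h_def nonzero_divide_eq_eq)
  then have "\<forall>\<^sub>F q in nhds 0. eval_fps T q = eval_fps (fps_const c * C) q"
    unfolding eventually_nhds by (intro exI[of _ "ball 0 1"]) auto
  moreover have "fps_conv_radius (fps_const c * C) \<ge> 1"
    by (intro fps_conv_radius_ge_1_mult C) simp
  ultimately have TC: "T = fps_const c * C"
    using T eball_ge_1[of _ 0] by (intro eval_fps_eqD) (auto simp: zero_ereal_def)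
  have "24 dvd p - 1" using p(2) by (rule cong_to_1_nat)
  then have "24 * \<Delta> = (r + 2) * (p - 1)" unfolding \<Delta> by simp
  then have \<Delta>0: "\<Delta> > 0" using p1 by (intro gr0I) auto
  have C0: "fps_nth C 0 = 1" by (simp flip: CI add: eta_quotient_fps_0)
  \<comment> \<open>The eigenvalue is the constant term of the transformed series: C has constant
    term 1, and since \<Delta> > 0 the second Hecke summand does not contribute at index 0, which
    leaves the coefficient of C at \<Delta>.\<close>
  have "c = fps_nth T 0" unfolding TC by (simp add: C0)
  also have "\<dots> = fps_nth C \<Delta>" using \<Delta>0 p0 by (simp add: T_def hecke_fps_nth)
  finally have cD: "c = of_int (fps_nth (eta_quotient_fps r) \<Delta>)" by (simp flip: CI)
  have "complex_fps (hecke_fps p (k - 1) \<Delta> (eta_quotient_fps r)) = T"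
    using p0 by (simp add: complex_fps_hecke CI T_def)
  also have "\<dots> = complex_fps (fps_const (fps_nth (eta_quotient_fps r) \<Delta>) * eta_quotient_fps r)"
    unfolding TC cD by (simp add: complex_fps_mult CI) (simp add: fps_eq_iff)
  finally show ?thesis by (simp add: fps_eq_iff flip: of_int_mult)
qed

section \<open>Congruences modulo a prime for the Euler product\<close>

lemma fps_mult_nth_cong:
  assumes "\<And>i. i \<le> n \<Longrightarrow> fps_nth F i = fps_nth F' i" "\<And>i. i \<le> n \<Longrightarrow> fps_nth G i = fps_nth G' i"
  shows "fps_nth (F * G) n = fps_nth (F' * G') n"
  unfolding fps_mult_nth using assms by (intro sum.cong) auto

lemma fps_power_nth_cong:
  fixes F G :: "'a::comm_ring_1 fps"
  assumes "\<And>i. i \<le> n \<Longrightarrow> fps_nth F i = fps_nth G i"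
  shows "fps_nth (F ^ m) n = fps_nth (G ^ m) n"
  using assms by (induction m arbitrary: n) (auto intro!: fps_mult_nth_cong)

lemma euler_fps_compose_nth:
  assumes u: "u > 0" and N: "n div u \<le> N"
  shows "fps_nth (euler_fps oo fps_X ^ u) n = fps_nth (\<Prod>k\<in>{1..N}. 1 - fps_X ^ (u * k)) n"
proof -
  have u0: "fps_nth (fps_X ^ u :: int fps) 0 = 0" using u by simp
  have "(\<Prod>k\<in>{1..N}. 1 - fps_X ^ k) oo (fps_X ^ u :: int fps) = (\<Prod>k\<in>{1..N}. 1 - fps_X ^ (u * k))"
    unfolding fps_compose_prod_distrib[OF u0] fps_compose_sub_distrib
    by (simp add: fps_X_power_compose[OF u0] power_mult)
  moreover have "fps_nth (euler_fps oo fps_X ^ u) n = fps_nth ((\<Prod>k\<in>{1..N}. 1 - fps_X ^ k) oo fps_X ^ u) n"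
  proof (cases "u dvd n")
    case True
    then show ?thesis using u N by (simp add: fps_nth_compose_X_power euler_fps_nth)
  qed (use u in \<open>simp add: fps_nth_compose_X_power\<close>)
  ultimately show ?thesis by simp
qed

lemma dvd_diff_mult:
  fixes a b c d m :: "'a::comm_ring_1"
  assumes "m dvd a - b" "m dvd c - d"
  shows "m dvd a * c - b * d"
proof -
  have "a * c - b * d = a * (c - d) + (a - b) * d" by (simp add: algebra_simps)
  then show ?thesis using assms by (metis dvd_add dvd_mult dvd_mult2)
qed

text \<open>The inner binomial coefficients are divisible by l, and odd l turns the last term (-x)^l
  into -(x^l).\<close>

lemma prime_dvd_one_minus_power:
  fixes x :: "'a::comm_ring_1"
  assumes l: "prime l" "odd l"
  shows "of_nat l dvd (1 - x) ^ l - (1 - x ^ l)"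
proof -
  have l0: "l > 0" using l by (simp add: prime_gt_0_nat)
  define t where "t k = of_nat (l choose k) * (- x) ^ k" for k
  have "(1 - x) ^ l = (- x + 1) ^ l" by simp
  also have "\<dots> = (\<Sum>k\<le>l. t k)" unfolding binomial_ring t_def by simp
  also have "{..l} = insert 0 (insert l {1..<l})" using l0 by auto
  also have "(\<Sum>k\<in>insert 0 (insert l {1..<l}). t k) = t 0 + (t l + (\<Sum>k\<in>{1..<l}. t k))" using l0 by simp
  finally have diff: "(1 - x) ^ l - (1 - x ^ l) = (\<Sum>k\<in>{1..<l}. t k)"
    using l(2) by (simp add: t_def)
  have "of_nat l dvd t k" if "k \<in> {1..<l}" for k
  proof -
    have "l dvd l choose k" using that l l0 by (intro dvd_choose_prime) auto
    then have "(of_nat l :: 'a) dvd of_nat (l choose k)" by (auto elim!: dvdE)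
    then show ?thesis unfolding t_def by (rule dvd_mult2)
  qed
  then show ?thesis unfolding diff by (rule dvd_sum)
qed

lemma prime_dvd_prod_one_minus_power:
  fixes x :: "'i \<Rightarrow> 'a::comm_ring_1"
  assumes "prime l" "odd l" "finite S"
  shows "of_nat l dvd (\<Prod>k\<in>S. 1 - x k) ^ l - (\<Prod>k\<in>S. 1 - x k ^ l)"
  using assms(3)
  by (induction S rule: finite_induct)
     (simp_all add: power_mult_distrib dvd_diff_mult prime_dvd_one_minus_power[OF assms(1,2)])

lemma of_nat_dvd_fps_nth: "of_nat l dvd (F :: int fps) \<Longrightarrow> int l dvd fps_nth F n"
  by (auto elim!: dvdE simp flip: fps_of_nat)

text \<open>The coefficient at n sees only the factors with k \<le> n of either product, so the
  factorwise congruence of finite products suffices.\<close>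

lemma euler_fps_prime_power:
  assumes l: "prime l" "odd l"
  shows "int l dvd fps_nth (euler_fps ^ l - (euler_fps oo fps_X ^ l)) n"
proof -
  have l0: "l > 0" using l by (simp add: prime_gt_0_nat)
  define P :: "int fps" where "P = (\<Prod>k\<in>{1..n}. 1 - fps_X ^ k)"
  have "fps_nth (euler_fps ^ l) n = fps_nth (P ^ l) n"
    unfolding P_def by (intro fps_power_nth_cong euler_fps_nth)
  moreover have "fps_nth (euler_fps oo fps_X ^ l) n = fps_nth (\<Prod>k\<in>{1..n}. 1 - (fps_X ^ k) ^ l) n"
    using euler_fps_compose_nth[OF l0, of n n] l0 by (simp add: mult.commute flip: power_mult)
  ultimately have "fps_nth (euler_fps ^ l - (euler_fps oo fps_X ^ l)) n = fps_nth (P ^ l - (\<Prod>k\<in>{1..n}. 1 - (fps_X ^ k) ^ l)) n"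
    by simp
  then show ?thesis
    using of_nat_dvd_fps_nth[OF prime_dvd_prod_one_minus_power[OF l, of "{1..n}" "\<lambda>k. fps_X ^ k :: int fps"]]
    unfolding P_def by simp
qed

text \<open>A series with constant term 1 is a unit also modulo m; the induction on n solves for the
  coefficients of F one after another.\<close>

lemma dvd_fps_mult_cancel:
  fixes E F :: "int fps"
  assumes "fps_nth E 0 = 1" "\<And>n. m dvd fps_nth (E * F) n"
  shows "m dvd fps_nth F n"
proof (induction n rule: less_induct)
  case (less n)
  have "{0..n} = insert 0 {1..n}" by auto
  then have "fps_nth (E * F) n = fps_nth F n + (\<Sum>i\<in>{1..n}. fps_nth E i * fps_nth F (n - i))"
    using assms(1) by (simp add: fps_mult_nth)
  moreover have "m dvd (\<Sum>i\<in>{1..n}. fps_nth E i * fps_nth F (n - i))"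
    using less by (intro dvd_sum dvd_mult) auto
  ultimately show ?case using assms(2)[of n] by (simp add: dvd_add_left_iff)
qed

section \<open>Regular partitions\<close>

definition partitions_in :: "nat set \<Rightarrow> nat \<Rightarrow> nat multiset set" where
  "partitions_in S n = {A. set_mset A \<subseteq> S \<and> \<Sum>\<^sub># A = n}"

lemma finite_partitions_in:
  assumes "0 \<notin> S"
  shows "finite (partitions_in S n)"
proof (rule finite_imageD)
  \<comment> \<open>Regularity with modulus 0 only says that all parts are positive, because 0
    divides no positive number; hence bipartitions with moduli 0, 0 contain all partitions.\<close>
  have "(\<lambda>A. (A, {#} :: nat multiset)) ` partitions_in S n \<subseteq> bipartitions 0 0 n"
    using assms by (auto simp: partitions_in_def bipartitions_def regular_partition_def intro!: gr0I)
  then show "finite ((\<lambda>A. (A, {#} :: nat multiset)) ` partitions_in S n)"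
    by (rule finite_subset) (rule finite_bipartitions)
qed (auto simp: inj_on_def)

text \<open>A partition either avoids k or loses one copy of k. For generating functions this says
  that admitting the part k amounts to division by 1 - q^k.\<close>

lemma card_partitions_in_insert:
  assumes k: "k > 0" "k \<notin> S" "0 \<notin> S"
  shows "card (partitions_in (insert k S) n) =
    card (partitions_in S n) + (if k \<le> n then card (partitions_in (insert k S) (n - k)) else 0)"
proof -
  define Q where "Q = {A \<in> partitions_in (insert k S) n. k \<in># A}"
  have "partitions_in (insert k S) n = partitions_in S n \<union> Q"
    unfolding Q_def partitions_in_def by auto
  moreover have "partitions_in S n \<inter> Q = {}" using k by (auto simp: Q_def partitions_in_def)
  moreover have fin: "finite (partitions_in (insert k S) n)" for n using k by (intro finite_partitions_in) auto
  moreover have "finite Q" unfolding Q_def using fin[of n] by (rule finite_subset[rotated]) blast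
  ultimately have "card (partitions_in (insert k S) n) = card (partitions_in S n) + card Q"
    using finite_partitions_in[OF k(3)] by (simp add: card_Un_disjoint)
  moreover have "card Q = (if k \<le> n then card (partitions_in (insert k S) (n - k)) else 0)"
  proof (cases "k \<le> n")
    case True
    have "Q = add_mset k ` partitions_in (insert k S) (n - k)"
    proof (intro equalityI subsetI)
      fix A assume A: "A \<in> Q"
      then obtain A' where "A = add_mset k A'" unfolding Q_def by (auto dest: multi_member_split)
      with A show "A \<in> add_mset k ` partitions_in (insert k S) (n - k)"
        by (auto simp: Q_def partitions_in_def)
    qed (use True in \<open>auto simp: Q_def partitions_in_def\<close>)
    then show ?thesis using True by (simp add: card_image inj_on_def)
  next
    case False
    have "Q = {}"
    proof (rule equals0I)
      fix A assume A: "A \<in> Q"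
      then obtain A' where "A = add_mset k A'" unfolding Q_def by (auto dest: multi_member_split)
      with A False show False by (auto simp: Q_def partitions_in_def)
    qed
    then show ?thesis using False by simp
  qed
  ultimately show ?thesis by simp
qed

lemma partitions_in_generating_function:
  assumes "finite S" "0 \<notin> S"
  shows "Abs_fps (\<lambda>n. int (card (partitions_in S n))) * (\<Prod>k\<in>S. 1 - fps_X ^ k) = 1"
  using assms
proof (induction S rule: finite_induct)
  case empty
  have "partitions_in {} n = (if n = 0 then {{#}} else {})" for n
    by (auto simp: partitions_in_def)
  then show ?case by (simp add: fps_eq_iff)
next
  case (insert k S)
  have k: "k > 0" "0 \<notin> S" using insert.prems by auto
  have "Abs_fps (\<lambda>n. int (card (partitions_in (insert k S) n))) * (1 - fps_X ^ k) = Abs_fps (\<lambda>n. int (card (partitions_in S n)))"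
    using card_partitions_in_insert[OF k(1) insert.hyps(2) k(2)]
    by (simp add: fps_eq_iff right_diff_distrib fps_X_power_mult_right_nth)
  then show ?case using insert k by (simp add: mult.assoc[symmetric])
qed

definition regular_fps :: "nat \<Rightarrow> int fps" where
  "regular_fps u = Abs_fps (\<lambda>n. int (card {A. regular_partition u A \<and> \<Sum>\<^sub># A = n}))"

text \<open>Only parts up to N affect the coefficient at N. In the truncated product for f_1 the
  factors over non-multiples of u are cancelled by the generating function; the factors over
  multiples of u remain and form a truncation of f_u.\<close>

lemma regular_fps_euler:
  assumes u: "u > 0"
  shows "regular_fps u * euler_fps = euler_fps oo fps_X ^ u"
proof (rule fps_ext)
  fix N
  define S where "S = {k \<in> {1..N}. \<not> u dvd k}"
  define G where "G = Abs_fps (\<lambda>n. int (card (partitions_in S n)))"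
  have S: "finite S" "0 \<notin> S" by (auto simp: S_def)
  have "{A. regular_partition u A \<and> \<Sum>\<^sub># A = n} = partitions_in S n" if "n \<le> N" for n
  proof -
    have "k \<le> N" if "k \<in># A" "\<Sum>\<^sub># A = n" for k A
      using sum_mset.remove[OF that(1)] that(2) \<open>n \<le> N\<close> by linarith
    then show ?thesis
      unfolding partitions_in_def regular_partition_def S_def by (intro Collect_cong) fastforce
  qed
  then have "fps_nth (regular_fps u * euler_fps) N = fps_nth (G * (\<Prod>k\<in>{1..N}. 1 - fps_X ^ k)) N"
    by (intro fps_mult_nth_cong) (simp_all add: regular_fps_def G_def euler_fps_nth)
  also have "(\<Prod>k\<in>{1..N}. 1 - fps_X ^ k :: int fps) = (\<Prod>k\<in>S. 1 - fps_X ^ k) * (\<Prod>k\<in>{1..N} - S. 1 - fps_X ^ k)"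
    by (subst prod.subset_diff[of S "{1..N}"]) (auto simp: S_def mult.commute)
  also have "G * \<dots> = (\<Prod>k\<in>{1..N} - S. 1 - fps_X ^ k)"
    using partitions_in_generating_function[OF S] by (simp add: G_def mult.assoc[symmetric])
  also have "\<dots> = (\<Prod>k\<in>{1..N div u}. 1 - fps_X ^ (u * k))"
  proof (rule prod.reindex_bij_witness[of _ "\<lambda>k. u * k" "\<lambda>k. k div u"])
    fix k assume "k \<in> {1..N div u}"
    then have "1 \<le> k" "k \<le> N div u" by auto
    then have "u * k \<le> u * (N div u)" by simp
    also have "\<dots> \<le> N" by simp
    finally show "u * k \<in> {1..N} - S" using u \<open>1 \<le> k\<close> by (auto simp: S_def)
  qed (use u in \<open>auto simp: S_def div_le_mono elim!: dvdE\<close>)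
  also have "fps_nth \<dots> N = fps_nth (euler_fps oo fps_X ^ u) N"
    by (rule euler_fps_compose_nth[OF u order_refl, symmetric])
  finally show "fps_nth (regular_fps u * euler_fps) N = fps_nth (euler_fps oo fps_X ^ u) N" .
qed

lemma B_eq_regular_fps: "int (B u v n) = fps_nth (regular_fps u * regular_fps v) n"
proof -
  define R where "R u i = {A. regular_partition u A \<and> \<Sum>\<^sub># A = i}" for u i
  have fin: "finite (R u i)" for u i
  proof (rule finite_subset)
    show "R u i \<subseteq> partitions_in {0<..} i" by (auto simp: R_def regular_partition_def partitions_in_def)
  qed (simp add: finite_partitions_in)
  have "bipartitions u v n = (\<Union>i\<in>{0..n}. R u i \<times> R v (n - i))"
    by (auto simp: bipartitions_def R_def)
  moreover have "card (\<Union>i\<in>{0..n}. R u i \<times> R v (n - i)) = (\<Sum>i\<in>{0..n}. card (R u i \<times> R v (n - i)))"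
  proof (rule card_UN_disjoint)
    show "\<forall>i\<in>{0..n}. finite (R u i \<times> R v (n - i))" using fin by blast
    show "\<forall>i\<in>{0..n}. \<forall>j\<in>{0..n}. i \<noteq> j \<longrightarrow> (R u i \<times> R v (n - i)) \<inter> (R u j \<times> R v (n - j)) = {}"
      unfolding R_def by blast
  qed simp
  ultimately have "B u v n = (\<Sum>i\<in>{0..n}. card (R u i \<times> R v (n - i)))"
    unfolding B_def by (simp only:)
  then show ?thesis
    by (simp add: card_cartesian_product fps_mult_nth regular_fps_def R_def)
qed

section \<open>Reduction of B modulo l and the recursion along powers of p\<close>

lemma B_cong_eta_quotient:
  assumes l: "prime l" "odd l"
  shows "[int (B l 2 n) = fps_nth (eta_quotient_fps (l - 2)) n] (mod int l)"
proof -
  have l0: "l > 0" "l \<ge> 2" using l(1) prime_gt_0_nat prime_ge_2_nat by blast+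
  define E where "E = euler_fps"
  define D where "D = euler_fps oo fps_X ^ 2"
  define R where "R = regular_fps l * regular_fps 2"
  \<comment> \<open>Both series are compared after multiplication by f_1^2: the generating function
    of B becomes f_l f_2, the eta quotient becomes f_1^l f_2. These agree modulo l, and f_1^2 has
    constant term 1, so it cancels.\<close>
  have "E ^ 2 * R = (regular_fps l * E) * (regular_fps 2 * E)" by (simp add: R_def power2_eq_square mult_ac)
  also have "\<dots> = (euler_fps oo fps_X ^ l) * D"
    unfolding E_def D_def using l0 by (simp add: regular_fps_euler)
  finally have ER: "E ^ 2 * R = (euler_fps oo fps_X ^ l) * D" .
  have "E ^ 2 * E ^ (l - 2) = E ^ l" using l0 by (simp only: power_add[symmetric] le_add_diff_inverse)
  then have "E ^ 2 * eta_quotient_fps (l - 2) = E ^ l * D"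
    by (simp only: eta_quotient_fps_def E_def D_def mult.assoc[symmetric])
  then have diff: "E ^ 2 * (eta_quotient_fps (l - 2) - R) = (E ^ l - (euler_fps oo fps_X ^ l)) * D"
    unfolding right_diff_distrib left_diff_distrib ER by simp
  have "int l dvd fps_nth (eta_quotient_fps (l - 2) - R) n"
  proof (rule dvd_fps_mult_cancel)
    show "fps_nth (E ^ 2) 0 = 1" by (simp add: E_def euler_fps_0 fps_power_zeroth_eq_one)
    show "int l dvd fps_nth (E ^ 2 * (eta_quotient_fps (l - 2) - R)) n" for n
      unfolding diff unfolding fps_mult_nth E_def
      by (intro dvd_sum dvd_mult2 euler_fps_prime_power l)
  qed
  then show ?thesis
    unfolding B_eq_regular_fps R_def by (simp add: cong_iff_dvd_diff dvd_diff_commute)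
qed

text \<open>The index \<open>N j = p ^ j * n + l * (p ^ j - 1) div 24\<close> is determined by
  \<open>24 * N j + l = p ^ j * (24 * n + l)\<close>.\<close>

lemma B_progression:
  fixes p l n \<alpha> :: nat
  assumes p: "prime p" "[p = 1] (mod 24)" and l: "prime l" "odd l" "l \<le> 13"
    and n: "\<not> p dvd 24 * n + l" and B0: "[B l 2 (l * (p - 1) div 24) = 0] (mod l)"
  shows "[B l 2 (p ^ (2 * \<alpha> + 1) * n + l * (p ^ (2 * \<alpha> + 1) - 1) div 24) = 0] (mod l)"
proof -
  have p0: "p > 0" using p(1) by (simp add: prime_gt_0_nat)
  \<comment> \<open>The weight: the exponent r = l - 2 equals 2k - 1, and l \<le> 13 is the bound r
    \<le> 11.\<close>
  define k where "k = (l - 1) div 2"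
  have l3: "l \<ge> 3" using l(1,2) prime_ge_2_nat[OF l(1)] by (cases "l = 2") auto
  have rk: "l - 2 = 2 * k - 1" "k > 0" "l - 2 \<le> 11"
    using l l3 by (auto simp: k_def elim!: oddE)
  define b where "b = fps_nth (eta_quotient_fps (l - 2))"
  have B_iff: "[B l 2 m = 0] (mod l) \<longleftrightarrow> int l dvd b m" for m
  proof -
    have "[B l 2 m = 0] (mod l) \<longleftrightarrow> [int (B l 2 m) = 0] (mod int l)"
      using cong_int_iff[of "B l 2 m" 0 l] by simp
    also have "\<dots> \<longleftrightarrow> [b m = 0] (mod int l)"
      using B_cong_eta_quotient[OF l(1,2), of m] unfolding b_def by (meson cong_sym cong_trans)
    finally show ?thesis by (simp add: cong_0_iff)
  qed
  define \<Delta> where "\<Delta> = l * (p - 1) div 24"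
  define N where "N j = p ^ j * n + l * (p ^ j - 1) div 24" for j
  have N24: "24 * N j + l = p ^ j * (24 * n + l)" for j
  proof -
    have "[p ^ j = 1 ^ j] (mod 24)" using p(2) by (rule cong_pow)
    then have "[p ^ j = 1] (mod 24)" unfolding power_one .
    then have "24 dvd p ^ j - 1" by (rule cong_to_1_nat)
    then have "24 * (l * (p ^ j - 1) div 24) = l * (p ^ j - 1)" by simp
    moreover have "l * (p ^ j - 1) + l = l * p ^ j" using p0 by (simp add: diff_mult_distrib2)
    ultimately show ?thesis by (simp add: N_def algebra_simps)
  qed
  have \<Delta>24: "24 * \<Delta> + l = p * l"
  proof -
    have "24 dvd p - 1" using p(2) by (rule cong_to_1_nat)
    then have "24 * \<Delta> = l * (p - 1)" by (simp add: \<Delta>_def)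
    moreover have "l * (p - 1) + l = p * l" using p0 by (simp add: diff_mult_distrib2)
    ultimately show ?thesis by simp
  qed
  have N_Suc: "N (Suc j) = p * N j + \<Delta>" for j
  proof -
    have "24 * N (Suc j) + l = p * (24 * N j + l)" unfolding N24 by simp
    then show ?thesis using \<Delta>24 by (simp add: algebra_simps)
  qed
  have rec: "b (p * m + \<Delta>) + int (p ^ (k - 1)) * (if \<Delta> \<le> m \<and> p dvd m - \<Delta> then b ((m - \<Delta>) div p) else 0) = b \<Delta> * b m" for m
  proof -
    have "l - 2 + 2 = l" using l3 by simp
    then have "\<Delta> = (l - 2 + 2) * (p - 1) div 24" by (simp only: \<Delta>_def)
    from arg_cong[OF hecke_eigenform[OF p rk this], of "\<lambda>F. fps_nth F m"] show ?thesis
      unfolding b_def hecke_fps_nth[OF p0] fps_mult_left_const_nth .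
  qed
  have b\<Delta>: "int l dvd b \<Delta>" using B0 unfolding B_iff \<Delta>_def .
  have "int l dvd b (N (2 * \<alpha> + 1))"
  proof (induction \<alpha>)
    case 0
    \<comment> \<open>The hypothesis on n removes the second term of the recursion: 24 n + l = 24 (n
      - \<Delta>) + p l would be divisible by p if n - \<Delta> were.\<close>
    have "\<not> (\<Delta> \<le> n \<and> p dvd n - \<Delta>)"
    proof
      assume *: "\<Delta> \<le> n \<and> p dvd n - \<Delta>"
      have "24 * n + l = 24 * (n - \<Delta>) + (24 * \<Delta> + l)" using conjunct1[OF *] by arith
      then have "24 * n + l = 24 * (n - \<Delta>) + p * l" unfolding \<Delta>24 .
      moreover have "p dvd 24 * (n - \<Delta>) + p * l" using * by simp
      ultimately show False using n by simp
    qed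
    then have "b (p * n + \<Delta>) = b \<Delta> * b n" using rec[of n] by auto
    moreover have "N 1 = p * n + \<Delta>" using N_Suc[of 0] by (simp add: N_def)
    ultimately show ?case using b\<Delta> by simp
  next
    case (Suc \<alpha>)
    \<comment> \<open>At this m the second term of the recursion is the coefficient at N (2 \<alpha>
      + 1), which the induction hypothesis covers. The recursion thus links indices two powers of p
      apart, and only odd exponents are reached.\<close>
    define m where "m = N (2 * \<alpha> + 2)"
    have m: "m = p * N (2 * \<alpha> + 1) + \<Delta>" using N_Suc[of "2 * \<alpha> + 1"] by (simp add: m_def)
    have "N (2 * Suc \<alpha> + 1) = p * m + \<Delta>" using N_Suc[of "2 * \<alpha> + 2"] by (simp add: m_def)
    moreover have "b (p * m + \<Delta>) = b \<Delta> * b m - int (p ^ (k - 1)) * b (N (2 * \<alpha> + 1))"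
      using rec[of m] p0 by (simp add: m)
    ultimately show ?case using b\<Delta> Suc.IH by simp
  qed
  then show ?thesis unfolding B_iff N_def .
qed

theorem theorem1p9:
  fixes p n \<alpha> :: nat
  assumes "prime p" and "[p = 1] (mod 24)"
  shows
    "(\<not> p dvd 24 * n + 7 \<and> [B 7 2 (7 * (p - 1) div 24) = 0] (mod 7) \<longrightarrow>
        [B 7 2 (p ^ (2 * \<alpha> + 1) * n + 7 * (p ^ (2 * \<alpha> + 1) - 1) div 24) = 0] (mod 7)) \<and>
     (\<not> p dvd 24 * n + 11 \<and> [B 11 2 (11 * (p - 1) div 24) = 0] (mod 11) \<longrightarrow>
        [B 11 2 (p ^ (2 * \<alpha> + 1) * n + 11 * (p ^ (2 * \<alpha> + 1) - 1) div 24) = 0] (mod 11)) \<and>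
     (\<not> p dvd 24 * n + 13 \<and> [B 13 2 (13 * (p - 1) div 24) = 0] (mod 13) \<longrightarrow>
        [B 13 2 (p ^ (2 * \<alpha> + 1) * n + 13 * (p ^ (2 * \<alpha> + 1) - 1) div 24) = 0] (mod 13))"
  using B_progression[OF assms, of 7 n \<alpha>] B_progression[OF assms, of 11 n \<alpha>] B_progression[OF assms, of 13 n \<alpha>]
  by simp

end
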